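(* Let $0<p\le\infty$, and let $s>1/4$ if $p\le4$ and $s>1/2-1/p$ if $p>4$ (with $1/\infty=0$). Let $R_s(x)=\sum_{n=1}^\infty n^{-2s}e^{2\pi i n^2x}$ and, for $N\in\mathbb N$, $(R_s)_{\ge N}(x)=\sum_{n\ge1,\,n^2\ge N}n^{-2s}e^{2\pi i n^2x}$. Then for all sufficiently large $N$, \[ \|(R_s)_{\ge N}\|_{L^p(\mathbb T)}\simeq_{s,p}\begin{cases}N^{1/4-s}, & p<4,\\ N^{1/4-s}(\log N)^{1/4}, & p=4,\\ N^{1/2-1/p-s}, & p>4,\end{cases} \] interpreting $1/p=0$ when $p=\infty$.
   Context: $\mathbb T=\mathbb R/\mathbb Z$. The series are understood as limits in $L^p(\mathbb T)$ of their partial sums. $\simeq_{s,p}$ means two-sided bounds with constants depending only on $s,p$ (not on $N$). *)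

theory Defs
  imports "HOL-Analysis.Analysis"
begin

text \<open>Functions on the torus T = R/Z are represented by functions real => complex,
  of which only the values on the fundamental domain [0,1] matter.
  The exponent p ranges over (0, infinity], encoded as an ennreal.\<close>

definition inv_exp :: "ennreal \<Rightarrow> real" where
  "inv_exp p = (if p = \<infinity> then 0 else 1 / enn2real p)"

definition Lp_norm :: "ennreal \<Rightarrow> (real \<Rightarrow> complex) \<Rightarrow> ennreal" where
  "Lp_norm p f =
     (if p = \<infinity> then
        Inf {C :: ennreal. AE x in lebesgue_on {0..1}. ennreal (norm (f x)) \<le> C}
      else
        (let I = (\<integral>\<^sup>+ x. ennreal (norm (f x) powr enn2real p) \<partial>(lebesgue_on {0..1}))
         in if I = \<infinity> then \<infinity> else ennreal (enn2real I powr (1 / enn2real p))))"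

definition tail_partial :: "real \<Rightarrow> nat \<Rightarrow> nat \<Rightarrow> real \<Rightarrow> complex" where
  "tail_partial s N M x =
     (\<Sum>n\<in>{n. 1 \<le> n \<and> n \<le> M \<and> N \<le> n^2}.
        complex_of_real (real n powr (-2 * s)) * cis (2 * pi * real (n^2) * x))"

definition is_tail_limit :: "ennreal \<Rightarrow> real \<Rightarrow> nat \<Rightarrow> (real \<Rightarrow> complex) \<Rightarrow> bool" where
  "is_tail_limit p s N f \<longleftrightarrow>
     f \<in> borel_measurable lebesgue \<and>
     ((\<lambda>M. Lp_norm p (\<lambda>x. tail_partial s N M x - f x)) \<longlonglongrightarrow> 0)"

definition rate :: "ennreal \<Rightarrow> real \<Rightarrow> nat \<Rightarrow> real" where
  "rate p s N =
     (if p < 4 then real N powr (1/4 - s)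
      else if p = 4 then real N powr (1/4 - s) * ln (real N) powr (1/4)
      else real N powr (1/2 - inv_exp p - s))"

end

theory Submission
  imports Defs "HOL-Number_Theory.Number_Theory"
begin

text \<open>
  Upper bounds. For a weight that is Lipschitz at scale \<open>L\<close> with second differences summing to
  \<open>O(1/L)\<close>, Weyl differencing followed by two summations by parts bounds the square of the
  exponential sum over a window of length \<open>L\<close> by \<open>C / (q (L\<^sup>-\<^sup>2 + |x - a/q|))\<close> when \<open>a/q\<close> is a Dirichlet
  approximation to \<open>x\<close> of level \<open>16 L\<close>; the smoothness of the weight is what prevents a logarithmic loss.
  Summing the integrals of the majorant over all \<open>a/q\<close> gives the sharp \<open>L\<^sup>r\<close> norm for every \<open>r > 2\<close>.
  A sharp cutoff is a telescoping sum of such weights at dyadic scales, so it obeys the same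
  bound, and partial summation inserts the coefficients \<open>n powr (-2 s)\<close>.

  Lower bounds. For \<open>p < 2\<close>, interpolate the exact \<open>L\<^sup>2\<close> norm between \<open>L\<^sup>p\<close> and \<open>L\<^sup>3\<close>; for \<open>2 \<le> p < 4\<close> it
  is a lower bound itself. For \<open>p = 4\<close>, count solutions of \<open>n\<^sub>1\<^sup>2 + n\<^sub>2\<^sup>2 = n\<^sub>3\<^sup>2 + n\<^sub>4\<^sup>2\<close>. For \<open>4 < p < \<infinity>\<close>,
  test against a Fejer kernel, and for \<open>p = \<infinity>\<close> evaluate at \<open>0\<close>.

  The tail beyond \<open>n\<^sup>2 \<ge> N\<close> is an \<open>L\<^sup>p\<close> limit of blocks starting at \<open>a \<approx> \<surd>N\<close>, whose norms are
  comparable to the rate at \<open>a\<^sup>2\<close>; the rate changes only by a bounded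
  factor when its argument does.
\<close>

subsection \<open>Power means on the unit interval\<close>

lemma weighted_geometric_mean_le:
  fixes a b \<theta> :: real
  assumes "0 < \<theta>" "\<theta> < 1" "0 \<le> a" "0 \<le> b"
  shows "a powr \<theta> * b powr (1 - \<theta>) \<le> \<theta> * a + (1 - \<theta>) * b"
proof (cases "a = 0 \<or> b = 0")
  case False
  then show ?thesis using assms by (intro Youngs_inequality_0) auto
qed (use assms in auto)

lemma integral_geometric_mean_le:
  fixes u v :: "'a::euclidean_space \<Rightarrow> real"
  assumes \<theta>: "0 < \<theta>" "\<theta> < 1"
    and u_int: "u integrable_on S" and v_int: "v integrable_on S"
    and uv_int: "(\<lambda>x. u x powr \<theta> * v x powr (1 - \<theta>)) integrable_on S"
    and u_nonneg: "\<And>x. x \<in> S \<Longrightarrow> 0 \<le> u x" and v_nonneg: "\<And>x. x \<in> S \<Longrightarrow> 0 \<le> v x"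
    and A: "0 < A" "integral S u \<le> A" and B: "0 < B" "integral S v \<le> B"
  shows "integral S (\<lambda>x. u x powr \<theta> * v x powr (1 - \<theta>)) \<le> A powr \<theta> * B powr (1 - \<theta>)"
proof -
  define M where "M = A powr \<theta> * B powr (1 - \<theta>)"
  let ?majorant = "\<lambda>x. M * (\<theta> * (u x / A) + (1 - \<theta>) * (v x / B))"
  have "integral S (\<lambda>x. u x powr \<theta> * v x powr (1 - \<theta>)) \<le> integral S ?majorant"
  proof (intro integral_le uv_int)
    show "?majorant integrable_on S"
      using u_int v_int by (intro integrable_on_mult_right integrable_add integrable_on_divide)
    fix x assume x: "x \<in> S"
    have "u x powr \<theta> * v x powr (1 - \<theta>) = M * ((u x / A) powr \<theta> * (v x / B) powr (1 - \<theta>))"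
      using A B u_nonneg[OF x] v_nonneg[OF x] by (simp add: M_def powr_divide)
    also have "\<dots> \<le> ?majorant x"
      using \<theta> A B u_nonneg[OF x] v_nonneg[OF x]
      by (intro mult_left_mono weighted_geometric_mean_le) (auto simp: M_def)
    finally show "u x powr \<theta> * v x powr (1 - \<theta>) \<le> ?majorant x" .
  qed
  also have "\<dots> = M * (\<theta> * (integral S u / A) + (1 - \<theta>) * (integral S v / B))"
    using u_int v_int by (simp add: integral_add integrable_on_mult_right integrable_on_divide)
  also have "\<dots> \<le> M * (\<theta> * 1 + (1 - \<theta>) * 1)"
    using \<theta> A B by (intro mult_left_mono add_mono) (auto simp: M_def)
  finally show ?thesis by (simp add: M_def)
qed

lemma integral_Hoelder_le:
  fixes u v :: "'a::euclidean_space \<Rightarrow> real"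
  assumes \<theta>: "0 < \<theta>" "\<theta> < 1"
    and u_int: "u integrable_on S" and v_int: "v integrable_on S"
    and uv_int: "(\<lambda>x. u x powr \<theta> * v x powr (1 - \<theta>)) integrable_on S"
    and u_nonneg: "\<And>x. x \<in> S \<Longrightarrow> 0 \<le> u x" and v_nonneg: "\<And>x. x \<in> S \<Longrightarrow> 0 \<le> v x"
  shows "integral S (\<lambda>x. u x powr \<theta> * v x powr (1 - \<theta>))
    \<le> integral S u powr \<theta> * integral S v powr (1 - \<theta>)"
proof (rule tendsto_lowerbound)
  have A_nonneg: "0 \<le> integral S u" and B_nonneg: "0 \<le> integral S v"
    by (intro integral_nonneg assms; simp)+
  have "((\<lambda>\<epsilon>. (integral S u + \<epsilon>) powr \<theta> * (integral S v + \<epsilon>) powr (1 - \<theta>)) \<longlongrightarrow>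
      (integral S u + 0) powr \<theta> * (integral S v + 0) powr (1 - \<theta>)) (at_right 0)"
    using \<theta> A_nonneg B_nonneg
    by (intro tendsto_intros tendsto_powr2) (auto intro!: eventually_at_rightI[of 0 1])
  then show "((\<lambda>\<epsilon>. (integral S u + \<epsilon>) powr \<theta> * (integral S v + \<epsilon>) powr (1 - \<theta>)) \<longlongrightarrow>
      integral S u powr \<theta> * integral S v powr (1 - \<theta>)) (at_right 0)" by simp
  show "\<forall>\<^sub>F \<epsilon> in at_right 0. integral S (\<lambda>x. u x powr \<theta> * v x powr (1 - \<theta>))
      \<le> (integral S u + \<epsilon>) powr \<theta> * (integral S v + \<epsilon>) powr (1 - \<theta>)"
    using A_nonneg B_nonneg
    by (intro eventually_at_rightI[of 0 1] integral_geometric_mean_le assms) auto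
qed simp

definition power_mean :: "real \<Rightarrow> (real \<Rightarrow> 'a::real_normed_vector) \<Rightarrow> real" where
  "power_mean r g = integral {0..1} (\<lambda>x. norm (g x) powr r) powr (1 / r)"

lemma power_mean_nonneg [simp]: "0 \<le> power_mean r g"
  by (simp add: power_mean_def)

lemma continuous_on_norm_powr [continuous_intros]:
  assumes "continuous_on S g" "0 < r"
  shows "continuous_on S (\<lambda>x. norm (g x) powr r)"
  using assms by (intro continuous_on_powr' continuous_intros) auto

lemma norm_powr_integrable:
  fixes g :: "real \<Rightarrow> 'a::real_normed_vector"
  assumes "continuous_on {0..1} g" "0 < r"
  shows "(\<lambda>x. norm (g x) powr r) integrable_on {0..1}"
  using assms by (intro integrable_continuous_real continuous_intros)

lemma integral_norm_powr_nonneg: "0 \<le> integral S (\<lambda>x. norm (g x) powr r)"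
  by (cases "(\<lambda>x. norm (g x) powr r) integrable_on S")
    (auto intro: integral_nonneg simp: not_integrable_integral)

lemma power_mean_powr:
  assumes "r \<noteq> 0"
  shows "power_mean r g powr r = integral {0..1} (\<lambda>x. norm (g x) powr r)"
  using assms by (simp add: power_mean_def powr_powr integral_norm_powr_nonneg)

lemma power_mean_le_iff:
  assumes "0 < r" "0 \<le> B"
  shows "power_mean r g \<le> B \<longleftrightarrow> integral {0..1} (\<lambda>x. norm (g x) powr r) \<le> B powr r"
proof -
  have "power_mean r g \<le> B \<longleftrightarrow> power_mean r g powr r \<le> B powr r"
    using assms powr_mono2[of r "power_mean r g" B] powr_less_mono2[of r B "power_mean r g"]
    by (metis less_imp_le not_le power_mean_nonneg)
  then show ?thesis using assms by (simp add: power_mean_powr)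
qed

lemma power_mean_mult_left:
  fixes g :: "real \<Rightarrow> 'a::real_normed_div_algebra"
  assumes "r \<noteq> 0"
  shows "power_mean r (\<lambda>x. c * g x) = norm c * power_mean r g"
  using assms by (simp add: power_mean_def norm_mult powr_mult powr_powr integral_norm_powr_nonneg)

lemma power_mean_minus: "power_mean r (\<lambda>x. - g x) = power_mean r g"
  by (simp add: power_mean_def)

lemma power_mean_zero [simp]: "r \<noteq> 0 \<Longrightarrow> power_mean r (\<lambda>x. 0) = 0"
  by (simp add: power_mean_def)

lemma powr_convex_nonneg:
  fixes p :: real
  assumes "1 \<le> p"
  shows "convex_on {0..} (\<lambda>x. x powr p)"
proof (rule convex_on_linorderI)
  fix t x y :: real
  assume t: "0 < t" "t < 1" and xy: "x \<in> {0..}" "y \<in> {0..}" "x < y"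
  show "((1 - t) *\<^sub>R x + t *\<^sub>R y) powr p \<le> (1 - t) * x powr p + t * y powr p"
  proof (cases "x = 0")
    case True
    have "t powr p \<le> t powr 1" using t assms by (intro powr_mono') auto
    then show ?thesis using True t xy by (auto simp: powr_mult intro!: mult_right_mono)
  next
    case False
    then show ?thesis using convex_onD[OF powr_convex[OF assms], of t x y] t xy by auto
  qed
qed auto

lemma powr_add_le_weighted:
  fixes x y a b r :: real
  assumes "1 \<le> r" "0 \<le> x" "0 \<le> y" "0 < a" "0 < b"
  shows "(x + y) powr r \<le> (a + b) powr r * (a / (a + b) * (x / a) powr r + b / (a + b) * (y / b) powr r)"
proof -
  define t where "t = b / (a + b)"
  have t: "0 \<le> t" "t \<le> 1" "1 - t = a / (a + b)" using assms by (auto simp: t_def field_simps)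
  have "(a + b) * (1 - t) = a" "(a + b) * t = b"
    unfolding t(3) using assms by (auto simp: t_def)
  then have "x + y = ((a + b) * (1 - t)) * (x / a) + ((a + b) * t) * (y / b)" using assms by simp
  also have "\<dots> = (a + b) * ((1 - t) *\<^sub>R (x / a) + t *\<^sub>R (y / b))" by (simp add: distrib_left)
  finally have "(x + y) powr r = (a + b) powr r * ((1 - t) *\<^sub>R (x / a) + t *\<^sub>R (y / b)) powr r"
    by (simp only: powr_mult)
  also have "\<dots> \<le> (a + b) powr r * ((1 - t) * (x / a) powr r + t * (y / b) powr r)"
    using assms t by (intro mult_left_mono convex_onD[OF powr_convex_nonneg]) auto
  finally show ?thesis unfolding t(3) by (simp add: t_def)
qed

text \<open>Normalising by upper bounds \<open>a\<close> and \<open>b\<close> of the two means reduces Minkowski's inequality to the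
  convexity of \<open>t powr r\<close>; perturbing the means by \<open>\<epsilon>\<close> makes the bounds positive.\<close>

lemma power_mean_add_le:
  fixes f g :: "real \<Rightarrow> 'a::real_normed_vector"
  assumes r: "1 \<le> r" and f: "continuous_on {0..1} f" and g: "continuous_on {0..1} g"
  shows "power_mean r (\<lambda>x. f x + g x) \<le> power_mean r f + power_mean r g"
proof (rule field_le_epsilon)
  fix \<epsilon> :: real assume \<epsilon>: "0 < \<epsilon>"
  define a where "a = power_mean r f + \<epsilon> / 2"
  define b where "b = power_mean r g + \<epsilon> / 2"
  have ab: "0 < a" "0 < b" using \<epsilon> by (auto simp: a_def b_def intro: add_nonneg_pos)
  have f_int: "(\<lambda>x. norm (f x) powr r) integrable_on {0..1}"
    and g_int: "(\<lambda>x. norm (g x) powr r) integrable_on {0..1}"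
    using r f g by (auto intro: norm_powr_integrable)
  have f_le: "integral {0..1} (\<lambda>x. norm (f x) powr r) \<le> a powr r"
    and g_le: "integral {0..1} (\<lambda>x. norm (g x) powr r) \<le> b powr r"
    using r ab \<epsilon> power_mean_le_iff[of r a f] power_mean_le_iff[of r b g] by (auto simp: a_def b_def)
  let ?majorant = "\<lambda>x. (a + b) powr r *
      (a / (a + b) * (norm (f x) powr r / a powr r) + b / (a + b) * (norm (g x) powr r / b powr r))"
  have "integral {0..1} (\<lambda>x. norm (f x + g x) powr r) \<le> integral {0..1} ?majorant"
  proof (intro integral_le norm_powr_integrable continuous_on_add f g)
    show "?majorant integrable_on {0..1}"
      using f_int g_int by (intro integrable_on_mult_right integrable_add integrable_on_divide)
    fix x :: real
    have "norm (f x + g x) powr r \<le> (norm (f x) + norm (g x)) powr r"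
      using r by (intro powr_mono2 norm_triangle_ineq) auto
    also have "\<dots> \<le> ?majorant x"
      using powr_add_le_weighted[of r "norm (f x)" "norm (g x)" a b] r ab by (simp add: powr_divide)
    finally show "norm (f x + g x) powr r \<le> ?majorant x" .
  qed (use r in auto)
  also have "\<dots> = (a + b) powr r * (a / (a + b) * (integral {0..1} (\<lambda>x. norm (f x) powr r) / a powr r)
      + b / (a + b) * (integral {0..1} (\<lambda>x. norm (g x) powr r) / b powr r))"
    using f_int g_int by (simp add: integral_add integrable_on_mult_right integrable_on_divide)
  also have "\<dots> \<le> (a + b) powr r * (a / (a + b) * 1 + b / (a + b) * 1)"
    using ab f_le g_le by (intro mult_left_mono add_mono) (auto simp: divide_le_eq_1)
  also have "\<dots> = (a + b) powr r" using ab by (simp flip: add_divide_distrib)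
  finally have "power_mean r (\<lambda>x. f x + g x) \<le> a + b"
    using r ab by (simp add: power_mean_le_iff)
  then show "power_mean r (\<lambda>x. f x + g x) \<le> power_mean r f + power_mean r g + \<epsilon>"
    by (simp add: a_def b_def)
qed

lemma power_mean_sum_le:
  fixes g :: "'i \<Rightarrow> real \<Rightarrow> 'a::real_normed_vector"
  assumes r: "1 \<le> r" and "\<And>i. i \<in> I \<Longrightarrow> continuous_on {0..1} (g i)"
  shows "power_mean r (\<lambda>x. \<Sum>i\<in>I. g i x) \<le> (\<Sum>i\<in>I. power_mean r (g i))"
  using assms(2)
proof (induction I rule: infinite_finite_induct)
  case (insert i I)
  have "power_mean r (\<lambda>x. g i x + (\<Sum>i\<in>I. g i x)) \<le> power_mean r (g i) + power_mean r (\<lambda>x. \<Sum>i\<in>I. g i x)"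
    using r insert.prems by (intro power_mean_add_le continuous_on_sum) auto
  then show ?case using insert by fastforce
qed (use r in auto)

lemma power_mean_mono_exponent:
  fixes g :: "real \<Rightarrow> 'a::real_normed_vector"
  assumes g: "continuous_on {0..1} g" and "0 < r" "r \<le> p"
  shows "power_mean r g \<le> power_mean p g"
proof (cases "r = p")
  case False
  have split: "norm (g x) powr r = (norm (g x) powr p) powr (r / p) * 1 powr (1 - r / p)" for x
    using assms by (simp add: powr_powr)
  have "integral {0..1} (\<lambda>x. norm (g x) powr r)
      \<le> integral {0..1} (\<lambda>x. norm (g x) powr p) powr (r / p) * integral {0..1::real} (\<lambda>x. 1::real) powr (1 - r / p)"
    unfolding split using assms False
    by (intro integral_Hoelder_le norm_powr_integrable) (auto simp: norm_powr_integrable powr_powr)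
  then show ?thesis
    using assms by (simp add: power_mean_le_iff) (simp add: power_mean_def powr_powr)
qed simp

lemma power_mean_interpolation:
  fixes g :: "real \<Rightarrow> 'a::real_normed_vector"
  assumes g: "continuous_on {0..1} g" and pqr: "0 < p" "0 < q" "0 < r" and \<theta>: "0 < \<theta>" "\<theta> < 1"
    and r_eq: "1 / r = \<theta> / p + (1 - \<theta>) / q"
  shows "power_mean r g \<le> power_mean p g powr \<theta> * power_mean q g powr (1 - \<theta>)"
proof -
  define \<tau> where "\<tau> = \<theta> * r / p"
  have "\<theta> * r / p + (1 - \<theta>) * r / q = r * (\<theta> / p + (1 - \<theta>) / q)" by (simp add: algebra_simps)
  also have "\<dots> = 1" using pqr by (simp flip: r_eq)
  finally have \<tau>_compl: "1 - \<tau> = (1 - \<theta>) * r / q" by (simp add: \<tau>_def)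
  have \<tau>: "0 < \<tau>" "0 < 1 - \<tau>" unfolding \<tau>_compl using \<theta> pqr by (auto simp: \<tau>_def)
  have \<tau>_mult: "p * \<tau> = \<theta> * r" "q * (1 - \<tau>) = (1 - \<theta>) * r"
    unfolding \<tau>_compl using pqr by (auto simp: \<tau>_def)
  have split: "norm (g x) powr r = (norm (g x) powr p) powr \<tau> * (norm (g x) powr q) powr (1 - \<tau>)" for x
    unfolding powr_powr \<tau>_mult powr_add[symmetric] by (simp add: algebra_simps)
  have "integral {0..1} (\<lambda>x. norm (g x) powr r)
      \<le> integral {0..1} (\<lambda>x. norm (g x) powr p) powr \<tau> * integral {0..1} (\<lambda>x. norm (g x) powr q) powr (1 - \<tau>)"
    unfolding split using \<tau> g pqr
    by (intro integral_Hoelder_le norm_powr_integrable) (auto simp: norm_powr_integrable simp flip: split)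
  also have "\<dots> = (power_mean p g powr \<theta> * power_mean q g powr (1 - \<theta>)) powr r"
    using pqr by (simp add: powr_mult powr_powr \<tau>_mult flip: power_mean_powr)
  finally show ?thesis using pqr by (simp add: power_mean_le_iff)
qed

subsection \<open>Trigonometric sums\<close>

definition unit_char :: "real \<Rightarrow> complex" where
  "unit_char t = cis (2 * pi * t)"

lemma norm_unit_char [simp]: "norm (unit_char t) = 1"
  by (simp add: unit_char_def)

lemma unit_char_add: "unit_char (s + t) = unit_char s * unit_char t"
  by (simp add: unit_char_def cis_mult ring_distribs)

lemma unit_char_0 [simp]: "unit_char 0 = 1"
  by (simp add: unit_char_def)

lemma cnj_unit_char: "cnj (unit_char t) = unit_char (- t)"
  by (simp add: unit_char_def cis_cnj)

lemma unit_char_of_int [simp]: "unit_char (of_int k) = 1"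
  by (simp add: unit_char_def cis_multiple_2pi)

lemma continuous_on_unit_char [continuous_intros]:
  "continuous_on S f \<Longrightarrow> continuous_on S (\<lambda>x. unit_char (f x))"
  unfolding unit_char_def by (intro continuous_intros)

lemma has_integral_unit_char:
  "((\<lambda>x. unit_char (of_int k * x)) has_integral (if k = 0 then 1 else 0)) {0..1}"
proof (cases "k = 0")
  case True
  then show ?thesis using has_integral_const_real[of "1::complex" 0 1] by simp
next
  case False
  define c where "c = 2 * pi * of_int k"
  have c: "c \<noteq> 0" using False by (simp add: c_def)
  define F where "F = (\<lambda>x. cis (c * x) / (\<i> * of_real c))"
  have "((\<lambda>x. cis (c * x)) has_integral (F 1 - F 0)) {0..1}"
  proof (rule fundamental_theorem_of_calculus)
    fix x :: real
    show "(F has_vector_derivative cis (c * x)) (at x within {0..1})"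
      unfolding F_def cis_conv_exp using c
      by (auto intro!: derivative_eq_intros has_vector_derivative_real_field simp: field_simps)
  qed simp
  moreover have "F 1 = F 0"
    using unit_char_of_int[of k] by (simp add: F_def c_def unit_char_def)
  ultimately show ?thesis using False by (simp add: unit_char_def c_def mult.assoc)
qed

definition trig_sum :: "'a set \<Rightarrow> ('a \<Rightarrow> real) \<Rightarrow> ('a \<Rightarrow> int) \<Rightarrow> real \<Rightarrow> complex" where
  "trig_sum I d k x = (\<Sum>i\<in>I. of_real (d i) * unit_char (of_int (k i) * x))"

lemma continuous_on_trig_sum [continuous_intros]: "continuous_on S (trig_sum I d k)"
  unfolding trig_sum_def by (intro continuous_intros)

lemma trig_sum_mono_neutral:
  assumes "finite B" "A \<subseteq> B" "\<And>i. i \<in> B - A \<Longrightarrow> d i = 0"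
  shows "trig_sum A d k = trig_sum B d k"
  unfolding trig_sum_def using assms by (intro ext sum.mono_neutral_left) auto

lemma trig_sum_add: "trig_sum I (\<lambda>i. d i + d' i) k x = trig_sum I d k x + trig_sum I d' k x"
  by (simp add: trig_sum_def distrib_right sum.distrib)

lemma trig_sum_diff: "trig_sum I (\<lambda>i. d i - d' i) k x = trig_sum I d k x - trig_sum I d' k x"
  by (simp add: trig_sum_def left_diff_distrib sum_subtractf)

lemma trig_sum_sum: "trig_sum I (\<lambda>i. \<Sum>j\<in>J. d j i) k x = (\<Sum>j\<in>J. trig_sum I (d j) k x)"
  unfolding trig_sum_def of_real_sum sum_distrib_right by (rule sum.swap)

lemma norm_trig_sum_le: "norm (trig_sum I d k x) \<le> (\<Sum>i\<in>I. \<bar>d i\<bar>)"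
  unfolding trig_sum_def by (intro sum_norm_le) (simp add: norm_mult)

lemma trig_sum_mult:
  "trig_sum I d k x * trig_sum J d' k' x
    = trig_sum (I \<times> J) (\<lambda>(i, j). d i * d' j) (\<lambda>(i, j). k i + k' j) x"
  unfolding trig_sum_def sum_product sum.cartesian_product
  by (intro sum.cong refl) (auto simp: unit_char_add ring_distribs mult_ac)

lemma cnj_trig_sum: "cnj (trig_sum I d k x) = trig_sum I d (\<lambda>i. - k i) x"
  by (simp add: trig_sum_def cnj_unit_char)

lemma norm_trig_sum_square:
  "of_real ((norm (trig_sum I d k x))\<^sup>2) = trig_sum (I \<times> I) (\<lambda>(i, j). d i * d j) (\<lambda>(i, j). k i - k j) x"
  unfolding complex_norm_square cnj_trig_sum trig_sum_mult by simp

lemma has_integral_trig_sum: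
  assumes "finite I"
  shows "(trig_sum I d k has_integral of_real (\<Sum>i\<in>{i\<in>I. k i = 0}. d i)) {0..1}"
proof -
  have "(trig_sum I d k has_integral (\<Sum>i\<in>I. of_real (d i) * (if k i = 0 then 1 else 0))) {0..1}"
    unfolding trig_sum_def using assms
    by (intro has_integral_sum has_integral_mult_right has_integral_unit_char)
  also have "(\<Sum>i\<in>I. of_real (d i) * (if k i = 0 then 1 else 0))
      = (of_real (\<Sum>i\<in>{i\<in>I. k i = 0}. d i) :: complex)"
    unfolding of_real_sum using assms by (subst sum.inter_filter) (auto intro!: sum.cong)
  finally show ?thesis .
qed

lemma integral_norm_trig_sum_square:
  assumes "finite I"
  shows "integral {0..1} (\<lambda>x. (norm (trig_sum I d k x))\<^sup>2) = (\<Sum>(i, j)\<in>{(i, j)\<in>I \<times> I. k i = k j}. d i * d j)"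
proof -
  have "((\<lambda>x. of_real ((norm (trig_sum I d k x))\<^sup>2) :: complex) has_integral
      of_real (\<Sum>(i, j)\<in>{(i, j)\<in>I \<times> I. k i = k j}. d i * d j)) {0..1}"
    unfolding norm_trig_sum_square
    using has_integral_trig_sum[of "I \<times> I" "\<lambda>(i, j). d i * d j" "\<lambda>(i, j). k i - k j"] assms
    by (simp add: case_prod_unfold mem_Times_iff conj_assoc)
  from has_integral_linear[OF this bounded_linear_Re] show ?thesis
    by (intro integral_unique) (simp add: o_def)
qed

lemma integral_norm_trig_sum_square_inj:
  assumes "finite I" "inj_on k I"
  shows "integral {0..1} (\<lambda>x. (norm (trig_sum I d k x))\<^sup>2) = (\<Sum>i\<in>I. (d i)\<^sup>2)"
proof -
  have "{(i, j)\<in>I \<times> I. k i = k j} = (\<lambda>i. (i, i)) ` I"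
    using assms(2) by (auto simp: image_iff inj_on_eq_iff)
  then show ?thesis
    unfolding integral_norm_trig_sum_square[OF assms(1)]
    by (simp add: sum.reindex inj_on_def power2_eq_square)
qed

lemma power_mean_2_trig_sum:
  assumes "finite I" "inj_on k I"
  shows "power_mean 2 (trig_sum I d k) = L2_set d I"
  using integral_norm_trig_sum_square_inj[OF assms]
  by (simp add: power_mean_def L2_set_def powr_half_sqrt sum_nonneg)

lemma power_mean_4_trig_sum_ge:
  fixes m :: real
  assumes I: "finite I" and d: "\<And>i. i \<in> I \<Longrightarrow> 0 \<le> d i" and Q: "Q \<subseteq> (I \<times> I) \<times> (I \<times> I)"
    and equal_differences: "\<And>i j i' j'. ((i, j), (i', j')) \<in> Q \<Longrightarrow> k i - k j = k i' - k j'"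
    and m: "0 \<le> m" "\<And>i j i' j'. ((i, j), (i', j')) \<in> Q \<Longrightarrow> m \<le> d i * d j * (d i' * d j')"
  shows "(m * card Q) powr (1/4) \<le> power_mean 4 (trig_sum I d k)"
proof -
  define D where "D = (\<lambda>(i, j). d i * d j)"
  define E where "E = (\<lambda>(i, j). k i - k j)"
  define Z where "Z = {(p, q)\<in>(I \<times> I) \<times> (I \<times> I). E p = E q}"
  have "m * card Q = (\<Sum>p\<in>Q. m)" by simp
  also have "\<dots> \<le> (\<Sum>(p, q)\<in>Q. D p * D q)"
    by (intro sum_mono) (auto simp: D_def dest: m(2))
  also have "\<dots> \<le> (\<Sum>(p, q)\<in>Z. D p * D q)"
  proof (rule sum_mono2)
    show "finite Z" using I by (intro finite_subset[of Z "(I \<times> I) \<times> (I \<times> I)"]) (auto simp: Z_def)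
    show "Q \<subseteq> Z" unfolding Z_def E_def using Q equal_differences by auto
  qed (auto simp: Z_def D_def intro!: mult_nonneg_nonneg d)
  also have "\<dots> = integral {0..1} (\<lambda>x. (norm (trig_sum (I \<times> I) D E x))\<^sup>2)"
    unfolding Z_def using I by (simp add: integral_norm_trig_sum_square)
  also have "(\<lambda>x. (norm (trig_sum (I \<times> I) D E x))\<^sup>2) = (\<lambda>x. norm (trig_sum I d k x) powr 4)"
    unfolding D_def E_def norm_trig_sum_square[symmetric]
    by (simp del: of_real_power flip: power_mult)
  finally show ?thesis
    unfolding power_mean_def using m(1) by (intro powr_mono2) auto
qed

definition fejer_kernel :: "nat \<Rightarrow> real \<Rightarrow> real" where
  "fejer_kernel N x = (norm (trig_sum {..<N} (\<lambda>_. 1) int x))\<^sup>2"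

lemma fejer_kernel_nonneg [simp]: "0 \<le> fejer_kernel N x"
  by (simp add: fejer_kernel_def)

lemma fejer_kernel_le: "fejer_kernel N x \<le> (real N)\<^sup>2"
  unfolding fejer_kernel_def using norm_trig_sum_le[of "{..<N}" "\<lambda>_. 1" int x] by (intro power_mono) auto

lemma continuous_on_fejer_kernel [continuous_intros]: "continuous_on S (fejer_kernel N)"
  unfolding fejer_kernel_def by (intro continuous_intros)

lemma integral_fejer_kernel: "integral {0..1} (fejer_kernel N) = N"
  unfolding fejer_kernel_def by (simp add: integral_norm_trig_sum_square_inj)

lemma has_integral_unit_char_times_fejer_kernel:
  assumes "0 \<le> k"
  shows "((\<lambda>x. unit_char (of_int k * x) * of_real (fejer_kernel N x)) has_integral of_nat (N - nat k)) {0..1}"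
proof -
  let ?freq = "\<lambda>(i, j). k + (int i - int j)"
  have "{p \<in> {..<N} \<times> {..<N}. ?freq p = 0} = (\<lambda>i. (i, i + nat k)) ` {..<N - nat k}"
    using assms by (auto simp: image_iff)
  moreover have "card ((\<lambda>i. (i, i + nat k)) ` {..<N - nat k}) = N - nat k"
    by (subst card_image) (auto simp: inj_on_def)
  ultimately have "(trig_sum ({..<N} \<times> {..<N}) (\<lambda>_. 1) ?freq has_integral of_nat (N - nat k)) {0..1}"
    using has_integral_trig_sum[of "{..<N} \<times> {..<N}" "\<lambda>_. 1" ?freq] by simp
  also have "trig_sum ({..<N} \<times> {..<N}) (\<lambda>_. 1) ?freq
      = (\<lambda>x. unit_char (of_int k * x) * of_real (fejer_kernel N x))"
    unfolding fejer_kernel_def norm_trig_sum_square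
    by (simp add: trig_sum_def fun_eq_iff case_prod_unfold sum_distrib_left distrib_right unit_char_add)
  finally show ?thesis .
qed

lemma has_integral_trig_sum_times_fejer_kernel:
  assumes "finite I" "\<And>i. i \<in> I \<Longrightarrow> 0 \<le> k i"
  shows "((\<lambda>x. trig_sum I d k x * of_real (fejer_kernel N x)) has_integral
    of_real (\<Sum>i\<in>I. d i * real (N - nat (k i)))) {0..1}"
  unfolding trig_sum_def sum_distrib_right of_real_sum of_real_mult mult.assoc of_real_of_nat_eq
  using assms by (intro has_integral_sum has_integral_mult_right has_integral_unit_char_times_fejer_kernel)

lemma integral_norm_powr_times_fejer_kernel_le:
  assumes p: "0 < p" and f: "continuous_on {0..1} f"
  shows "integral {0..1} (\<lambda>x. norm (f x) powr p * fejer_kernel N x) \<le> (real N)\<^sup>2 * power_mean p f powr p"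
proof -
  have "integral {0..1} (\<lambda>x. norm (f x) powr p * fejer_kernel N x)
      \<le> integral {0..1} (\<lambda>x. norm (f x) powr p * (real N)\<^sup>2)"
    using p f by (intro integral_le integrable_continuous_real continuous_intros mult_left_mono fejer_kernel_le) auto
  then show ?thesis using p by (simp add: power_mean_powr mult.commute)
qed

lemma trig_sum_fejer_test:
  assumes I: "finite I" and k: "\<And>i. i \<in> I \<Longrightarrow> 0 \<le> k i" and N: "0 < N" and p: "1 < p"
  shows "(\<Sum>i\<in>I. d i * real (N - nat (k i))) \<le> real N powr (1 + 1/p) * power_mean p (trig_sum I d k)"
proof -
  let ?f = "trig_sum I d k" and ?F = "fejer_kernel N"
  let ?weighted = "\<lambda>x. norm (?f x) powr p * ?F x"
  have cont: "continuous_on {0..1} ?weighted" using p by (intro continuous_intros) auto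
  have split: "norm (?f x) * ?F x = ?weighted x powr (1/p) * ?F x powr (1 - 1/p)" for x
    using p by (simp add: powr_mult powr_powr flip: powr_add)
  have "((\<lambda>x. Re (?f x * of_real (?F x))) has_integral (\<Sum>i\<in>I. d i * real (N - nat (k i)))) {0..1}"
    using has_integral_linear[OF has_integral_trig_sum_times_fejer_kernel[OF I k] bounded_linear_Re]
    by (simp only: o_def Re_complex_of_real)
  then have "(\<Sum>i\<in>I. d i * real (N - nat (k i))) = integral {0..1} (\<lambda>x. Re (?f x * of_real (?F x)))"
    by (simp add: integral_unique)
  also have "\<dots> \<le> integral {0..1} (\<lambda>x. norm (?f x) * ?F x)"
  proof (intro integral_le integrable_continuous_real continuous_intros)
    fix x show "Re (?f x * of_real (?F x)) \<le> norm (?f x) * ?F x"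
      using complex_Re_le_cmod[of "?f x * of_real (?F x)"] by (simp add: norm_mult)
  qed
  also have "\<dots> \<le> integral {0..1} ?weighted powr (1/p) * integral {0..1} ?F powr (1 - 1/p)"
    unfolding split using p cont
    by (intro integral_Hoelder_le integrable_continuous_real)
       (auto intro!: continuous_intros simp flip: split)
  also have "\<dots> \<le> ((real N)\<^sup>2 * power_mean p ?f powr p) powr (1/p) * real N powr (1 - 1/p)"
    unfolding integral_fejer_kernel using p
    by (intro mult_right_mono powr_mono2 integral_nonneg integrable_continuous_real cont
        integral_norm_powr_times_fejer_kernel_le continuous_intros) auto
  also have "\<dots> = (real N powr (2/p) * real N powr (1 - 1/p)) * power_mean p ?f"
    using N p by (simp add: powr_mult powr_powr flip: powr_numeral)
  also have "real N powr (2/p) * real N powr (1 - 1/p) = real N powr (1 + 1/p)"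
    by (simp add: field_simps flip: powr_add)
  finally show ?thesis .
qed

subsection \<open>Distance to the nearest integer\<close>

definition dist_int :: "real \<Rightarrow> real" where
  "dist_int t = \<bar>t - of_int (round t)\<bar>"

lemma dist_int_nonneg [simp]: "0 \<le> dist_int t"
  by (simp add: dist_int_def)

lemma dist_int_le: "dist_int t \<le> \<bar>t - of_int k\<bar>"
  unfolding dist_int_def by (rule round_diff_minimal)

lemma dist_int_attained: obtains k :: int where "dist_int t = \<bar>t - of_int k\<bar>"
  unfolding dist_int_def by blast

lemma dist_int_of_small:
  assumes "\<bar>t\<bar> \<le> 1/2"
  shows "dist_int t = \<bar>t\<bar>"
proof (rule antisym)
  show "dist_int t \<le> \<bar>t\<bar>" using dist_int_le[of t 0] by simp
  obtain k where k: "dist_int t = \<bar>t - of_int k\<bar>" by (rule dist_int_attained)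
  show "\<bar>t\<bar> \<le> dist_int t"
  proof (cases "k = 0")
    case False
    then have "1 \<le> \<bar>real_of_int k\<bar>" by linarith
    then show ?thesis using assms k by linarith
  qed (use k in simp)
qed

lemma dist_int_add_le: "dist_int (s + t) \<le> dist_int s + \<bar>t\<bar>"
proof -
  obtain k where "dist_int s = \<bar>s - of_int k\<bar>" by (rule dist_int_attained)
  then show ?thesis using dist_int_le[of "s + t" k] by linarith
qed

lemma dist_int_add_of_int [simp]: "dist_int (t + of_int k) = dist_int t"
proof -
  have "\<lfloor>(t + 1/2) + of_int k\<rfloor> = \<lfloor>t + 1/2\<rfloor> + k" by simp
  then show ?thesis by (simp add: dist_int_def round_def add_ac)
qed

lemma sin_pi_mult_ge:
  assumes "0 \<le> u" "u \<le> 1/2"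
  shows "2 * u \<le> sin (pi * u)"
proof -
  have "convex_on {0..pi} (\<lambda>x. - sin x)"
    by (rule f''_ge0_imp_convex[where f' = "\<lambda>x. - cos x" and f'' = sin])
       (auto intro!: derivative_eq_intros sin_ge_zero)
  then have "- sin ((1 - 2 * u) *\<^sub>R 0 + (2 * u) *\<^sub>R (pi / 2))
      \<le> (1 - 2 * u) * (- sin 0) + 2 * u * (- sin (pi / 2))"
    by (rule convex_onD) (use assms in auto)
  then show ?thesis by (simp add: mult.commute)
qed

lemma norm_one_minus_unit_char: "norm (1 - unit_char t) = 2 * \<bar>sin (pi * t)\<bar>"
  using dist_exp_i_1[of "2 * pi * t"] by (simp add: unit_char_def cis_conv_exp norm_minus_commute)

lemma norm_one_minus_unit_char_ge: "4 * dist_int t \<le> norm (1 - unit_char t)"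
proof -
  define u where "u = t - of_int (round t)"
  have "\<bar>u\<bar> \<le> 1/2"
    using of_int_round_abs_le[of t] by (simp add: u_def abs_minus_commute)
  then have "2 * \<bar>u\<bar> \<le> \<bar>sin (pi * u)\<bar>"
    using sin_pi_mult_ge[of u] sin_pi_mult_ge[of "-u"] by (cases "0 \<le> u") auto
  moreover have "unit_char t = unit_char (u + of_int (round t))" by (simp add: u_def)
  then have "unit_char t = unit_char u" by (simp add: unit_char_add)
  ultimately show ?thesis
    by (simp add: norm_one_minus_unit_char dist_int_def flip: u_def)
qed

subsection \<open>Weyl differencing\<close>

definition second_diff :: "(int \<Rightarrow> real) \<Rightarrow> int \<Rightarrow> real" where
  "second_diff w n = w (n + 2) - 2 * w (n + 1) + w n"

lemma second_diff_mult:
  "second_diff (\<lambda>n. u n * v n) n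
    = second_diff u n * v (n + 2) + 2 * ((u (n + 1) - u n) * (v (n + 2) - v (n + 1))) + u n * second_diff v n"
  by (simp add: second_diff_def algebra_simps)

lemma trig_sum_difference:
  assumes supp: "\<And>n. n \<notin> {a..<b} \<Longrightarrow> w n = 0"
  shows "trig_sum {a - 1..<b} (\<lambda>n. w (n + 1) - w n) (\<lambda>n. n) \<theta>
    = (unit_char (- \<theta>) - 1) * trig_sum {a..<b} w (\<lambda>n. n) \<theta>"
proof -
  have "(\<Sum>n\<in>{a - 1..<b}. of_real (w (n + 1)) * unit_char (of_int n * \<theta>))
      = (\<Sum>n\<in>{a..<b + 1}. of_real (w n) * unit_char (of_int (n - 1) * \<theta>))"
    by (rule sum.reindex_bij_witness[of _ "\<lambda>n. n - 1" "\<lambda>n. n + 1"]) auto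
  also have "\<dots> = (\<Sum>n\<in>{a..<b}. of_real (w n) * unit_char (of_int (n - 1) * \<theta>))"
    by (intro sum.mono_neutral_right) (auto simp: supp)
  also have "\<dots> = unit_char (- \<theta>) * trig_sum {a..<b} w (\<lambda>n. n) \<theta>"
    unfolding trig_sum_def sum_distrib_left
    by (intro sum.cong refl) (simp add: left_diff_distrib flip: unit_char_add)
  finally have shifted: "(\<Sum>n\<in>{a - 1..<b}. of_real (w (n + 1)) * unit_char (of_int n * \<theta>))
      = unit_char (- \<theta>) * trig_sum {a..<b} w (\<lambda>n. n) \<theta>" .
  have "(\<Sum>n\<in>{a - 1..<b}. of_real (w n) * unit_char (of_int n * \<theta>)) = trig_sum {a..<b} w (\<lambda>n. n) \<theta>"
    unfolding trig_sum_def by (intro sum.mono_neutral_right) (auto simp: supp)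
  then show ?thesis
    using shifted by (simp add: trig_sum_def left_diff_distrib sum_subtractf)
qed

lemma norm_trig_sum_le_second_diff:
  assumes supp: "\<And>n. n \<notin> {a..<b} \<Longrightarrow> w n = 0"
  shows "(norm (1 - unit_char \<theta>))\<^sup>2 * norm (trig_sum {a..<b} w (\<lambda>n. n) \<theta>)
    \<le> (\<Sum>n\<in>{a - 2..<b}. \<bar>second_diff w n\<bar>)"
proof -
  define w' where "w' = (\<lambda>n. w (n + 1) - w n)"
  have "trig_sum {a - 1 - 1..<b} (\<lambda>n. w' (n + 1) - w' n) (\<lambda>n. n) \<theta>
      = (unit_char (- \<theta>) - 1) * trig_sum {a - 1..<b} w' (\<lambda>n. n) \<theta>"
    by (rule trig_sum_difference) (auto simp: w'_def supp)
  also have "trig_sum {a - 1..<b} w' (\<lambda>n. n) \<theta> = (unit_char (- \<theta>) - 1) * trig_sum {a..<b} w (\<lambda>n. n) \<theta>"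
    unfolding w'_def by (rule trig_sum_difference[OF supp])
  also have "(\<lambda>n. w' (n + 1) - w' n) = second_diff w"
    by (auto simp: w'_def second_diff_def algebra_simps)
  finally have "norm (trig_sum {a - 2..<b} (second_diff w) (\<lambda>n. n) \<theta>)
      = (norm (1 - unit_char (- \<theta>)))\<^sup>2 * norm (trig_sum {a..<b} w (\<lambda>n. n) \<theta>)"
    by (simp add: norm_mult power2_eq_square norm_minus_commute)
  moreover have "norm (1 - unit_char (- \<theta>)) = norm (1 - unit_char \<theta>)"
    by (simp add: norm_one_minus_unit_char)
  ultimately show ?thesis using norm_trig_sum_le[of "{a - 2..<b}" "second_diff w" "\<lambda>n. n" \<theta>] by simp
qed

abbreviation weyl_sum :: "int set \<Rightarrow> (int \<Rightarrow> real) \<Rightarrow> real \<Rightarrow> complex" where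
  "weyl_sum A w \<equiv> trig_sum A w (\<lambda>n. n\<^sup>2)"

text \<open>In \<open>|\<Sum>\<^sub>n w(n) e(n\<^sup>2 x)|\<^sup>2\<close> the substitution \<open>m = n + h\<close> makes the phase \<open>m\<^sup>2 - n\<^sup>2 = 2 h n + h\<^sup>2\<close>
  linear in \<open>n\<close>.\<close>

lemma weyl_differencing:
  assumes supp: "\<And>n. n \<notin> {a..<a + M} \<Longrightarrow> w n = 0"
  shows "(norm (weyl_sum {a..<a + M} w x))\<^sup>2
    \<le> (\<Sum>h\<in>{-M..M}. norm (trig_sum {a..<a + M} (\<lambda>n. w n * w (n + h)) (\<lambda>n. n) (of_int (2 * h) * x)))"
proof -
  let ?I = "{a..<a + M}" and ?H = "{-M..M}"
  let ?e = "\<lambda>n. unit_char (of_int (n\<^sup>2) * x)"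
  let ?f = "\<lambda>n m. of_real (w m * w n) * unit_char (of_int (m\<^sup>2 - n\<^sup>2) * x)"
  let ?corr = "\<lambda>h. trig_sum ?I (\<lambda>n. w n * w (n + h)) (\<lambda>n. n) (of_int (2 * h) * x)"
  have shift: "(\<Sum>m\<in>?I. ?f n m) = (\<Sum>h\<in>?H. ?f n (n + h))" if n: "n \<in> ?I" for n
  proof -
    have "(\<Sum>m\<in>?I. ?f n m) = (\<Sum>m\<in>{n - M..n + M}. ?f n m)"
      using n by (intro sum.mono_neutral_left) (auto simp: supp)
    also have "\<dots> = (\<Sum>h\<in>?H. ?f n (n + h))"
      by (rule sum.reindex_bij_witness[of _ "\<lambda>h. n + h" "\<lambda>m. m - n"]) auto
    finally show ?thesis .
  qed
  have phase: "?f n (n + h)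
      = ?e h * (of_real (w n * w (n + h)) * unit_char (of_int n * (of_int (2 * h) * x)))" for n h
  proof -
    have "of_int ((n + h)\<^sup>2 - n\<^sup>2) * x = of_int (h\<^sup>2) * x + of_int n * (of_int (2 * h) * x)"
      by (simp add: power2_eq_square algebra_simps)
    then show ?thesis by (simp add: unit_char_add mult_ac)
  qed
  have "of_real ((norm (weyl_sum ?I w x))\<^sup>2) = (\<Sum>m\<in>?I. \<Sum>n\<in>?I. ?f n m)"
    unfolding norm_trig_sum_square by (simp add: trig_sum_def sum.cartesian_product case_prod_unfold)
  also have "\<dots> = (\<Sum>n\<in>?I. \<Sum>h\<in>?H. ?f n (n + h))"
    by (subst sum.swap) (intro sum.cong refl shift)
  also have "\<dots> = (\<Sum>h\<in>?H. ?e h * ?corr h)"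
    unfolding phase trig_sum_def sum_distrib_left by (rule sum.swap)
  finally have "norm (of_real ((norm (weyl_sum ?I w x))\<^sup>2) :: complex) \<le> (\<Sum>h\<in>?H. norm (?corr h))"
    by (simp only:) (intro sum_norm_le, simp add: norm_mult)
  then show ?thesis by (simp add: norm_power)
qed

abbreviation bump_window :: "nat \<Rightarrow> int \<Rightarrow> int set" where
  "bump_window L a \<equiv> {a..<a + 4 * int L}"

definition bump :: "nat \<Rightarrow> int \<Rightarrow> (int \<Rightarrow> real) \<Rightarrow> bool" where
  "bump L a w \<longleftrightarrow> (\<forall>n. n \<notin> bump_window L a \<longrightarrow> w n = 0) \<and> (\<forall>n. \<bar>w n\<bar> \<le> 1) \<and>
     (\<forall>n. \<bar>w (n + 1) - w n\<bar> \<le> 2 / L) \<and> (\<forall>F. finite F \<longrightarrow> (\<Sum>n\<in>F. \<bar>second_diff w n\<bar>) \<le> 4 / L)"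

lemma bumpD:
  assumes "bump L a w"
  shows "n \<notin> bump_window L a \<Longrightarrow> w n = 0" "\<bar>w n\<bar> \<le> 1" "\<bar>w (n + 1) - w n\<bar> \<le> 2 / L"
    "finite F \<Longrightarrow> (\<Sum>n\<in>F. \<bar>second_diff w n\<bar>) \<le> 4 / L"
  using assms by (auto simp: bump_def)

lemma sum_second_diff_bump_correlation_le:
  assumes w: "bump L a w" and L: "1 \<le> L"
  shows "(\<Sum>n\<in>{a - 2..<a + 4 * int L}. \<bar>second_diff (\<lambda>n. w n * w (n + h)) n\<bar>) \<le> 56 / L"
proof -
  let ?A = "{a - 2..<a + 4 * int L}"
  have shift: "(\<Sum>n\<in>?A. \<bar>second_diff w (n + h)\<bar>) = (\<Sum>n\<in>(\<lambda>n. n + h) ` ?A. \<bar>second_diff w n\<bar>)"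
    by (subst sum.reindex) (auto simp: inj_on_def)
  have "\<bar>second_diff (\<lambda>n. w n * w (n + h)) n\<bar>
      \<le> \<bar>second_diff w n\<bar> + 8 / L\<^sup>2 + \<bar>second_diff w (n + h)\<bar>" for n
  proof -
    define d where "d = (\<lambda>n. w (n + 1) - w n)"
    have "second_diff (\<lambda>n. w n * w (n + h)) n
        = second_diff w n * w (n + 2 + h) + 2 * (d n * d (n + 1 + h)) + w n * second_diff w (n + h)"
      unfolding second_diff_mult by (simp add: second_diff_def d_def add_ac)
    also have "\<bar>\<dots>\<bar> \<le> \<bar>second_diff w n\<bar> * \<bar>w (n + 2 + h)\<bar> + 2 * (\<bar>d n\<bar> * \<bar>d (n + 1 + h)\<bar>)
        + \<bar>w n\<bar> * \<bar>second_diff w (n + h)\<bar>"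
      unfolding abs_mult[symmetric] by linarith
    also have "\<dots> \<le> \<bar>second_diff w n\<bar> * 1 + 2 * (2 / L * (2 / L)) + 1 * \<bar>second_diff w (n + h)\<bar>"
      unfolding d_def by (intro add_mono mult_mono bumpD(2,3)[OF w]) auto
    finally show ?thesis by (simp add: power2_eq_square)
  qed
  then have "(\<Sum>n\<in>?A. \<bar>second_diff (\<lambda>n. w n * w (n + h)) n\<bar>)
      \<le> (\<Sum>n\<in>?A. \<bar>second_diff w n\<bar> + 8 / L\<^sup>2 + \<bar>second_diff w (n + h)\<bar>)"
    by (rule sum_mono)
  also have "\<dots> = (\<Sum>n\<in>?A. \<bar>second_diff w n\<bar>) + (4 * real L + 2) * (8 / L\<^sup>2)
      + (\<Sum>n\<in>(\<lambda>n. n + h) ` ?A. \<bar>second_diff w n\<bar>)"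
    unfolding sum.distrib shift by simp
  also have "\<dots> \<le> 4 / L + (4 * real L + 2 * L) * (8 / L\<^sup>2) + 4 / L"
    using L by (intro add_mono bumpD(4)[OF w] mult_right_mono) auto
  also have "\<dots> = 56 / L" using L by (simp add: field_simps power2_eq_square)
  finally show ?thesis .
qed

definition dist_kernel :: "real \<Rightarrow> real \<Rightarrow> real" where
  "dist_kernel L t = 1 / (1 + L * dist_int t)\<^sup>2"

lemma dist_kernel_nonneg [simp]: "0 \<le> dist_kernel L t"
  by (simp add: dist_kernel_def)

lemma bump_correlation_le:
  assumes w: "bump L a w" and L: "1 \<le> L"
  shows "norm (trig_sum (bump_window L a) (\<lambda>n. w n * w (n + h)) (\<lambda>n. n) \<theta>) \<le> 16 * real L * dist_kernel L \<theta>"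
proof -
  define T where "T = norm (trig_sum (bump_window L a) (\<lambda>n. w n * w (n + h)) (\<lambda>n. n) \<theta>)"
  define t where "t = dist_int \<theta>"
  have T: "0 \<le> T" and t: "0 \<le> t" and L_pos: "0 < real L" using L by (auto simp: T_def t_def)
  have "T \<le> (\<Sum>n\<in>bump_window L a. \<bar>w n * w (n + h)\<bar>)"
    unfolding T_def by (rule norm_trig_sum_le)
  also have "\<dots> \<le> (\<Sum>n\<in>bump_window L a. 1 * 1)"
    unfolding abs_mult by (intro sum_mono mult_mono bumpD(2)[OF w]) auto
  finally have trivial_bound: "T \<le> 4 * real L" by simp
  have "(4 * t)\<^sup>2 * T \<le> (norm (1 - unit_char \<theta>))\<^sup>2 * T"
    using norm_one_minus_unit_char_ge T t by (intro mult_right_mono power_mono) (auto simp: t_def)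
  also have "\<dots> \<le> 56 / L"
    unfolding T_def
    by (rule order_trans[OF norm_trig_sum_le_second_diff sum_second_diff_bump_correlation_le[OF w L]])
       (simp add: bumpD(1)[OF w])
  finally have cancellation: "16 * t\<^sup>2 * T \<le> 56 / L" by (simp add: power_mult_distrib)
  have "T * (1 + L * t)\<^sup>2 \<le> 16 * L"
  proof (cases "L * t \<le> 1")
    case True
    then have "(1 + L * t)\<^sup>2 \<le> 2\<^sup>2" using t L_pos by (intro power_mono) auto
    then have "T * (1 + L * t)\<^sup>2 \<le> 4 * real L * 4" using trivial_bound T by (intro mult_mono) auto
    then show ?thesis by simp
  next
    case False
    then have "1 + L * t \<le> 2 * (L * t)" by linarith
    then have "(1 + L * t)\<^sup>2 \<le> (2 * (L * t))\<^sup>2" using t L_pos by (intro power_mono) auto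
    then have "T * (1 + L * t)\<^sup>2 \<le> T * (2 * (L * t))\<^sup>2" using T by (intro mult_left_mono) auto
    also have "\<dots> = (16 * t\<^sup>2 * T) * (L\<^sup>2 / 4)" by (simp add: power_mult_distrib)
    also have "\<dots> \<le> 56 / L * (L\<^sup>2 / 4)" using cancellation by (intro mult_right_mono) auto
    also have "\<dots> \<le> 16 * L" using L_pos by (simp add: power2_eq_square)
    finally show ?thesis .
  qed
  moreover have "0 < (1 + L * t)\<^sup>2" using t L_pos by (intro zero_less_power add_pos_nonneg) auto
  ultimately show ?thesis
    unfolding dist_kernel_def T_def[symmetric] t_def[symmetric] by (simp add: pos_le_divide_eq)
qed

lemma bump_weyl_sum_square_le:
  assumes w: "bump L a w" and L: "1 \<le> L"
  shows "(norm (weyl_sum (bump_window L a) w x))\<^sup>2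
    \<le> (\<Sum>k\<in>{-8 * int L..8 * int L}. 16 * real L * dist_kernel L (of_int k * x))"
proof -
  have "(norm (weyl_sum (bump_window L a) w x))\<^sup>2
      \<le> (\<Sum>h\<in>{-(4 * int L)..4 * int L}. 16 * real L * dist_kernel L (of_int (2 * h) * x))"
    using bumpD(1)[OF w] by (intro order_trans[OF weyl_differencing] sum_mono bump_correlation_le w L) auto
  also have "\<dots> = (\<Sum>k\<in>(\<lambda>h. 2 * h) ` {-(4 * int L)..4 * int L}. 16 * real L * dist_kernel L (of_int k * x))"
    by (subst sum.reindex) (auto simp: inj_on_def)
  also have "\<dots> \<le> (\<Sum>k\<in>{-8 * int L..8 * int L}. 16 * real L * dist_kernel L (of_int k * x))"
    by (intro sum_mono2) auto
  finally show ?thesis .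
qed

subsection \<open>The pointwise bound near a rational\<close>

lemma sum_inverse_squares_le: "(\<Sum>n\<in>{1..m}. 1 / (real n)\<^sup>2) \<le> 2"
proof -
  have "(\<Sum>n\<in>{1..m}. 1 / (real n)\<^sup>2) = (\<Sum>n<m. 1 / (real n + 1)\<^sup>2)"
    by (simp add: sum.atLeast1_atMost_eq add.commute)
  also have "\<dots> \<le> (\<Sum>n. 1 / (real n + 1)\<^sup>2)"
    using sums_summable[OF inverse_squares_sums] by (intro sum_le_suminf) (auto simp: add.commute)
  also have "\<dots> = pi\<^sup>2 / 6"
    using sums_unique[OF inverse_squares_sums] by (simp add: add.commute)
  also have "\<dots> \<le> 2"
    using power_mono[OF pi_approx(2), of 2] by (simp add: power2_eq_square)
  finally show ?thesis .
qed

lemma sum_inverse_square_progression_le: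
  fixes c :: real
  assumes c: "0 < c"
  shows "(\<Sum>j\<in>{-int m..int m}. 1 / (1 + c * of_int \<bar>j\<bar>)\<^sup>2) \<le> 1 + 2 / c"
proof -
  have "(\<Sum>j\<in>{-int m..int m}. 1 / (1 + c * of_int \<bar>j\<bar>)\<^sup>2) \<le> 1 + 2 / c * (1 - 1 / (1 + c * m))"
  proof (induction m)
    case (Suc m)
    define u where "u = 1 + c * m"
    have u: "1 \<le> u" "1 + c * (real m + 1) = u + c" using c by (auto simp: u_def algebra_simps)
    have "1 / (u + c)\<^sup>2 \<le> 1 / (u * (u + c))"
      using u c by (intro divide_left_mono) (auto simp: power2_eq_square)
    also have "\<dots> = 1 / c * (1 / u - 1 / (u + c))"
      using u c by (simp add: divide_simps)
    finally have "2 * (1 / (u + c)\<^sup>2) \<le> 2 / c * (1 / u - 1 / (u + c))"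
      using mult_left_mono[of _ _ "2::real"] by fastforce
    moreover have "{-int (Suc m)..int (Suc m)}
        = insert (int m + 1) (insert (- (int m + 1)) {-int m..int m})"
      by auto
    ultimately show ?case using Suc.IH u
      by (simp add: u_def[symmetric] right_diff_distrib) (simp add: add_ac)
  qed simp
  also have "\<dots> \<le> 1 + 2 / c * 1"
    using c by (intro add_left_mono mult_left_mono) auto
  finally show ?thesis by simp
qed

lemma sum_periodic_le:
  fixes F :: "int \<Rightarrow> real"
  assumes q: "0 < q" and K: "0 \<le> K" and nonneg: "\<And>k. 0 \<le> F k" and periodic: "\<And>k. F (k mod q) = F k"
  shows "(\<Sum>k\<in>{-K..K}. F k) \<le> (2 * of_int K / of_int q + 3) * (\<Sum>r\<in>{0..<q}. F r)"
proof -
  define J where "J = K div q + 1"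
  define P where "P = {-J..J} \<times> {0..<q}"
  have "k \<in> (\<lambda>(j, r). q * j + r) ` P" if k: "k \<in> {-K..K}" for k
  proof (rule image_eqI[where x = "(k div q, k mod q)"])
    have "(-K) div q \<le> k div q" "k div q \<le> K div q" using k q by (auto intro: zdiv_mono1)
    moreover have "- (K div q) - 1 \<le> (-K) div q" using q by (simp add: zdiv_zminus1_eq_if)
    ultimately show "(k div q, k mod q) \<in> P" using q by (auto simp: P_def J_def)
  qed simp
  then have "(\<Sum>k\<in>{-K..K}. F k) \<le> sum F ((\<lambda>(j, r). q * j + r) ` P)"
    by (intro sum_mono2) (auto simp: P_def nonneg)
  also have "\<dots> \<le> sum (F \<circ> (\<lambda>(j, r). q * j + r)) P"
    by (intro sum_image_le) (auto simp: P_def nonneg)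
  also have "\<dots> = (\<Sum>j\<in>{-J..J}. \<Sum>r\<in>{0..<q}. F (q * j + r))"
    by (simp add: P_def sum.cartesian_product comp_def case_prod_unfold)
  also have "\<dots> = (\<Sum>j\<in>{-J..J}. \<Sum>r\<in>{0..<q}. F r)"
  proof (intro sum.cong refl)
    fix j r assume "r \<in> {0..<q}"
    then have "(q * j + r) mod q = r" by simp
    then show "F (q * j + r) = F r" by (metis periodic)
  qed
  also have "\<dots> = of_int (2 * J + 1) * (\<Sum>r\<in>{0..<q}. F r)"
    using K q by (simp add: J_def pos_imp_zdiv_nonneg_iff)
  also have "\<dots> \<le> (2 * of_int K / of_int q + 3) * (\<Sum>r\<in>{0..<q}. F r)"
    using real_of_int_div4[of K q] by (intro mult_right_mono sum_nonneg nonneg) (simp add: J_def)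
  finally show ?thesis .
qed

lemma dist_int_mod_divide:
  assumes "0 < q"
  shows "dist_int (of_int (k mod q) / of_int q) = dist_int (of_int k / of_int q)"
proof -
  have "of_int k = of_int q * of_int (k div q) + (of_int (k mod q) :: real)"
    by (simp flip: of_int_mult of_int_add)
  then have "of_int k / of_int q = of_int (k mod q) / of_int q + (of_int (k div q) :: real)"
    using assms by (simp add: field_simps)
  then show ?thesis by simp
qed

lemma inverse_dist_int_divide_square_le:
  assumes r: "1 \<le> r" "r < q"
  shows "1 / (dist_int (of_int r / of_int q))\<^sup>2
      \<le> (of_int q)\<^sup>2 * (1 / (of_int r)\<^sup>2 + 1 / (of_int (q - r))\<^sup>2)"
proof -
  define d where "d = dist_int (of_int r / of_int q)"
  obtain k where k: "d = \<bar>of_int r / of_int q - of_int k\<bar>" unfolding d_def by (rule dist_int_attained)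
  have q: "0 < real_of_int q" using r by auto
  have compl: "of_int (q - r) / of_int q = 1 - of_int r / real_of_int q" using q by (simp add: field_simps)
  have inverse_le: "1 / d\<^sup>2 \<le> (of_int q)\<^sup>2 * (1 / (of_int u)\<^sup>2)"
    if u: "1 \<le> u" "of_int u / of_int q \<le> d" for u
  proof -
    have "0 < of_int u / real_of_int q" using q u(1) by simp
    with u(2) have "1 / d\<^sup>2 \<le> 1 / (of_int u / of_int q)\<^sup>2"
      by (intro divide_left_mono power_mono mult_pos_pos zero_less_power) linarith+
    then show ?thesis by (simp add: power_divide)
  qed
  show ?thesis
  proof (cases "k \<le> 0")
    case True
    then have "of_int r / of_int q \<le> d" unfolding k using r by (intro order_trans[OF _ abs_ge_self]) auto
    from inverse_le[OF r(1) this] show ?thesis by (simp add: d_def distrib_left add_increasing2)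
  next
    case False
    then have "1 \<le> real_of_int k" by linarith
    then have "of_int (q - r) / of_int q \<le> d" unfolding k compl by linarith
    from inverse_le[OF _ this] r show ?thesis by (simp add: d_def distrib_left add_increasing)
  qed
qed

lemma sum_inverse_dist_int_residues_le:
  assumes q: "0 < q" and cop: "coprime a q"
  shows "(\<Sum>r\<in>{0..<q}. 1 / (dist_int (of_int (r * a) / of_int q))\<^sup>2) \<le> 4 * (of_int q)\<^sup>2"
proof -
  let ?G = "\<lambda>r. 1 / (dist_int (of_int r / of_int q))\<^sup>2"
  have "(\<Sum>r\<in>{1..<q}. 1 / (of_int r)\<^sup>2) = (\<Sum>n\<in>{1..nat (q - 1)}. 1 / (real n)\<^sup>2)"
    by (rule sum.reindex_bij_witness[of _ int nat]) auto
  then have squares: "(\<Sum>r\<in>{1..<q}. 1 / (of_int r)\<^sup>2) \<le> (2::real)"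
    using sum_inverse_squares_le[of "nat (q - 1)"] by simp
  have "{0..<q} = insert 0 {1..<q}" using q by auto
  then have "(\<Sum>r\<in>{0..<q}. ?G (r * a)) = (\<Sum>r\<in>{1..<q}. ?G (r * a))"
    by (simp add: dist_int_def)
  also have "\<dots> = (\<Sum>r\<in>{1..<q}. ?G (a * r mod q))"
    using q by (simp add: dist_int_mod_divide mult.commute del: of_int_mult)
  also have "\<dots> = (\<Sum>r\<in>{1..<q}. ?G r)"
    by (rule sum.reindex_bij_betw[OF bij_betw_int_remainders_mult[OF cop]])
  also have "\<dots> \<le> (\<Sum>r\<in>{1..<q}. (of_int q)\<^sup>2 * (1 / (of_int r)\<^sup>2 + 1 / (of_int (q - r))\<^sup>2))"
    by (intro sum_mono inverse_dist_int_divide_square_le) auto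
  also have "\<dots> = (of_int q)\<^sup>2 * ((\<Sum>r\<in>{1..<q}. 1 / (of_int r)\<^sup>2) + (\<Sum>r\<in>{1..<q}. 1 / (of_int (q - r))\<^sup>2))"
    by (simp only: sum_distrib_left[symmetric] sum.distrib)
  also have "(\<Sum>r\<in>{1..<q}. 1 / (of_int (q - r))\<^sup>2) = (\<Sum>r\<in>{1..<q}. 1 / (of_int r :: real)\<^sup>2)"
    by (rule sum.reindex_bij_witness[of _ "\<lambda>r. q - r" "\<lambda>r. q - r"]) auto
  also have "(of_int q)\<^sup>2 * ((\<Sum>r\<in>{1..<q}. 1 / (of_int r)\<^sup>2) + (\<Sum>r\<in>{1..<q}. 1 / (of_int r)\<^sup>2))
      \<le> (of_int q)\<^sup>2 * (2 + 2 :: real)"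
    using squares by (intro mult_left_mono add_mono) auto
  finally show ?thesis by simp
qed

locale rational_approximation =
  fixes L :: nat and q a :: int and x :: real
  assumes L: "1 \<le> L" and q: "0 < q" "q \<le> 16 * int L" and coprime_aq: "coprime a q"
    and near: "\<bar>of_int q * x - of_int a\<bar> < 1 / (16 * L)"
begin

definition offset :: real where "offset = x - of_int a / of_int q"

definition frequencies :: "int set" where "frequencies = {-(8 * int L)..8 * int L}"

lemma finite_frequencies [simp]: "finite frequencies"
  by (simp add: frequencies_def)

lemma L_pos: "0 < real L" and q_pos: "0 < real_of_int q" and q_le: "of_int q \<le> 16 * real L"
  using L q by auto

lemma abs_offset_le: "of_int q * \<bar>offset\<bar> \<le> 1 / (16 * L)"
proof -
  have "of_int q * \<bar>offset\<bar> = \<bar>of_int q * offset\<bar>" using q by (simp add: abs_mult)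
  also have "of_int q * offset = of_int q * x - of_int a" using q
    by (simp add: offset_def right_diff_distrib)
  finally show ?thesis using near by simp
qed

lemma abs_frequency_offset_le:
  assumes "k \<in> frequencies"
  shows "\<bar>of_int k * offset\<bar> \<le> 1 / (2 * of_int q)"
proof -
  have "\<bar>of_int k\<bar> \<le> 8 * real L" using assms by (auto simp: frequencies_def)
  then have "\<bar>of_int k * offset\<bar> \<le> 8 * real L * \<bar>offset\<bar>"
    unfolding abs_mult by (intro mult_right_mono) auto
  also have "\<dots> = 8 * real L * (of_int q * \<bar>offset\<bar>) / of_int q" using q_pos by simp
  also have "\<dots> \<le> 8 * real L * (1 / (16 * L)) / of_int q"
    using abs_offset_le q_pos by (intro divide_right_mono mult_left_mono) auto
  also have "\<dots> = 1 / (2 * of_int q)" using L_pos by simp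
  finally show ?thesis .
qed

lemma dist_kernel_nonmultiple_le:
  assumes k: "k \<in> frequencies" "\<not> q dvd k"
  shows "dist_kernel L (of_int k * x) \<le> 4 / (real L)\<^sup>2 * (1 / (dist_int (of_int (k * a) / of_int q))\<^sup>2)"
proof -
  define d where "d = dist_int (of_int (k * a) / of_int q)"
  obtain j where j: "d = \<bar>of_int (k * a) / of_int q - of_int j\<bar>" unfolding d_def by (rule dist_int_attained)
  have "\<not> q dvd k * a" using k coprime_aq by (simp add: coprime_commute coprime_dvd_mult_left_iff)
  then have "k * a - q * j \<noteq> 0" by (metis dvd_triv_left eq_iff_diff_eq_0)
  then have "1 \<le> \<bar>real_of_int (k * a - q * j)\<bar>" by linarith
  also have "\<dots> = d * of_int q"
    unfolding j using q by (simp add: abs_mult_pos' field_simps)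
  finally have d_ge: "1 / of_int q \<le> d" using q_pos by (simp add: field_simps)
  then have d_pos: "0 < d" using q_pos by (meson divide_pos_pos less_le_trans zero_less_one)
  have "of_int k * x + - (of_int k * offset) = of_int (k * a) / of_int q"
    by (simp add: offset_def algebra_simps)
  with dist_int_add_le[of "of_int k * x" "- (of_int k * offset)"]
  have "d \<le> dist_int (of_int k * x) + 1 / (2 * of_int q)"
    unfolding d_def using abs_frequency_offset_le[OF k(1)] by simp
  also have "1 / (2 * of_int q) \<le> d / 2" using d_ge by simp
  finally have "d / 2 \<le> dist_int (of_int k * x)" by simp
  from mult_left_mono[OF this, of L] have "L * (d / 2) \<le> 1 + L * dist_int (of_int k * x)" by simp
  then have "dist_kernel L (of_int k * x) \<le> 1 / (L * (d / 2))\<^sup>2"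
    unfolding dist_kernel_def using d_pos L_pos
    by (intro divide_left_mono power_mono mult_pos_pos zero_less_power add_pos_nonneg) auto
  also have "\<dots> = 4 / (real L)\<^sup>2 * (1 / d\<^sup>2)" by (simp add: power_mult_distrib power_divide)
  finally show ?thesis unfolding d_def .
qed

lemma sum_nonmultiples_le:
  "(\<Sum>k\<in>{k\<in>frequencies. \<not> q dvd k}. dist_kernel L (of_int k * x)) \<le> 1024 * (of_int q / L)"
proof -
  let ?G = "\<lambda>k. 1 / (dist_int (of_int (k * a) / of_int q))\<^sup>2"
  have "(\<Sum>k\<in>frequencies. ?G k) \<le> (2 * of_int (8 * int L) / of_int q + 3) * (\<Sum>r\<in>{0..<q}. ?G r)"
    unfolding frequencies_def
  proof (rule sum_periodic_le)
    fix k
    show "?G (k mod q) = ?G k"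
      using dist_int_mod_divide[OF q(1), of "k mod q * a"] dist_int_mod_divide[OF q(1), of "k * a"]
      by (simp add: mod_mult_left_eq del: of_int_mult)
  qed (use q in auto)
  also have "\<dots> \<le> (2 * of_int (8 * int L) / of_int q + 3) * (4 * (of_int q)\<^sup>2)"
    using q by (intro mult_left_mono sum_inverse_dist_int_residues_le coprime_aq) auto
  also have "\<dots> \<le> (64 * L / of_int q) * (4 * (of_int q)\<^sup>2)"
    using q_pos q_le by (intro mult_right_mono) (auto simp: field_simps)
  also have "\<dots> = 256 * L * of_int q" using q_pos by (simp add: power2_eq_square)
  finally have G_sum: "(\<Sum>k\<in>frequencies. ?G k) \<le> 256 * L * of_int q" .
  have "(\<Sum>k\<in>{k\<in>frequencies. \<not> q dvd k}. dist_kernel L (of_int k * x))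
      \<le> (\<Sum>k\<in>{k\<in>frequencies. \<not> q dvd k}. 4 / (real L)\<^sup>2 * ?G k)"
    by (intro sum_mono dist_kernel_nonmultiple_le) auto
  also have "\<dots> \<le> (\<Sum>k\<in>frequencies. 4 / (real L)\<^sup>2 * ?G k)"
    by (intro sum_mono2) auto
  also have "\<dots> = 4 / (real L)\<^sup>2 * (\<Sum>k\<in>frequencies. ?G k)"
    by (simp only: sum_distrib_left)
  also have "\<dots> \<le> 4 / (real L)\<^sup>2 * (256 * L * of_int q)"
    using G_sum by (intro mult_left_mono) auto
  also have "\<dots> = 1024 * (of_int q / L)"
    using L_pos by (simp add: power2_eq_square)
  finally show ?thesis .
qed

lemma dist_kernel_multiple:
  assumes "q * j \<in> frequencies"
  shows "dist_kernel L (of_int (q * j) * x) = 1 / (1 + L * of_int q * \<bar>offset\<bar> * of_int \<bar>j\<bar>)\<^sup>2"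
proof -
  have "1 / (2 * of_int q) \<le> 1 / (2 * 1 :: real)" using q by (intro divide_left_mono mult_left_mono) auto
  then have small: "\<bar>of_int (q * j) * offset\<bar> \<le> 1 / 2" using abs_frequency_offset_le[OF assms] by simp
  have shift: "of_int (q * j) * x = of_int (q * j) * offset + of_int (j * a)"
    using q_pos by (simp add: offset_def field_simps)
  have "dist_int (of_int (q * j) * x) = \<bar>of_int (q * j) * offset\<bar>"
    unfolding shift dist_int_add_of_int by (rule dist_int_of_small[OF small])
  also have "\<dots> = of_int q * \<bar>offset\<bar> * of_int \<bar>j\<bar>" using q by (simp add: abs_mult)
  finally show ?thesis by (simp add: dist_kernel_def mult.assoc)
qed

lemma sum_multiples:
  defines "m \<equiv> nat (8 * int L div q)"
  shows "(\<Sum>k\<in>{k\<in>frequencies. q dvd k}. dist_kernel L (of_int k * x))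
    = (\<Sum>j\<in>{-int m..int m}. 1 / (1 + L * of_int q * \<bar>offset\<bar> * of_int \<bar>j\<bar>)\<^sup>2)"
proof -
  have m: "int m = 8 * int L div q" using q by (simp add: m_def pos_imp_zdiv_nonneg_iff)
  have frequency_iff: "q * j \<in> frequencies \<longleftrightarrow> j \<in> {-int m..int m}" for j
  proof -
    have "q * i \<le> 8 * int L \<longleftrightarrow> i \<le> int m" for i
    proof -
      have "i \<le> int m \<longleftrightarrow> of_int i * of_int q \<le> real_of_int (8 * int L)"
        unfolding m floor_divide_of_int_eq[symmetric, where ?'a = real] le_floor_iff pos_le_divide_eq[OF q_pos] ..
      also have "\<dots> \<longleftrightarrow> q * i \<le> 8 * int L"
        unfolding of_int_mult[symmetric] of_int_le_iff by (simp only: mult.commute)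
      finally show ?thesis by simp
    qed
    from this[of j] this[of "-j"] show ?thesis by (auto simp: frequencies_def)
  qed
  then have multiples: "{k\<in>frequencies. q dvd k} = (\<lambda>j. q * j) ` {-int m..int m}"
    unfolding dvd_def by blast
  have "(\<Sum>k\<in>{k\<in>frequencies. q dvd k}. dist_kernel L (of_int k * x))
      = (\<Sum>j\<in>{-int m..int m}. dist_kernel L (of_int (q * j) * x))"
    unfolding multiples using q by (subst sum.reindex) (auto simp: inj_on_def)
  also have "\<dots> = (\<Sum>j\<in>{-int m..int m}. 1 / (1 + L * of_int q * \<bar>offset\<bar> * of_int \<bar>j\<bar>)\<^sup>2)"
    by (intro sum.cong refl dist_kernel_multiple) (simp only: frequency_iff)
  finally show ?thesis .
qed

lemma sum_multiples_le: "(\<Sum>k\<in>{k\<in>frequencies. q dvd k}. dist_kernel L (of_int k * x)) \<le> 32 * (L / of_int q)"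
proof -
  define m where "m = nat (8 * int L div q)"
  have "(\<Sum>k\<in>{k\<in>frequencies. q dvd k}. dist_kernel L (of_int k * x)) \<le> (\<Sum>j\<in>{-int m..int m}. 1)"
    unfolding sum_multiples m_def[symmetric] using q_pos
    by (intro sum_mono) (auto simp: divide_le_eq_1 intro!: one_le_power)
  also have "\<dots> = 2 * of_int (8 * int L div q) + 1"
    using q by (simp add: m_def pos_imp_zdiv_nonneg_iff)
  also have "\<dots> \<le> 2 * (8 * L / of_int q) + 16 * L / of_int q"
    using real_of_int_div4[of "8 * int L" q] q_pos q_le by (intro add_mono) auto
  finally show ?thesis by simp
qed

lemma sum_multiples_mult_offset_le:
  "(\<Sum>k\<in>{k\<in>frequencies. q dvd k}. dist_kernel L (of_int k * x)) * (of_int q * \<bar>offset\<bar>) \<le> 3 / L"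
proof (cases "offset = 0")
  case False
  define c where "c = L * of_int q * \<bar>offset\<bar>"
  have c: "0 < c" using False L_pos q_pos by (auto simp: c_def)
  have "(\<Sum>k\<in>{k\<in>frequencies. q dvd k}. dist_kernel L (of_int k * x)) * (of_int q * \<bar>offset\<bar>)
      \<le> (1 + 2 / c) * (of_int q * \<bar>offset\<bar>)"
    unfolding sum_multiples c_def[symmetric] using q_pos
    by (intro mult_right_mono sum_inverse_square_progression_le c) auto
  also have "\<dots> = of_int q * \<bar>offset\<bar> + 2 / L"
    using False L_pos q_pos by (simp add: c_def distrib_right)
  also have "\<dots> \<le> 1 / (16 * L) + 2 / L" by (intro add_right_mono abs_offset_le)
  also have "\<dots> \<le> 3 / L" using L_pos by (simp add: field_simps)
  finally show ?thesis .
qed simp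

lemma sum_dist_kernel_le:
  "(\<Sum>k\<in>frequencies. 16 * real L * dist_kernel L (of_int k * x))
    \<le> 10 ^ 7 / (of_int q * (1 / (real L)\<^sup>2 + \<bar>x - of_int a / of_int q\<bar>))"
proof -
  define \<Delta> where "\<Delta> = of_int q / (real L)\<^sup>2 + of_int q * \<bar>offset\<bar>"
  define minor where "minor = (\<Sum>k\<in>{k\<in>frequencies. \<not> q dvd k}. dist_kernel L (of_int k * x))"
  define major where "major = (\<Sum>k\<in>{k\<in>frequencies. q dvd k}. dist_kernel L (of_int k * x))"
  have \<Delta>: "0 < \<Delta>" unfolding \<Delta>_def using q_pos L_pos by (intro add_pos_nonneg) auto
  have "minor * \<Delta> \<le> 1024 * (of_int q / L) * \<Delta>"
    unfolding minor_def using \<Delta> by (intro mult_right_mono sum_nonmultiples_le) auto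
  also have "\<dots> = 1024 / L * (of_int q / L * (of_int q / L) + of_int q * (of_int q * \<bar>offset\<bar>))"
    using L_pos by (simp add: \<Delta>_def power2_eq_square field_simps)
  also have "\<dots> \<le> 1024 / L * (16 * 16 + 16 * L * (1 / (16 * L)))"
    using q_pos q_le L_pos abs_offset_le
    by (intro mult_left_mono add_mono mult_mono) (auto simp: divide_le_eq)
  finally have "minor * \<Delta> \<le> 263168 / L" using L_pos by simp
  moreover have "major * \<Delta> \<le> 35 / L"
  proof -
    have "major * (of_int q / (real L)\<^sup>2) \<le> 32 * (L / of_int q) * (of_int q / (real L)\<^sup>2)"
      unfolding major_def using q_pos by (intro mult_right_mono sum_multiples_le) auto
    also have "\<dots> = 32 / L" using q_pos L_pos by (simp add: power2_eq_square)
    finally show ?thesis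
      using sum_multiples_mult_offset_le by (simp add: \<Delta>_def distrib_left flip: major_def)
  qed
  ultimately have "16 * real L * ((minor + major) * \<Delta>) \<le> 16 * real L * (263168 / L + 35 / L)"
    by (intro mult_left_mono) (auto simp: distrib_right)
  also have "\<dots> \<le> 10 ^ 7" using L_pos by (simp add: field_simps)
  finally have "16 * real L * (minor + major) \<le> 10 ^ 7 / \<Delta>" using \<Delta>
    by (simp add: pos_le_divide_eq mult.assoc)
  moreover have "(\<Sum>k\<in>frequencies. dist_kernel L (of_int k * x)) = minor + major"
    unfolding minor_def major_def by (subst sum.union_disjoint[symmetric]) (auto intro!: sum.cong)
  ultimately show ?thesis
    by (simp add: \<Delta>_def distrib_left flip: sum_distrib_left offset_def)
qed

end

lemma bump_weyl_sum_pointwise: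
  assumes w: "bump L b w" and L: "1 \<le> L" and x: "x \<in> {0..1}"
  obtains q a :: nat where "1 \<le> q" "q \<le> 16 * L" "a \<le> q"
    "(norm (weyl_sum (bump_window L b) w x))\<^sup>2 \<le> 10 ^ 7 / (q * (1 / (real L)\<^sup>2 + \<bar>x - a / q\<bar>))"
proof -
  obtain a q where aq: "coprime a q" "0 < q" "q \<le> int (16 * L)" "\<bar>of_int q * x - of_int a\<bar> < 1 / (16 * L)"
    using Dirichlet_approx_coprime[of "16 * L" x] L by auto
  interpret rational_approximation L q a x
    using aq L by unfold_locales auto
  have "\<bar>of_int q * x - of_int a\<bar> < 1" using aq(4) L by (auto elim!: order_less_le_trans)
  moreover have "0 \<le> of_int q * x" "of_int q * x \<le> of_int q * 1" using x aq(2)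
    by (auto intro!: mult_left_mono)
  ultimately have "(-1::real) < of_int a" "real_of_int a < of_int q + 1" by linarith+
  then have a: "0 \<le> a" "a \<le> q" by linarith+
  have "(norm (weyl_sum (bump_window L b) w x))\<^sup>2
      \<le> 10 ^ 7 / (of_int q * (1 / (real L)\<^sup>2 + \<bar>x - of_int a / of_int q\<bar>))"
    using bump_weyl_sum_square_le[OF w L, of x] sum_dist_kernel_le unfolding frequencies_def by simp
  then show ?thesis
    using aq a by (intro that[of "nat q" "nat a"]) auto
qed

subsection \<open>The growth rate of quadratic exponential sums\<close>

definition weyl_exponent :: "real \<Rightarrow> real" where
  "weyl_exponent r = max (1/2) (1 - 2/r)"

definition weyl_growth :: "real \<Rightarrow> real \<Rightarrow> real" where
  "weyl_growth r n = n powr weyl_exponent r * (if r = 4 then (1 + ln n) powr (1/4) else 1)"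

lemma weyl_exponent_ge: "1/2 \<le> weyl_exponent r"
  by (simp add: weyl_exponent_def)

lemma weyl_exponent_le_one: "0 < r \<Longrightarrow> weyl_exponent r \<le> 1"
  by (simp add: weyl_exponent_def)

lemma weyl_exponent_le_4: "0 < r \<Longrightarrow> r \<le> 4 \<Longrightarrow> weyl_exponent r = 1/2"
  by (simp add: weyl_exponent_def max_def field_simps)

lemma weyl_exponent_ge_4: "4 \<le> r \<Longrightarrow> weyl_exponent r = 1 - 2/r"
  by (simp add: weyl_exponent_def max_def field_simps)

lemma weyl_growth_less_4: "0 < r \<Longrightarrow> r < 4 \<Longrightarrow> weyl_growth r n = n powr (1/2)"
  by (simp add: weyl_growth_def weyl_exponent_le_4)

lemma weyl_growth_4: "weyl_growth 4 n = n powr (1/2) * (1 + ln n) powr (1/4)"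
  by (simp add: weyl_growth_def weyl_exponent_le_4)

lemma weyl_growth_greater_4: "4 < r \<Longrightarrow> weyl_growth r n = n powr (1 - 2/r)"
  by (simp add: weyl_growth_def weyl_exponent_ge_4)

lemma weyl_growth_pos:
  assumes "1 \<le> n" shows "0 < weyl_growth r n"
proof -
  have "0 \<le> ln n" using assms by simp
  then have "1 + ln n \<noteq> 0" by linarith
  then show ?thesis using assms by (auto simp: weyl_growth_def)
qed

lemma weyl_growth_le_scaled:
  assumes "1 \<le> n" "n \<le> m"
  shows "weyl_growth r n \<le> (n / m) powr weyl_exponent r * weyl_growth r m"
proof -
  have "(if r = 4 then (1 + ln n) powr (1/4) else 1) \<le> (if r = 4 then (1 + ln m) powr (1/4) else 1)"
    using assms by (auto intro!: powr_mono2)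
  then have "weyl_growth r n \<le> n powr weyl_exponent r * (if r = 4 then (1 + ln m) powr (1/4) else 1)"
    unfolding weyl_growth_def by (intro mult_left_mono) auto
  also have "\<dots> = (n / m) powr weyl_exponent r * weyl_growth r m"
    using assms by (simp add: weyl_growth_def powr_divide)
  finally show ?thesis .
qed

lemma weyl_growth_mono:
  assumes "1 \<le> n" "n \<le> m"
  shows "weyl_growth r n \<le> weyl_growth r m"
proof -
  have "(n / m) powr weyl_exponent r \<le> 1 powr weyl_exponent r"
    using assms weyl_exponent_ge[of r] by (intro powr_mono2) (auto simp: divide_le_eq_1)
  then have "(n / m) powr weyl_exponent r * weyl_growth r m \<le> 1 * weyl_growth r m"
    using weyl_growth_pos[of m r] assms by (intro mult_right_mono) auto
  then show ?thesis using weyl_growth_le_scaled[OF assms, of r] by linarith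
qed

lemma one_plus_ln_le:
  fixes y \<epsilon> :: real
  assumes "1 \<le> y" "0 < \<epsilon>"
  shows "1 + ln y \<le> (1 + 1/\<epsilon>) * y powr \<epsilon>"
proof -
  have "\<epsilon> * ln y \<le> y powr \<epsilon> - 1"
    using ln_le_minus_one[of "y powr \<epsilon>"] assms by (simp add: ln_powr)
  then have "ln y \<le> y powr \<epsilon> / \<epsilon>" using assms by (simp add: field_simps)
  moreover have "1 \<le> y powr \<epsilon>" using assms by (simp add: ge_one_powr_ge_zero)
  ultimately show ?thesis by (simp add: algebra_simps)
qed

text \<open>An arbitrarily small loss \<open>\<epsilon>\<close> in the exponent absorbs the logarithm.\<close>

lemma weyl_growth_le_powr:
  assumes nm: "1 \<le> m" "m \<le> n" and \<epsilon>: "0 < \<epsilon>"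
  shows "weyl_growth r n \<le> (1 + 1/\<epsilon>) * weyl_growth r m * (n / m) powr (weyl_exponent r + \<epsilon>)"
proof -
  define y where "y = n / m"
  have y: "1 \<le> y" and n: "n = m * y" using nm by (auto simp: y_def)
  have loss: "1 + ln y \<le> (1 + 1/\<epsilon>) * y powr \<epsilon>" by (rule one_plus_ln_le[OF y \<epsilon>])
  have "1 + ln n = 1 + ln m + ln y" using nm y by (simp add: n ln_mult)
  also have "\<dots> \<le> (1 + ln y) * (1 + ln m)" using nm y by (simp add: algebra_simps)
  finally have "(1 + ln n) powr (1/4) \<le> ((1 + ln y) * (1 + ln m)) powr (1/4)"
    using nm by (intro powr_mono2) auto
  also have "\<dots> = (1 + ln y) powr (1/4) * (1 + ln m) powr (1/4)" by (rule powr_mult)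
  also have "(1 + ln y) powr (1/4) \<le> (1 + ln y) powr 1" using y by (intro powr_mono) auto
  also have "\<dots> \<le> (1 + 1/\<epsilon>) * y powr \<epsilon>" using y loss by simp
  finally have "(1 + ln n) powr (1/4) \<le> (1 + 1/\<epsilon>) * y powr \<epsilon> * (1 + ln m) powr (1/4)"
    by (simp add: mult_right_mono)
  moreover have "1 \<le> (1 + 1/\<epsilon>) * y powr \<epsilon>" using loss y
    by (meson ln_ge_zero add_increasing2 order_refl order_trans)
  ultimately have "(if r = 4 then (1 + ln n) powr (1/4) else 1)
      \<le> (1 + 1/\<epsilon>) * y powr \<epsilon> * (if r = 4 then (1 + ln m) powr (1/4) else 1)"
    by auto
  then have "weyl_growth r n
      \<le> n powr weyl_exponent r * ((1 + 1/\<epsilon>) * y powr \<epsilon> * (if r = 4 then (1 + ln m) powr (1/4) else 1))"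
    unfolding weyl_growth_def by (intro mult_left_mono) auto
  also have "\<dots> = (1 + 1/\<epsilon>) * weyl_growth r m * y powr (weyl_exponent r + \<epsilon>)"
    using nm y by (simp add: weyl_growth_def n powr_mult powr_add mult_ac)
  finally show ?thesis unfolding y_def .
qed

lemma weyl_growth_le_powr_scaled:
  assumes "1 \<le> a" "1 \<le> m" "m \<le> n" "a \<le> n" and \<epsilon>: "0 < \<epsilon>"
  shows "weyl_growth r m
    \<le> (1 + 1/\<epsilon>) * weyl_growth r a * a powr (-(weyl_exponent r + \<epsilon>)) * n powr (weyl_exponent r + \<epsilon>)"
proof -
  have "weyl_growth r m \<le> weyl_growth r n" using assms by (intro weyl_growth_mono) auto
  also have "\<dots> \<le> (1 + 1/\<epsilon>) * weyl_growth r a * (n / a) powr (weyl_exponent r + \<epsilon>)"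
    using assms by (intro weyl_growth_le_powr) auto
  finally show ?thesis by (simp add: powr_divide powr_minus_divide[of a "weyl_exponent r + \<epsilon>"] del: minus_add_distrib)
qed

lemma weyl_growth_mult_le:
  assumes "0 < r" "1 \<le> n" "1 \<le> c"
  shows "weyl_growth r (c * n) \<le> 2 * c\<^sup>2 * weyl_growth r n"
proof -
  have "1 * n \<le> c * n" using assms by (intro mult_right_mono) auto
  then have "weyl_growth r (c * n) \<le> (1 + 1/1) * weyl_growth r n * (c * n / n) powr (weyl_exponent r + 1)"
    using assms by (intro weyl_growth_le_powr) auto
  also have "\<dots> = 2 * weyl_growth r n * c powr (weyl_exponent r + 1)" using assms by simp
  also have "\<dots> \<le> 2 * weyl_growth r n * c powr 2"
    using assms weyl_exponent_le_one[of r] weyl_growth_pos[of n r] by (intro mult_left_mono powr_mono) auto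
  finally show ?thesis using assms by (simp add: mult_ac)
qed

lemma sum_weyl_growth_dyadic_le:
  "(\<Sum>k\<le>K. weyl_growth r (2 ^ k)) \<le> 4 * weyl_growth r (2 ^ K)"
proof (induction K)
  case 0
  then show ?case using weyl_growth_pos[of 1 r] by simp
next
  case (Suc K)
  have "(1/2) powr weyl_exponent r \<le> (1/2) powr (1/2)"
    using weyl_exponent_ge by (intro powr_mono') auto
  also have "\<dots> = sqrt (1/2)" by (simp add: powr_half_sqrt)
  also have "\<dots> \<le> 3/4" by (rule real_le_lsqrt) (auto simp: power2_eq_square)
  finally have ratio: "(1/2) powr weyl_exponent r \<le> 3/4" .
  have "weyl_growth r (2 ^ K) \<le> (2 ^ K / 2 ^ Suc K) powr weyl_exponent r * weyl_growth r (2 ^ Suc K)"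
    by (intro weyl_growth_le_scaled) auto
  also have "\<dots> = (1/2) powr weyl_exponent r * weyl_growth r (2 ^ Suc K)" by simp
  also have "\<dots> \<le> 3/4 * weyl_growth r (2 ^ Suc K)"
    using ratio weyl_growth_pos[of "2 ^ Suc K" r, OF one_le_power] by (intro mult_right_mono) auto
  finally show ?case using Suc.IH by simp
qed

lemma powr_diff_ge:
  fixes y z \<theta> :: real
  assumes "0 \<le> z" "z \<le> y" "0 < y" "0 < \<theta>" "\<theta> \<le> 1"
  shows "\<theta> * y powr (\<theta> - 1) * (y - z) \<le> y powr \<theta> - z powr \<theta>"
proof -
  consider "z = y" | "z = 0" | "0 < z" "z < y" using assms by linarith
  then show ?thesis
  proof cases
    assume "z = 0"
    have "\<theta> * y powr (\<theta> - 1) * y = \<theta> * y powr \<theta>" using assms by (simp add: powr_diff)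
    also have "\<dots> \<le> 1 * y powr \<theta>" using assms by (intro mult_right_mono) auto
    finally show ?thesis using \<open>z = 0\<close> assms by simp
  next
    assume z: "0 < z" "z < y"
    obtain u where u: "z < u" "u < y" "y powr \<theta> - z powr \<theta> = (y - z) * (\<theta> * u powr (\<theta> - 1))"
      using MVT2[of z y "\<lambda>x. x powr \<theta>" "\<lambda>x. \<theta> * x powr (\<theta> - 1)"] z
      by (metis has_real_derivative_powr less_le_trans)
    have "y powr (\<theta> - 1) \<le> u powr (\<theta> - 1)" using u z assms by (intro powr_mono2') auto
    then have "(y - z) * (\<theta> * y powr (\<theta> - 1)) \<le> (y - z) * (\<theta> * u powr (\<theta> - 1))"
      using z assms by (intro mult_left_mono) auto
    then show ?thesis using u by (simp add: mult_ac)
  qed simp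
qed

lemma sum_powr_le:
  fixes \<theta> :: real
  assumes "0 < \<theta>" "\<theta> \<le> 1"
  shows "(\<Sum>q\<in>{1..n::nat}. real q powr (\<theta> - 1)) \<le> real n powr \<theta> / \<theta>"
proof (induction n)
  case (Suc n)
  have "\<theta> * real (Suc n) powr (\<theta> - 1) * (real (Suc n) - real n) \<le> real (Suc n) powr \<theta> - real n powr \<theta>"
    using assms by (intro powr_diff_ge) auto
  then have "real (Suc n) powr (\<theta> - 1) \<le> (real (Suc n) powr \<theta> - real n powr \<theta>) / \<theta>"
    using assms by (simp add: field_simps)
  then show ?case using Suc.IH by (simp add: diff_divide_distrib)
qed simp

lemma harm_le_one_plus_ln:
  assumes "1 \<le> n"
  shows "harm n \<le> 1 + ln (real n)"
  using decseqD[OF decseq_harm_diff_ln, of 0 "n - 1"] assms by (simp add: harm_def)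

lemma sum_denominators_less_4_le:
  fixes n :: nat
  assumes r: "2 < r" "r < 4"
  shows "real n powr (r - 2) * (\<Sum>q\<in>{1..n}. real q powr (1 - r/2)) \<le> 1 / (2 - r/2) * weyl_growth r n powr r"
proof -
  have "(\<Sum>q\<in>{1..n}. real q powr (1 - r/2)) \<le> real n powr (2 - r/2) / (2 - r/2)"
    using sum_powr_le[of "2 - r/2" n] r by simp
  then have "real n powr (r - 2) * (\<Sum>q\<in>{1..n}. real q powr (1 - r/2))
      \<le> real n powr (r - 2) * (real n powr (2 - r/2) / (2 - r/2))"
    by (intro mult_left_mono) auto
  also have "\<dots> = 1 / (2 - r/2) * (real n powr (r - 2) * real n powr (2 - r/2))" by simp
  also have "real n powr (r - 2) * real n powr (2 - r/2) = weyl_growth r n powr r"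
    using r by (simp add: weyl_growth_less_4 powr_powr flip: powr_add)
  finally show ?thesis .
qed

lemma sum_denominators_4_le:
  fixes n :: nat
  assumes n: "1 \<le> n"
  shows "real n powr 2 * (\<Sum>q\<in>{1..n}. real q powr (-1)) \<le> weyl_growth 4 n powr 4"
proof -
  have "(\<Sum>q\<in>{1..n}. real q powr (-1)) = harm n"
    unfolding harm_def by (intro sum.cong) (auto simp: powr_minus)
  also have "\<dots> \<le> 1 + ln n" by (rule harm_le_one_plus_ln[OF n])
  finally have "real n powr 2 * (\<Sum>q\<in>{1..n}. real q powr (-1)) \<le> real n powr 2 * (1 + ln n)"
    by (intro mult_left_mono) auto
  also have "\<dots> = weyl_growth 4 n powr 4"
    using n by (simp add: weyl_growth_4 powr_mult powr_powr add_nonneg_nonneg)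
  finally show ?thesis .
qed

lemma sum_denominators_greater_4_le:
  assumes r: "4 < r"
  shows "real n powr (r - 2) * (\<Sum>q\<in>{1..n}. real q powr (1 - r/2))
    \<le> (\<Sum>q. real q powr (1 - r/2)) * weyl_growth r n powr r"
proof -
  have "summable (\<lambda>q. real q powr (1 - r/2))" using r by (simp add: summable_real_powr_iff)
  then have "(\<Sum>q\<in>{1..n}. real q powr (1 - r/2)) \<le> (\<Sum>q. real q powr (1 - r/2))"
    by (intro sum_le_suminf) auto
  then have "(\<Sum>q\<in>{1..n}. real q powr (1 - r/2)) * real n powr (r - 2)
      \<le> (\<Sum>q. real q powr (1 - r/2)) * real n powr (r - 2)"
    by (intro mult_right_mono) auto
  then show ?thesis
    using r by (simp add: weyl_growth_greater_4 powr_powr right_diff_distrib mult.commute)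
qed

lemma sum_denominators_le:
  assumes r: "2 < r"
  shows "\<exists>K>0. \<forall>n\<ge>1. real n powr (r - 2) * (\<Sum>q\<in>{1..n::nat}. real q powr (1 - r/2))
      \<le> K * weyl_growth r n powr r"
proof -
  consider "r < 4" | "r = 4" | "4 < r" by linarith
  then show ?thesis
  proof cases
    assume "r < 4"
    then show ?thesis using sum_denominators_less_4_le[OF r] by (intro exI[of _ "1 / (2 - r/2)"]) auto
  next
    assume "r = 4"
    then show ?thesis using sum_denominators_4_le by (intro exI[of _ 1]) auto
  next
    assume "4 < r"
    then have "summable (\<lambda>q. real q powr (1 - r/2))" by (simp add: summable_real_powr_iff)
    then have "0 < (\<Sum>q. real q powr (1 - r/2))" by (rule suminf_pos2[of _ 1]) auto
    then show ?thesis using sum_denominators_greater_4_le[OF \<open>4 < r\<close>] by blast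
  qed
qed

subsection \<open>Integrating the pointwise bound\<close>

lemma has_integral_shifted_powr:
  fixes \<delta> \<rho> c d :: real
  assumes \<delta>: "0 < \<delta>" and \<rho>: "\<rho> \<noteq> 1" and cd: "c \<le> d"
  shows "((\<lambda>x. (\<delta> + (x - c)) powr (-\<rho>)) has_integral
    (\<delta> powr (1 - \<rho>) - (\<delta> + (d - c)) powr (1 - \<rho>)) / (\<rho> - 1)) {c..d}"
proof -
  define F where "F = (\<lambda>x. - ((\<delta> + (x - c)) powr (1 - \<rho>) / (\<rho> - 1)))"
  have "((\<lambda>x. (\<delta> + (x - c)) powr (-\<rho>)) has_integral (F d - F c)) {c..d}"
  proof (rule fundamental_theorem_of_calculus[OF cd])
    fix x assume "x \<in> {c..d}"
    then have "(F has_real_derivative - ((1 - \<rho>) * (\<delta> + (x - c)) powr (1 - \<rho> - 1) / (\<rho> - 1))) (at x within {c..d})"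
      unfolding F_def using \<delta> \<rho> by (auto intro!: derivative_eq_intros)
    also have "- ((1 - \<rho>) * (\<delta> + (x - c)) powr (1 - \<rho> - 1) / (\<rho> - 1)) = (\<delta> + (x - c)) powr (-\<rho>)"
      using \<rho> by (simp add: field_simps)
    finally show "(F has_vector_derivative (\<delta> + (x - c)) powr (-\<rho>)) (at x within {c..d})"
      by (simp add: has_real_derivative_iff_has_vector_derivative)
  qed
  then show ?thesis by (simp add: F_def diff_divide_distrib)
qed

lemma integral_inverse_distance_powr_le:
  fixes \<delta> \<rho> b c d :: real
  assumes \<delta>: "0 < \<delta>" and \<rho>: "1 < \<rho>" and b: "c \<le> b" "b \<le> d"
  shows "integral {c..d} (\<lambda>x. (\<delta> + \<bar>x - b\<bar>) powr (-\<rho>)) \<le> 2 * \<delta> powr (1 - \<rho>) / (\<rho> - 1)"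
proof -
  let ?f = "\<lambda>x. (\<delta> + \<bar>x - b\<bar>) powr (-\<rho>)"
  let ?I = "\<lambda>u. (\<delta> powr (1 - \<rho>) - (\<delta> + u) powr (1 - \<rho>)) / (\<rho> - 1)"
  have "((\<lambda>x. (\<delta> + (x - b)) powr (-\<rho>)) has_integral ?I (d - b)) {b..d}"
    using \<delta> \<rho> b by (intro has_integral_shifted_powr) auto
  then have right: "(?f has_integral ?I (d - b)) {b..d}"
    by (rule has_integral_eq[rotated]) simp
  have "((\<lambda>x. (\<delta> + (x - (-b))) powr (-\<rho>)) has_integral ?I (- c - (-b))) {-b..-c}"
    using \<delta> \<rho> b by (intro has_integral_shifted_powr) auto
  then have "((\<lambda>x. (\<delta> + (- x + b)) powr (-\<rho>)) has_integral ?I (b - c)) {c..b}"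
    by (subst (asm) has_integral_reflect_real[symmetric]) (simp add: algebra_simps)
  then have left: "(?f has_integral ?I (b - c)) {c..b}"
    by (rule has_integral_eq[rotated]) simp
  have "integral {c..d} ?f = ?I (b - c) + ?I (d - b)"
    using has_integral_combine[OF b left right] by (rule integral_unique)
  also have "\<dots> \<le> \<delta> powr (1 - \<rho>) / (\<rho> - 1) + \<delta> powr (1 - \<rho>) / (\<rho> - 1)"
    using \<rho> by (intro add_mono divide_right_mono) auto
  finally show ?thesis by simp
qed

definition peak :: "nat \<Rightarrow> real \<Rightarrow> real \<Rightarrow> real \<Rightarrow> real" where
  "peak L \<rho> b x = (1 / (real L)\<^sup>2 + \<bar>x - b\<bar>) powr (-\<rho>)"

lemma peak_nonneg [simp]: "0 \<le> peak L \<rho> b x"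
  by (simp add: peak_def)

lemma peak_integrable:
  assumes "1 \<le> L"
  shows "peak L \<rho> b integrable_on {c..d}"
  unfolding peak_def using assms
  by (intro integrable_continuous_real continuous_intros) (auto simp: add_nonneg_eq_0_iff)

lemma integral_peak_le:
  assumes "1 \<le> L" "1 < \<rho>" "c \<le> b" "b \<le> d"
  shows "integral {c..d} (peak L \<rho> b) \<le> 2 * real L powr (2 * \<rho> - 2) / (\<rho> - 1)"
proof -
  have "(1 / (real L)\<^sup>2) powr (1 - \<rho>) = real L powr (2 * \<rho> - 2)"
    using assms by (simp add: powr_divide powr_minus_divide[symmetric] powr_powr flip: powr_numeral)
  then show ?thesis
    unfolding peak_def using integral_inverse_distance_powr_le[of "1 / (real L)\<^sup>2" \<rho> c b d] assms by simp
qed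

lemma bump_weyl_sum_powr_le:
  assumes w: "bump L b w" and L: "1 \<le> L" and x: "x \<in> {0..1}" and r: "0 < r"
  shows "norm (weyl_sum (bump_window L b) w x) powr r
    \<le> (\<Sum>q\<in>{1..16 * L}. \<Sum>a\<in>{0..q}.
          (10 ^ 7 / real q) powr (r/2) * peak L (r/2) (real a / real q) x)"
proof -
  let ?S = "weyl_sum (bump_window L b) w x"
  let ?h = "\<lambda>q a. (10 ^ 7 / real q) powr (r/2) * peak L (r/2) (real a / real q) x"
  obtain q a :: nat where qa: "1 \<le> q" "q \<le> 16 * L" "a \<le> q"
    and square_le: "(norm ?S)\<^sup>2 \<le> 10 ^ 7 / (q * (1 / (real L)\<^sup>2 + \<bar>x - a / q\<bar>))"
    by (rule bump_weyl_sum_pointwise[OF w L x])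
  have "norm ?S powr r = ((norm ?S)\<^sup>2) powr (r/2)"
    by (simp add: powr_powr flip: powr_numeral)
  also have "\<dots> \<le> (10 ^ 7 / (q * (1 / (real L)\<^sup>2 + \<bar>x - a / q\<bar>))) powr (r/2)"
    using r square_le by (intro powr_mono2) auto
  also have "\<dots> = ?h q a"
    by (simp only: divide_divide_eq_left[symmetric] powr_divide[of "10 ^ 7 / q"] peak_def powr_minus_divide) simp
  also have "\<dots> \<le> (\<Sum>a\<in>{0..q}. ?h q a)"
    using qa by (intro member_le_sum) auto
  also have "\<dots> \<le> (\<Sum>q\<in>{1..16 * L}. \<Sum>a\<in>{0..q}. ?h q a)"
    using qa by (intro member_le_sum[of q _ "\<lambda>q. \<Sum>a\<in>{0..q}. ?h q a"] sum_nonneg) auto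
  finally show ?thesis .
qed

lemma bump_weyl_sum_integral_le:
  assumes w: "bump L b w" and L: "1 \<le> L" and r: "2 < r"
  shows "integral {0..1} (\<lambda>x. norm (weyl_sum (bump_window L b) w x) powr r)
    \<le> 4 * (10 ^ 7) powr (r/2) / (r/2 - 1) * (real L powr (r - 2) * (\<Sum>q\<in>{1..16 * L}. real q powr (1 - r/2)))"
proof -
  let ?S = "weyl_sum (bump_window L b) w"
  define c where "c = (10 ^ 7) powr (r/2) * (2 * real L powr (r - 2) / (r/2 - 1))"
  have c: "0 \<le> c" using r by (simp add: c_def)
  have "integral {0..1} (\<lambda>x. norm (?S x) powr r)
      \<le> integral {0..1} (\<lambda>x. \<Sum>q\<in>{1..16 * L}. \<Sum>a\<in>{0..q}.
          (10 ^ 7 / real q) powr (r/2) * peak L (r/2) (real a / real q) x)"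
    using r by (intro integral_le norm_powr_integrable integrable_sum integrable_on_mult_right
        peak_integrable continuous_on_trig_sum bump_weyl_sum_powr_le w L) auto
  also have "\<dots> = (\<Sum>q\<in>{1..16 * L}. \<Sum>a\<in>{0..q}.
      (10 ^ 7 / real q) powr (r/2) * integral {0..1} (peak L (r/2) (real a / real q)))"
    using L by (simp add: integral_sum integrable_sum integrable_on_mult_right peak_integrable)
  also have "\<dots> \<le> (\<Sum>q\<in>{1..16 * L}. \<Sum>a\<in>{0..q}.
      (10 ^ 7 / real q) powr (r/2) * (2 * real L powr (r - 2) / (r/2 - 1)))"
    using L r by (intro sum_mono mult_left_mono order_trans[OF integral_peak_le]) (auto simp: divide_le_eq_1)
  also have "\<dots> = (\<Sum>q\<in>{1..16 * L}. (real q + 1) * (c * real q powr (-(r/2))))"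
    by (simp add: c_def powr_divide powr_minus_divide mult_ac add.commute)
  also have "\<dots> \<le> (\<Sum>q\<in>{1..16 * L}. 2 * c * real q powr (1 - r/2))"
  proof (rule sum_mono)
    fix q assume q: "q \<in> {1..16 * L}"
    have "(real q + 1) * (c * real q powr (-(r/2))) \<le> (2 * real q) * (c * real q powr (-(r/2)))"
      using q c by (intro mult_right_mono) auto
    also have "\<dots> = 2 * c * (real q powr 1 * real q powr (-(r/2)))" by simp
    also have "real q powr 1 * real q powr (-(r/2)) = real q powr (1 - r/2)"
      unfolding powr_add[symmetric] by simp
    finally show "(real q + 1) * (c * real q powr (-(r/2))) \<le> 2 * c * real q powr (1 - r/2)" .
  qed
  also have "\<dots> = 2 * c * (\<Sum>q\<in>{1..16 * L}. real q powr (1 - r/2))" by (simp only: sum_distrib_left)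
  finally show ?thesis by (simp add: c_def)
qed

lemma bump_weyl_sum_power_mean_le:
  assumes r: "2 < r"
  shows "\<exists>K>0. \<forall>L b w. bump L b w \<longrightarrow> 1 \<le> L \<longrightarrow>
    power_mean r (weyl_sum (bump_window L b) w) \<le> K * weyl_growth r L"
proof -
  obtain K where K: "0 < K" and denominators: "\<And>n::nat. 1 \<le> n \<Longrightarrow>
      real n powr (r - 2) * (\<Sum>q\<in>{1..n}. real q powr (1 - r/2)) \<le> K * weyl_growth r n powr r"
    using sum_denominators_le[OF r] by blast
  define A where "A = 4 * (10 ^ 7) powr (r/2) / (r/2 - 1)"
  define C where "C = (A * K) powr (1/r) * 512"
  have A: "0 < A" and C: "0 < C" using r K by (auto simp: A_def C_def)
  have "power_mean r (weyl_sum (bump_window L b) w) \<le> C * weyl_growth r L"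
    if w: "bump L b w" and L: "1 \<le> L" for L b w
  proof -
    have "real L powr (r - 2) * (\<Sum>q\<in>{1..16 * L}. real q powr (1 - r/2))
        \<le> real (16 * L) powr (r - 2) * (\<Sum>q\<in>{1..16 * L}. real q powr (1 - r/2))"
      using r by (intro mult_right_mono powr_mono2 sum_nonneg) auto
    also have "\<dots> \<le> K * weyl_growth r (real (16 * L)) powr r" using L by (intro denominators) auto
    also have "\<dots> \<le> K * (512 * weyl_growth r L) powr r"
      using K L r weyl_growth_mult_le[of r L 16] weyl_growth_pos[of "16 * real L" r]
      by (intro mult_left_mono powr_mono2) auto
    finally have denominators_L: "real L powr (r - 2) * (\<Sum>q\<in>{1..16 * L}. real q powr (1 - r/2))
        \<le> K * (512 * weyl_growth r L) powr r" .
    have "integral {0..1} (\<lambda>x. norm (weyl_sum (bump_window L b) w x) powr r)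
        \<le> A * (real L powr (r - 2) * (\<Sum>q\<in>{1..16 * L}. real q powr (1 - r/2)))"
      unfolding A_def by (rule bump_weyl_sum_integral_le[OF w L r])
    also have "\<dots> \<le> A * (K * (512 * weyl_growth r L) powr r)"
      using A denominators_L by (intro mult_left_mono) auto
    also have "\<dots> = (C * weyl_growth r L) powr r"
      using r A K by (simp add: C_def powr_mult powr_powr)
    finally show ?thesis
      using r C L weyl_growth_pos[of L r] by (subst power_mean_le_iff) auto
  qed
  then show ?thesis using C by blast
qed

subsection \<open>Sharp cutoffs as sums of bumps at dyadic scales\<close>

definition ramp :: "nat \<Rightarrow> int \<Rightarrow> real" where
  "ramp m n = max 0 (min 1 ((of_int n + 1) / m))"

lemma ramp_bounds: "0 \<le> ramp m n" "ramp m n \<le> 1"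
  by (auto simp: ramp_def)

lemma ramp_eq_0:
  assumes "n < 0"
  shows "ramp m n = 0"
proof -
  have "of_int n + 1 \<le> (0::real)" using assms by linarith
  then have "(of_int n + 1) / real m \<le> 0" by (simp add: divide_nonpos_nonneg)
  then show ?thesis by (simp add: ramp_def)
qed

lemma ramp_eq_1:
  assumes "1 \<le> m" "int m - 1 \<le> n"
  shows "ramp m n = 1"
proof -
  have "real m \<le> of_int n + 1" using assms by linarith
  then have "1 \<le> (of_int n + 1) / real m" using assms by (simp add: le_divide_eq)
  then show ?thesis by (simp add: ramp_def)
qed

lemma ramp_linear:
  assumes "1 \<le> m" "-1 \<le> n" "n \<le> int m - 1"
  shows "ramp m n = (of_int n + 1) / m"
proof -
  have "of_int n + 1 \<le> real m" "0 \<le> of_int n + (1::real)" using assms by linarith+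
  then show ?thesis using assms by (simp add: ramp_def divide_le_eq)
qed

lemma ramp_1: "ramp 1 n = (if 0 \<le> n then 1 else 0)"
  by (auto simp: ramp_def)

lemma abs_ramp_diff_le:
  assumes "1 \<le> m"
  shows "\<bar>ramp m (n + 1) - ramp m n\<bar> \<le> 1 / m"
proof -
  consider "n < -1" | "-1 \<le> n" "n < int m - 1" | "int m - 1 \<le> n" by linarith
  then show ?thesis
    by cases (use assms in \<open>simp_all add: ramp_eq_0 ramp_linear ramp_eq_1 flip: diff_divide_distrib\<close>)
qed

lemma abs_second_diff_ramp_le:
  assumes "1 \<le> m"
  shows "\<bar>second_diff (ramp m) n\<bar> \<le> (if n = -2 then 1 / m else 0) + (if n = int m - 2 then 1 / m else 0)"
proof -
  consider "n < -2" | "n = -2" | "-2 < n" "n < int m - 2" | "n = int m - 2" "-2 < n" | "int m - 2 < n"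
    by linarith
  then show ?thesis
  proof cases
    assume "-2 < n" "n < int m - 2"
    then show ?thesis using assms by (simp add: second_diff_def ramp_linear field_simps)
  next
    assume n: "n = int m - 2" "-2 < n"
    have "ramp m (n + 2) = 1" "ramp m (n + 1) = 1" using n assms by (auto intro!: ramp_eq_1)
    moreover have "ramp m n = 1 - 1 / m"
      using n assms by (subst ramp_linear) (auto simp: field_simps)
    ultimately show ?thesis using n by (simp add: second_diff_def)
  qed (use assms in \<open>simp_all add: second_diff_def ramp_eq_0 ramp_linear ramp_eq_1\<close>)
qed

lemma sum_second_diff_ramp_le:
  assumes "1 \<le> m" "finite F"
  shows "(\<Sum>n\<in>F. \<bar>second_diff (ramp m) (n - c)\<bar>) \<le> 2 / m"
proof -
  have "(\<Sum>n\<in>F. \<bar>second_diff (ramp m) (n - c)\<bar>)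
      \<le> (\<Sum>n\<in>F. (if n = c - 2 then 1 / m else 0) + (if n = c + int m - 2 then 1 / m else 0))"
  proof (rule sum_mono)
    fix n
    show "\<bar>second_diff (ramp m) (n - c)\<bar>
        \<le> (if n = c - 2 then 1 / m else 0) + (if n = c + int m - 2 then 1 / m else 0)"
      using abs_second_diff_ramp_le[OF assms(1), of "n - c"] by (simp add: algebra_simps split: if_splits)
  qed
  also have "\<dots> \<le> 1 / m + 1 / m"
    unfolding sum.distrib using assms by (intro add_mono) auto
  finally show ?thesis by simp
qed

lemma bump_ramp_diff:
  assumes m: "1 \<le> m" "m \<le> k" and c: "a \<le> c" "c + int k \<le> a + 4 * int m"
  shows "bump m a (\<lambda>n. ramp m (n - a) - ramp k (n - c))"
  unfolding bump_def
proof (intro conjI allI impI)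
  fix n assume "n \<notin> bump_window m a"
  then consider "n < a" | "a + 4 * int m \<le> n" by fastforce
  then show "ramp m (n - a) - ramp k (n - c) = 0"
    by cases (use m c in \<open>simp_all add: ramp_eq_0 ramp_eq_1\<close>)
next
  fix n show "\<bar>ramp m (n - a) - ramp k (n - c)\<bar> \<le> 1"
    using ramp_bounds[of m "n - a"] ramp_bounds[of k "n - c"] by linarith
next
  fix n
  have "1 / real k \<le> 1 / real m" using m by (intro divide_left_mono) auto
  moreover have "\<bar>ramp m (n - a + 1) - ramp m (n - a)\<bar> \<le> 1 / m"
      "\<bar>ramp k (n - c + 1) - ramp k (n - c)\<bar> \<le> 1 / k"
    using m by (intro abs_ramp_diff_le; simp)+
  moreover have "2 / real m = 1 / m + 1 / m" by simp
  ultimately show "\<bar>ramp m (n + 1 - a) - ramp k (n + 1 - c) - (ramp m (n - a) - ramp k (n - c))\<bar> \<le> 2 / m"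
    unfolding diff_add_eq[symmetric] by linarith
next
  fix F :: "int set" assume F: "finite F"
  have "(\<Sum>n\<in>F. \<bar>second_diff (\<lambda>n. ramp m (n - a) - ramp k (n - c)) n\<bar>)
      \<le> (\<Sum>n\<in>F. \<bar>second_diff (ramp m) (n - a)\<bar> + \<bar>second_diff (ramp k) (n - c)\<bar>)"
  proof (rule sum_mono)
    fix n
    have "second_diff (\<lambda>n. ramp m (n - a) - ramp k (n - c)) n
        = second_diff (ramp m) (n - a) - second_diff (ramp k) (n - c)"
      by (simp add: second_diff_def algebra_simps)
    then show "\<bar>second_diff (\<lambda>n. ramp m (n - a) - ramp k (n - c)) n\<bar>
        \<le> \<bar>second_diff (ramp m) (n - a)\<bar> + \<bar>second_diff (ramp k) (n - c)\<bar>"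
      by (simp only: abs_triangle_ineq4)
  qed
  also have "\<dots> \<le> 2 / m + 2 / k"
    unfolding sum.distrib using m F by (intro add_mono sum_second_diff_ramp_le) auto
  also have "\<dots> \<le> 2 / m + 2 / m" using m by (intro add_left_mono divide_left_mono) auto
  finally show "(\<Sum>n\<in>F. \<bar>second_diff (\<lambda>n. ramp m (n - a) - ramp k (n - c)) n\<bar>) \<le> 4 / m" by simp
qed

definition trapezoid :: "nat \<Rightarrow> int \<Rightarrow> int \<Rightarrow> int \<Rightarrow> real" where
  "trapezoid m a b n = ramp m (n - a) - ramp m (n - b)"

lemma bump_trapezoid:
  assumes "1 \<le> m" "a \<le> b" "b + int m \<le> a + 4 * int m"
  shows "bump m a (trapezoid m a b)"
  unfolding trapezoid_def[abs_def] using assms by (intro bump_ramp_diff) auto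

definition ramp_layer :: "nat \<Rightarrow> int \<Rightarrow> real" where
  "ramp_layer k n = ramp (2 ^ k) n - ramp (2 ^ Suc k) n"

lemma bump_ramp_layer: "bump (2 ^ k) c (\<lambda>n. ramp_layer k (n - c))"
  unfolding ramp_layer_def by (intro bump_ramp_diff) auto

lemma indicator_eq_ramp_layers:
  fixes a b n :: int
  assumes "a \<le> b"
  shows "(if n \<in> {a..<b} then 1 else 0) = trapezoid (2 ^ Suc K) a b n
    + (\<Sum>k\<le>K. ramp_layer k (n - a)) - (\<Sum>k\<le>K. ramp_layer k (n - b))"
proof -
  have telescope: "ramp 1 n = ramp (2 ^ Suc K) n + (\<Sum>k\<le>K. ramp_layer k n)" for n
    unfolding ramp_layer_def by (subst sum_telescope) simp
  have "(if n \<in> {a..<b} then 1 else 0) = ramp 1 (n - a) - ramp 1 (n - b)"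
    unfolding ramp_1 using assms by auto
  then show ?thesis unfolding telescope trapezoid_def by simp
qed

lemma interval_trig_sum_eq_bump_sums:
  assumes ab: "a \<le> b" and bump: "bump (2 ^ Suc K) a (trapezoid (2 ^ Suc K) a b)"
  shows "trig_sum {a..<b} (\<lambda>_. 1) f x
    = trig_sum (bump_window (2 ^ Suc K) a) (trapezoid (2 ^ Suc K) a b) f x
      + (\<Sum>k\<le>K. trig_sum (bump_window (2 ^ k) a) (\<lambda>n. ramp_layer k (n - a)) f x)
      - (\<Sum>k\<le>K. trig_sum (bump_window (2 ^ k) b) (\<lambda>n. ramp_layer k (n - b)) f x)"
proof -
  define A where "A = {a..<b + 4 * 2 ^ Suc K}"
  have extend: "trig_sum (bump_window L c) w f = trig_sum A w f"
    if "bump L c w" "a \<le> c" "c \<le> b" "L \<le> 2 ^ Suc K" for L c w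
  proof (rule trig_sum_mono_neutral)
    have "int L \<le> int (2 ^ Suc K)" using that(4) by (simp only: of_nat_le_iff)
    then show "bump_window L c \<subseteq> A" using that by (auto simp: A_def)
  qed (use that in \<open>auto simp: A_def dest: bumpD(1)\<close>)
  have layers: "(\<Sum>k\<le>K. trig_sum A (\<lambda>n. ramp_layer k (n - c)) f x)
      = (\<Sum>k\<le>K. trig_sum (bump_window (2 ^ k) c) (\<lambda>n. ramp_layer k (n - c)) f x)" if "a \<le> c" "c \<le> b" for c
    using that by (intro sum.cong refl fun_cong[OF extend[symmetric]] bump_ramp_layer power_increasing) auto
  have "trig_sum {a..<b} (\<lambda>_. 1) f x = trig_sum {a..<b} (\<lambda>n. if n \<in> {a..<b} then 1 else 0) f x"
    unfolding trig_sum_def by (intro sum.cong) auto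
  also have "\<dots> = trig_sum A (\<lambda>n. if n \<in> {a..<b} then 1 else 0) f x"
    by (subst trig_sum_mono_neutral[of A]) (auto simp: A_def intro: less_le_trans)
  also have "\<dots> = trig_sum A (trapezoid (2 ^ Suc K) a b) f x
      + (\<Sum>k\<le>K. trig_sum A (\<lambda>n. ramp_layer k (n - a)) f x) - (\<Sum>k\<le>K. trig_sum A (\<lambda>n. ramp_layer k (n - b)) f x)"
    unfolding indicator_eq_ramp_layers[OF ab, of _ K]
    by (simp only: trig_sum_add trig_sum_diff trig_sum_sum)
  finally show ?thesis
    unfolding layers[OF order_refl ab] layers[OF ab order_refl] extend[OF bump order_refl ab order_refl] .
qed

lemma interval_trig_sum_power_mean_le:
  assumes r: "1 \<le> r" and ab: "a \<le> b"
    and bump: "bump (2 ^ Suc K) a (trapezoid (2 ^ Suc K) a b)"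
  shows "power_mean r (trig_sum {a..<b} (\<lambda>_. 1) f)
    \<le> power_mean r (trig_sum (bump_window (2 ^ Suc K) a) (trapezoid (2 ^ Suc K) a b) f)
      + (\<Sum>k\<le>K. power_mean r (trig_sum (bump_window (2 ^ k) a) (\<lambda>n. ramp_layer k (n - a)) f))
      + (\<Sum>k\<le>K. power_mean r (trig_sum (bump_window (2 ^ k) b) (\<lambda>n. ramp_layer k (n - b)) f))"
proof -
  define U where "U = trig_sum (bump_window (2 ^ Suc K) a) (trapezoid (2 ^ Suc K) a b) f"
  define V where "V = (\<lambda>c k. trig_sum (bump_window (2 ^ k) c) (\<lambda>n. ramp_layer k (n - c)) f)"
  have cont: "continuous_on {0..1} U" "continuous_on {0..1} (V c k)" for c k
    unfolding U_def V_def by (intro continuous_intros)+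
  have decomposition: "trig_sum {a..<b} (\<lambda>_. 1) f = (\<lambda>x. U x + (\<Sum>k\<le>K. V a k x) + (\<Sum>k\<le>K. - V b k x))"
    unfolding U_def V_def
    by (intro ext) (simp only: interval_trig_sum_eq_bump_sums[OF ab bump] sum_negf diff_conv_add_uminus)
  have "power_mean r (trig_sum {a..<b} (\<lambda>_. 1) f)
      \<le> power_mean r (\<lambda>x. U x + (\<Sum>k\<le>K. V a k x)) + power_mean r (\<lambda>x. \<Sum>k\<le>K. - V b k x)"
    unfolding decomposition by (intro power_mean_add_le r continuous_intros cont)
  also have "\<dots> \<le> power_mean r U + power_mean r (\<lambda>x. \<Sum>k\<le>K. V a k x) + power_mean r (\<lambda>x. \<Sum>k\<le>K. - V b k x)"
    by (intro add_right_mono power_mean_add_le r continuous_intros cont)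
  also have "\<dots> \<le> power_mean r U + (\<Sum>k\<le>K. power_mean r (V a k)) + (\<Sum>k\<le>K. power_mean r (\<lambda>x. - V b k x))"
    by (intro add_mono order_refl power_mean_sum_le r continuous_intros cont)
  finally show ?thesis unfolding U_def V_def power_mean_minus .
qed

lemma interval_weyl_sum_power_mean_le:
  assumes r: "2 < r"
  shows "\<exists>C>0. \<forall>a m. 1 \<le> m \<longrightarrow>
    power_mean r (weyl_sum {a..<a + int m} (\<lambda>_. 1)) \<le> C * weyl_growth r m"
proof -
  obtain C where C: "0 < C" and bump_le: "\<And>L b w. bump L b w \<Longrightarrow> 1 \<le> L \<Longrightarrow>
      power_mean r (weyl_sum (bump_window L b) w) \<le> C * weyl_growth r L"
    using bump_weyl_sum_power_mean_le[OF r] by blast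
  have layers_le: "(\<Sum>k\<le>K. power_mean r (weyl_sum (bump_window (2 ^ k) c) (\<lambda>n. ramp_layer k (n - c))))
      \<le> C * (4 * weyl_growth r (2 ^ K))" for c K
  proof -
    have "(\<Sum>k\<le>K. power_mean r (weyl_sum (bump_window (2 ^ k) c) (\<lambda>n. ramp_layer k (n - c))))
        \<le> (\<Sum>k\<le>K. C * weyl_growth r (2 ^ k))"
      using bump_le[OF bump_ramp_layer] by (intro sum_mono) simp
    also have "\<dots> \<le> C * (4 * weyl_growth r (2 ^ K))"
      unfolding sum_distrib_left[symmetric] using C by (intro mult_left_mono sum_weyl_growth_dyadic_le) auto
    finally show ?thesis .
  qed
  have "power_mean r (weyl_sum {a..<a + int m} (\<lambda>_. 1)) \<le> 16 * C * weyl_growth r m"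
    if m: "1 \<le> m" for a m
  proof -
    obtain K where K: "2 ^ K \<le> m" "m < 2 ^ Suc K" using ex_power_ivl1[of 2 m] m by auto
    then have "int m < 2 * 2 ^ K" by (metis of_nat_less_iff of_nat_numeral of_nat_power power_Suc)
    then have w: "bump (2 ^ Suc K) a (trapezoid (2 ^ Suc K) a (a + int m))"
      by (intro bump_trapezoid) auto
    have "power_mean r (weyl_sum {a..<a + int m} (\<lambda>_. 1))
        \<le> C * weyl_growth r (real (2 ^ Suc K)) + C * (4 * weyl_growth r (2 ^ K)) + C * (4 * weyl_growth r (2 ^ K))"
      using r by (intro order_trans[OF interval_trig_sum_power_mean_le[OF _ _ w]] add_mono bump_le[OF w] layers_le) auto
    also have "\<dots> \<le> C * (2 * 2\<^sup>2 * weyl_growth r (2 ^ K)) + C * (4 * weyl_growth r (2 ^ K))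
        + C * (4 * weyl_growth r (2 ^ K))"
      using C r weyl_growth_mult_le[of r "2 ^ K" 2] by simp
    also have "\<dots> = 16 * C * weyl_growth r (2 ^ K)" by simp
    also have "\<dots> \<le> 16 * C * weyl_growth r m"
      using C K(1) by (intro mult_left_mono weyl_growth_mono) (simp_all flip: of_nat_power)
    finally show ?thesis .
  qed
  then show ?thesis using C by (intro exI[of _ "16 * C"]) auto
qed

subsection \<open>Upper bounds for blocks of the series\<close>

lemma sum_by_parts:
  fixes c :: "nat \<Rightarrow> real" and z :: "nat \<Rightarrow> 'a::{real_algebra_1, comm_ring_1}"
  assumes "a \<le> b"
  shows "(\<Sum>n\<in>{a..<b}. of_real (c n) * z n)
    = (\<Sum>n\<in>{a..<b}. of_real (c n - c (Suc n)) * (\<Sum>i\<in>{a..<Suc n}. z i)) + of_real (c b) * (\<Sum>i\<in>{a..<b}. z i)"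
  using assms
proof (induction b rule: dec_induct)
  case (step b)
  then show ?case by (simp add: algebra_simps)
qed simp

lemma power_mean_sum_by_parts_le:
  fixes c :: "nat \<Rightarrow> real" and z :: "nat \<Rightarrow> real \<Rightarrow> complex"
  assumes r: "1 \<le> r" and ab: "a < b" and cont: "\<And>i. continuous_on {0..1} (z i)"
    and decreasing: "\<And>n. a \<le> n \<Longrightarrow> c (Suc n) \<le> c n" and nonneg: "0 \<le> c b"
    and bound: "\<And>n. a < n \<Longrightarrow> power_mean r (\<lambda>x. \<Sum>i\<in>{a..<n}. z i x) \<le> B n"
  shows "power_mean r (\<lambda>x. \<Sum>n\<in>{a..<b}. of_real (c n) * z n x)
    \<le> (\<Sum>n\<in>{a..<b}. (c n - c (Suc n)) * B (Suc n)) + c b * B b"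
proof -
  define Z where "Z = (\<lambda>n x. \<Sum>i\<in>{a..<n}. z i x)"
  have Z_cont: "continuous_on {0..1} (Z n)" for n unfolding Z_def by (intro continuous_intros cont)
  have "power_mean r (\<lambda>x. \<Sum>n\<in>{a..<b}. of_real (c n) * z n x)
      = power_mean r (\<lambda>x. (\<Sum>n\<in>{a..<b}. of_real (c n - c (Suc n)) * Z (Suc n) x) + of_real (c b) * Z b x)"
    unfolding Z_def using ab by (subst sum_by_parts) auto
  also have "\<dots> \<le> power_mean r (\<lambda>x. \<Sum>n\<in>{a..<b}. of_real (c n - c (Suc n)) * Z (Suc n) x)
      + power_mean r (\<lambda>x. of_real (c b) * Z b x)"
    by (intro power_mean_add_le r continuous_intros Z_cont)
  also have "\<dots> \<le> (\<Sum>n\<in>{a..<b}. power_mean r (\<lambda>x. of_real (c n - c (Suc n)) * Z (Suc n) x))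
      + power_mean r (\<lambda>x. of_real (c b) * Z b x)"
    by (intro add_right_mono power_mean_sum_le r continuous_intros Z_cont)
  also have "\<dots> = (\<Sum>n\<in>{a..<b}. (c n - c (Suc n)) * power_mean r (Z (Suc n))) + c b * power_mean r (Z b)"
    using r nonneg decreasing by (simp add: power_mean_mult_left del: of_real_diff)
  also have "\<dots> \<le> (\<Sum>n\<in>{a..<b}. (c n - c (Suc n)) * B (Suc n)) + c b * B b"
    unfolding Z_def using ab nonneg decreasing
    by (intro add_mono sum_mono mult_left_mono bound) auto
  finally show ?thesis .
qed

text \<open>Concavity of \<open>y \<mapsto> y powr \<theta>\<close> with \<open>y = n powr (-2s)\<close> and \<open>\<theta> = 1 - \<alpha> / (2s)\<close> makes
  the sum of \<open>n powr \<alpha>\<close> against the differences of \<open>n powr (-2s)\<close> telescope.\<close>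

lemma sum_powr_differences_le:
  fixes s \<alpha> :: real
  assumes \<alpha>: "0 < \<alpha>" "\<alpha> < 2 * s" and ab: "1 \<le> a" "a \<le> b"
  shows "(\<Sum>n\<in>{a..<b}. (real n powr (-2 * s) - real (Suc n) powr (-2 * s)) * real n powr \<alpha>)
      + real b powr (-2 * s) * real b powr \<alpha>
    \<le> 1 / (1 - \<alpha> / (2 * s)) * real a powr (\<alpha> - 2 * s)"
proof -
  let ?v = "\<lambda>n. (real n powr (-2 * s) - real (Suc n) powr (-2 * s)) * real n powr \<alpha>"
  let ?w = "\<lambda>n::nat. real n powr (\<alpha> - 2 * s)"
  define \<theta> where "\<theta> = 1 - \<alpha> / (2 * s)"
  have \<theta>: "0 < \<theta>" "\<theta> \<le> 1" using \<alpha> by (auto simp: \<theta>_def)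
  have exponents: "- (2 * s) * \<theta> = \<alpha> - 2 * s" "- (2 * s) * (\<theta> - 1) = \<alpha>"
    using \<alpha> by (auto simp: \<theta>_def field_simps)
  have concavity: "?v n \<le> 1 / \<theta> * (?w n - ?w (Suc n))" if "1 \<le> n" for n
  proof -
    have "\<theta> * (real n powr (-2 * s)) powr (\<theta> - 1) * (real n powr (-2 * s) - real (Suc n) powr (-2 * s))
        \<le> (real n powr (-2 * s)) powr \<theta> - (real (Suc n) powr (-2 * s)) powr \<theta>"
      using that \<alpha> \<theta> by (intro powr_diff_ge powr_mono2') auto
    then have "\<theta> * ?v n \<le> ?w n - ?w (Suc n)"
      using exponents by (simp add: powr_powr mult_ac)
    then show ?thesis using \<theta> by (simp add: field_simps)
  qed
  have "(\<Sum>n\<in>{a..<b}. ?v n) \<le> (\<Sum>n\<in>{a..<b}. 1 / \<theta> * (?w n - ?w (Suc n)))"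
    using ab by (intro sum_mono concavity) auto
  also have "\<dots> = 1 / \<theta> * (?w a - ?w b)"
    unfolding sum_distrib_left[symmetric] using sum_Suc_diff'[OF ab(2), of "\<lambda>n. - ?w n"] by simp
  finally have differences: "(\<Sum>n\<in>{a..<b}. ?v n) \<le> 1 / \<theta> * (?w a - ?w b)" .
  have "real b powr (-2 * s) * real b powr \<alpha> = 1 * ?w b" by (simp flip: powr_add)
  also have "\<dots> \<le> 1 / \<theta> * ?w b" using \<theta> by (intro mult_right_mono) auto
  finally show ?thesis using differences unfolding \<theta>_def[symmetric] by (simp add: right_diff_distrib)
qed

lemma power_mean_powr_weighted_sum_le:
  fixes z :: "nat \<Rightarrow> real \<Rightarrow> complex"
  assumes r: "1 \<le> r" and \<alpha>: "0 < \<alpha>" "\<alpha> < 2 * s" and a: "1 \<le> a" and cont: "\<And>i. continuous_on {0..1} (z i)"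
    and prefix: "\<And>n. a \<le> n \<Longrightarrow> power_mean r (\<lambda>x. \<Sum>i\<in>{a..n}. z i x) \<le> G * real n powr \<alpha>"
  shows "power_mean r (\<lambda>x. \<Sum>n\<in>{a..<b}. of_real (real n powr (-2 * s)) * z n x)
    \<le> G / (1 - \<alpha> / (2 * s)) * real a powr (\<alpha> - 2 * s)"
proof -
  have "0 \<le> G * real a powr \<alpha>" using prefix[of a] by (intro order_trans[OF power_mean_nonneg]) auto
  then have G: "0 \<le> G" using a by (simp add: zero_le_mult_iff)
  show ?thesis
  proof (cases "a < b")
    case True
    define c where "c = (\<lambda>n::nat. real n powr (-2 * s))"
    define B where "B = (\<lambda>n. G * real (n - 1) powr \<alpha>)"
    have decreasing: "c (Suc n) \<le> c n" if "a \<le> n" for n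
      unfolding c_def using that a \<alpha> by (intro powr_mono2') auto
    have "power_mean r (\<lambda>x. \<Sum>i\<in>{a..<n}. z i x) \<le> B n" if "a < n" for n
      using prefix[of "n - 1"] that by (cases n) (auto simp: B_def atLeastLessThanSuc_atLeastAtMost)
    then have "power_mean r (\<lambda>x. \<Sum>n\<in>{a..<b}. of_real (c n) * z n x)
        \<le> (\<Sum>n\<in>{a..<b}. (c n - c (Suc n)) * B (Suc n)) + c b * B b"
      using r True cont decreasing by (intro power_mean_sum_by_parts_le) (auto simp: c_def)
    also have "\<dots> \<le> (\<Sum>n\<in>{a..<b}. (c n - c (Suc n)) * (G * real n powr \<alpha>)) + c b * (G * real b powr \<alpha>)"
      unfolding B_def c_def using G \<alpha> by (intro add_mono mult_left_mono powr_mono2) auto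
    also have "\<dots> = G * ((\<Sum>n\<in>{a..<b}. (c n - c (Suc n)) * real n powr \<alpha>) + c b * real b powr \<alpha>)"
      by (simp add: distrib_left sum_distrib_left mult_ac)
    also have "\<dots> \<le> G * (1 / (1 - \<alpha> / (2 * s)) * real a powr (\<alpha> - 2 * s))"
      unfolding c_def using G \<alpha> a True by (intro mult_left_mono sum_powr_differences_le) auto
    finally show ?thesis by (simp add: c_def)
  next
    case False
    then show ?thesis using r G \<alpha> by simp
  qed
qed

definition series_block :: "real \<Rightarrow> nat \<Rightarrow> nat \<Rightarrow> real \<Rightarrow> complex" where
  "series_block s a b = trig_sum {a..<b} (\<lambda>n. real n powr (-2 * s)) (\<lambda>n. int (n\<^sup>2))"

lemma continuous_on_series_block [continuous_intros]: "continuous_on S (series_block s a b)"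
  unfolding series_block_def by (rule continuous_on_trig_sum)

lemma series_block_power_mean_growth_le:
  assumes r: "2 < r" and s: "weyl_exponent r < 2 * s"
  shows "\<exists>K>0. \<forall>a b. 1 \<le> a \<longrightarrow>
    power_mean r (series_block s a b) \<le> K * (weyl_growth r a * real a powr (-2 * s))"
proof -
  obtain C where C: "0 < C" and interval_le: "\<And>a m. 1 \<le> m \<Longrightarrow>
      power_mean r (weyl_sum {a..<a + int m} (\<lambda>_. 1)) \<le> C * weyl_growth r m"
    using interval_weyl_sum_power_mean_le[OF r] by blast
  define \<epsilon> where "\<epsilon> = (2 * s - weyl_exponent r) / 2"
  define \<alpha> where "\<alpha> = weyl_exponent r + \<epsilon>"
  have \<epsilon>: "0 < \<epsilon>" and \<alpha>: "0 < \<alpha>" "\<alpha> < 2 * s"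
    using s weyl_exponent_ge[of r] by (auto simp: \<epsilon>_def \<alpha>_def field_simps)
  define K where "K = C * (1 + 1 / \<epsilon>) / (1 - \<alpha> / (2 * s))"
  have "0 < 1 - \<alpha> / (2 * s)" using \<alpha> by simp
  then have K: "0 < K" using C \<epsilon> by (simp add: K_def add_pos_pos)
  have "power_mean r (series_block s a b) \<le> K * (weyl_growth r a * real a powr (-2 * s))"
    if a: "1 \<le> a" for a b
  proof -
    define G where "G = C * ((1 + 1/\<epsilon>) * weyl_growth r a * real a powr (-\<alpha>))"
    have prefix: "power_mean r (\<lambda>x. \<Sum>i\<in>{a..n}. unit_char (of_int (int (i\<^sup>2)) * x)) \<le> G * real n powr \<alpha>"
      if n: "a \<le> n" for n
    proof -
      have "(\<Sum>i\<in>{a..n}. unit_char (of_int (int (i\<^sup>2)) * x))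
          = weyl_sum {int a..<int a + int (Suc n - a)} (\<lambda>_. 1) x" for x
        unfolding trig_sum_def using n by (intro sum.reindex_bij_witness[of _ nat int]) auto
      then have "power_mean r (\<lambda>x. \<Sum>i\<in>{a..n}. unit_char (of_int (int (i\<^sup>2)) * x))
          \<le> C * weyl_growth r (real (Suc n - a))"
        using interval_le[of "Suc n - a" "int a"] n by simp
      also have "\<dots> \<le> G * real n powr \<alpha>"
        unfolding G_def mult.assoc[of C] \<alpha>_def using C \<epsilon> a n
        by (intro mult_left_mono weyl_growth_le_powr_scaled) auto
      finally show ?thesis .
    qed
    have "power_mean r (series_block s a b) \<le> G / (1 - \<alpha> / (2 * s)) * real a powr (\<alpha> - 2 * s)"
      unfolding series_block_def trig_sum_def
      using r \<alpha> a prefix by (intro power_mean_powr_weighted_sum_le continuous_intros) auto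
    also have "\<dots> = K * (weyl_growth r a * (real a powr (-\<alpha>) * real a powr (\<alpha> - 2 * s)))"
      by (simp add: G_def K_def)
    finally show ?thesis by (simp flip: powr_add)
  qed
  then show ?thesis using K by blast
qed

subsection \<open>Lower bounds for blocks of the series\<close>

lemma powr_dyadic_block_ge:
  assumes "0 \<le> s" "1 \<le> a" "n \<in> {a..<2 * a}"
  shows "real (2 * a) powr (-2 * s) \<le> real n powr (-2 * s)"
  using assms by (intro powr_mono2') auto

lemma series_block_power_mean_2_ge:
  assumes s: "0 \<le> s" and a: "1 \<le> a" "2 * a \<le> b"
  shows "2 powr (-2 * s) * real a powr (1/2 - 2 * s) \<le> power_mean 2 (series_block s a b)"
proof -
  have "real a * (real (2 * a) powr (-2 * s))\<^sup>2 = (\<Sum>n\<in>{a..<2 * a}. (real (2 * a) powr (-2 * s))\<^sup>2)"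
    by simp
  also have "\<dots> \<le> (\<Sum>n\<in>{a..<2 * a}. (real n powr (-2 * s))\<^sup>2)"
    using s a by (intro sum_mono power_mono powr_dyadic_block_ge) auto
  also have "\<dots> \<le> (\<Sum>n\<in>{a..<b}. (real n powr (-2 * s))\<^sup>2)"
    using a by (intro sum_mono2) auto
  finally have "sqrt (real a * (real (2 * a) powr (-2 * s))\<^sup>2) \<le> L2_set (\<lambda>n. real n powr (-2 * s)) {a..<b}"
    unfolding L2_set_def by (rule real_sqrt_le_mono)
  also have "\<dots> = power_mean 2 (series_block s a b)"
    unfolding series_block_def by (subst power_mean_2_trig_sum) (auto simp: inj_on_def power2_eq_iff_nonneg)
  also have "sqrt (real a * (real (2 * a) powr (-2 * s))\<^sup>2)
      = 2 powr (-2 * s) * (real a powr (1/2) * real a powr (-2 * s))"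
    by (simp add: real_sqrt_mult powr_half_sqrt powr_mult)
  finally show ?thesis by (simp flip: powr_add)
qed

lemma series_block_power_mean_ge:
  assumes s: "0 \<le> s" and a: "1 \<le> a" "2 * a \<le> b" and p: "1 < p"
  shows "4 * 2 powr (-2 * s) * 8 powr (- (1 + 1/p)) * real a powr (1 - 2/p - 2 * s)
      \<le> power_mean p (series_block s a b)"
proof -
  define N where "N = 8 * a\<^sup>2"
  have square_le: "n\<^sup>2 \<le> 4 * a\<^sup>2" if "n < 2 * a" for n
    using power_mono[of n "2 * a" 2] that by (simp add: power_mult_distrib)
  have "real a * (real (2 * a) powr (-2 * s) * real (4 * a\<^sup>2))
      = (\<Sum>n\<in>{a..<2 * a}. real (2 * a) powr (-2 * s) * real (4 * a\<^sup>2))"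
    by simp
  also have "\<dots> \<le> (\<Sum>n\<in>{a..<2 * a}. real n powr (-2 * s) * real (N - n\<^sup>2))"
  proof (intro sum_mono mult_mono powr_dyadic_block_ge)
    fix n assume "n \<in> {a..<2 * a}"
    then show "real (4 * a\<^sup>2) \<le> real (N - n\<^sup>2)" unfolding N_def of_nat_le_iff using square_le[of n] by simp
  qed (use s a in auto)
  also have "\<dots> \<le> (\<Sum>n\<in>{a..<b}. real n powr (-2 * s) * real (N - n\<^sup>2))"
    using a by (intro sum_mono2) auto
  also have "\<dots> \<le> real N powr (1 + 1/p) * power_mean p (series_block s a b)"
    unfolding series_block_def
    using trig_sum_fejer_test[of "{a..<b}" "\<lambda>n. int (n\<^sup>2)" N p "\<lambda>n. real n powr (-2 * s)"] a p
    by (simp add: N_def nat_power_eq)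
  finally have test: "real a * (real (2 * a) powr (-2 * s) * real (4 * a\<^sup>2))
      \<le> real N powr (1 + 1/p) * power_mean p (series_block s a b)" .
  have N_powr: "real N powr (1 + 1/p) = 8 powr (1 + 1/p) * real a powr (2 + 2/p)"
    using a by (simp add: N_def powr_mult powr_powr algebra_simps flip: powr_numeral)
  have "real a powr (1 - 2/p - 2 * s) * real a powr (2 + 2/p) = real a powr 3 * real a powr (-2 * s)"
    unfolding powr_add[symmetric] by (simp add: algebra_simps)
  then have "(4 * 2 powr (-2 * s) * 8 powr (- (1 + 1/p)) * real a powr (1 - 2/p - 2 * s))
      * real N powr (1 + 1/p)
      = 4 * 2 powr (-2 * s) * (8 powr (- (1 + 1/p)) * 8 powr (1 + 1/p)) * (real a powr 3 * real a powr (-2 * s))"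
    unfolding N_powr by (simp only: mult_ac)
  also have "\<dots> = real a * (real (2 * a) powr (-2 * s) * real (4 * a\<^sup>2))"
    using a by (simp add: powr_mult power2_eq_square power3_eq_cube flip: powr_add)
  finally have "(4 * 2 powr (-2 * s) * 8 powr (- (1 + 1/p)) * real a powr (1 - 2/p - 2 * s))
      * real N powr (1 + 1/p)
      \<le> power_mean p (series_block s a b) * real N powr (1 + 1/p)"
    using test by (simp only: mult.commute)
  then show ?thesis using a by (simp add: N_def)
qed

lemma norm_series_block_0_ge:
  assumes s: "0 \<le> s" and a: "1 \<le> a" "2 * a \<le> b"
  shows "2 powr (-2 * s) * real a powr (1 - 2 * s) \<le> norm (series_block s a b 0)"
proof -
  have "2 powr (-2 * s) * real a powr (1 - 2 * s) = (\<Sum>n\<in>{a..<2 * a}. real (2 * a) powr (-2 * s))"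
    using a powr_add[of "real a" 1 "-2 * s"] by (simp add: powr_mult)
  also have "\<dots> \<le> (\<Sum>n\<in>{a..<2 * a}. real n powr (-2 * s))"
    using s a by (intro sum_mono powr_dyadic_block_ge)
  also have "\<dots> \<le> (\<Sum>n\<in>{a..<b}. real n powr (-2 * s))"
    using a by (intro sum_mono2) auto
  also have "\<dots> = norm (of_real (\<Sum>n\<in>{a..<b}. real n powr (-2 * s)) :: complex)"
    by (simp only: norm_of_real) (simp add: sum_nonneg)
  also have "of_real (\<Sum>n\<in>{a..<b}. real n powr (-2 * s)) = series_block s a b 0"
    by (simp add: series_block_def trig_sum_def)
  finally show ?thesis .
qed

lemma sum_inverse_squares_multiples_le:
  assumes "1 \<le> d"
  shows "(\<Sum>n\<in>{n\<in>{1..K}. d dvd n}. 1 / (real n)\<^sup>2) \<le> 2 / (real d)\<^sup>2"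
proof -
  have "{n\<in>{1..K}. d dvd n} \<subseteq> (\<lambda>m. d * m) ` {1..K}"
  proof
    fix n assume "n \<in> {n\<in>{1..K}. d dvd n}"
    then obtain m where m: "n = d * m" "1 \<le> d * m" "d * m \<le> K" by auto
    have "m \<le> d * m" using assms by simp
    then have "m \<le> K" using m(3) by linarith
    moreover have "1 \<le> m" using m(2) by (cases m) auto
    ultimately show "n \<in> (\<lambda>m. d * m) ` {1..K}" using m(1) by auto
  qed
  then have "(\<Sum>n\<in>{n\<in>{1..K}. d dvd n}. 1 / (real n)\<^sup>2) \<le> (\<Sum>n\<in>(\<lambda>m. d * m) ` {1..K}. 1 / (real n)\<^sup>2)"
    by (intro sum_mono2) auto
  also have "\<dots> = 1 / (real d)\<^sup>2 * (\<Sum>m\<in>{1..K}. 1 / (real m)\<^sup>2)"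
    using assms by (subst sum.reindex) (auto simp: inj_on_def sum_distrib_left power_mult_distrib)
  also have "\<dots> \<le> 1 / (real d)\<^sup>2 * 2" by (intro mult_left_mono sum_inverse_squares_le) auto
  finally show ?thesis by simp
qed

lemma sum_totient_ge: "ln (real K + 1) / 2 \<le> (\<Sum>d\<in>{1..K}. real (totient d) / (real d)\<^sup>2)"
proof -
  have "ln (real K + 1) \<le> harm K" by (rule ln_le_harm)
  also have "\<dots> = (\<Sum>n\<in>{1..K}. \<Sum>d\<in>{d\<in>{1..K}. d dvd n}. real (totient d) * (1 / (real n)\<^sup>2))"
    unfolding harm_def
  proof (intro sum.cong refl)
    fix n assume n: "n \<in> {1..K}"
    have "{d\<in>{1..K}. d dvd n} = {d. d dvd n}" using n by (auto dest: dvd_imp_le intro: dvd_pos_nat Suc_leI)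
    then have "(\<Sum>d\<in>{d\<in>{1..K}. d dvd n}. real (totient d)) = real n"
      by (simp flip: of_nat_sum add: totient_divisor_sum)
    then show "inverse (real n) = (\<Sum>d\<in>{d\<in>{1..K}. d dvd n}. real (totient d) * (1 / (real n)\<^sup>2))"
      using n by (simp add: power2_eq_square divide_inverse flip: sum_distrib_right)
  qed
  also have "\<dots> = (\<Sum>d\<in>{1..K}. real (totient d) * (\<Sum>n\<in>{n\<in>{1..K}. d dvd n}. 1 / (real n)\<^sup>2))"
    unfolding sum_distrib_left by (rule sum.swap_restrict) auto
  also have "\<dots> \<le> (\<Sum>d\<in>{1..K}. real (totient d) * (2 / (real d)\<^sup>2))"
    by (intro sum_mono mult_left_mono sum_inverse_squares_multiples_le) auto
  also have "\<dots> = 2 * (\<Sum>d\<in>{1..K}. real (totient d) / (real d)\<^sup>2)"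
    by (simp add: sum_distrib_left mult_ac)
  finally show ?thesis by simp
qed

text \<open>Solutions of \<open>n\<^sub>1\<^sup>2 - n\<^sub>3\<^sup>2 = n\<^sub>4\<^sup>2 - n\<^sub>2\<^sup>2\<close>: both sides equal \<open>4 u z A B\<close> for
  \<open>n\<^sub>1 = uA + zB\<close>, \<open>n\<^sub>3 = zB - uA\<close>, \<open>n\<^sub>4 = uB + zA\<close>, \<open>n\<^sub>2 = zA - uB\<close>. Choosing \<open>A = w\<close> and \<open>B = w + v\<close>
  with \<open>v\<close> coprime to \<open>w\<close> makes the parametrisation injective and produces the sum of
  \<open>totient w / w\<^sup>2\<close>, which carries the logarithm.\<close>

definition quadruple_params :: "nat \<Rightarrow> (nat \<times> nat \<times> nat \<times> nat) set" where
  "quadruple_params a = (SIGMA w:{1..a div 2}.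
     totatives w \<times> {1..(a div w) div 2} \<times> {2 * (a div w) + 2..4 * (a div w)})"

definition square_quadruple :: "nat \<times> nat \<times> nat \<times> nat \<Rightarrow> (nat \<times> nat) \<times> (nat \<times> nat)" where
  "square_quadruple = (\<lambda>(w, v, u, z).
     ((z * (w + v) + u * w, z * (w + v) - u * w), (z * w + u * (w + v), z * w - u * (w + v))))"

lemma quadruple_params_bounds:
  assumes "(w, v, u, z) \<in> quadruple_params a"
  shows "1 \<le> w" "1 \<le> u" "coprime w (w + v)" "u * (w + v) \<le> a" "u * w \<le> a"
    "2 * a \<le> z * w" "2 * a \<le> z * (w + v)" "z * w \<le> 4 * a" "z * (w + v) \<le> 8 * a"
proof -
  define t where "t = a div w"
  have w: "1 \<le> w" and v: "v \<in> totatives w" and u: "1 \<le> u" "u \<le> t div 2" and z: "2 * t + 2 \<le> z" "z \<le> 4 * t"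
    using assms by (auto simp: quadruple_params_def t_def)
  show "1 \<le> w" "1 \<le> u" by (fact w u(1))+
  have v_le: "v \<le> w" and "coprime v w" using v by (auto simp: totatives_def)
  then show "coprime w (w + v)" unfolding coprime_iff_gcd_eq_1 by (metis gcd.commute gcd_add2)
  have t_upper: "t * w \<le> a" by (simp add: t_def)
  have "a mod w < w" using w by simp
  moreover have "a = t * w + a mod w" by (simp add: t_def)
  ultimately have t_lower: "a \<le> (t + 1) * w" by simp
  have "u * (w + v) \<le> u * (2 * w)" using v_le by (intro mult_left_mono) auto
  also have "\<dots> = (2 * u) * w" by simp
  also have "\<dots> \<le> t * w" using u by (intro mult_right_mono) auto
  finally show "u * (w + v) \<le> a" using t_upper by linarith
  then show "u * w \<le> a" by (simp add: distrib_left)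
  have "2 * a \<le> (2 * t + 2) * w" using t_lower by (simp add: algebra_simps)
  also have "\<dots> \<le> z * w" using z by (intro mult_right_mono) auto
  finally show "2 * a \<le> z * w" .
  then show "2 * a \<le> z * (w + v)" by (simp add: distrib_left)
  have "z * w \<le> (4 * t) * w" using z by (intro mult_right_mono) auto
  also have "\<dots> \<le> 4 * a" using t_upper by simp
  finally show zw: "z * w \<le> 4 * a" .
  have "z * v \<le> z * w" using v_le by (intro mult_left_mono) auto
  then show "z * (w + v) \<le> 8 * a" using zw unfolding distrib_left by linarith
qed

lemma square_quadruple_range:
  assumes "p \<in> quadruple_params a" "square_quadruple p = ((i, j), (i', j'))"
  shows "{i, j, i', j'} \<subseteq> {a..9 * a}" "int (i\<^sup>2) - int (j\<^sup>2) = int (i'\<^sup>2) - int (j'\<^sup>2)"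
proof -
  obtain w v u z where p: "p = (w, v, u, z)" by (cases p)
  note bounds = quadruple_params_bounds[OF assms(1)[unfolded p]]
  have square_diff: "int ((x + y)\<^sup>2) - int ((x - y)\<^sup>2) = 4 * int (x * y)" if "y \<le> x" for x y :: nat
    unfolding of_nat_power of_nat_diff[OF that] by (simp add: power2_eq_square algebra_simps)
  have ij: "i = z * (w + v) + u * w" "j = z * (w + v) - u * w"
      "i' = z * w + u * (w + v)" "j' = z * w - u * (w + v)"
    using assms(2) by (simp_all add: p square_quadruple_def)
  have "int (i\<^sup>2) - int (j\<^sup>2) = 4 * int (z * (w + v) * (u * w))"
    unfolding ij using bounds by (intro square_diff) linarith
  moreover have "int (i'\<^sup>2) - int (j'\<^sup>2) = 4 * int (z * w * (u * (w + v)))"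
    unfolding ij using bounds by (intro square_diff) linarith
  ultimately show "int (i\<^sup>2) - int (j\<^sup>2) = int (i'\<^sup>2) - int (j'\<^sup>2)" by (simp only: mult_ac)
  show "{i, j, i', j'} \<subseteq> {a..9 * a}" unfolding ij using bounds by auto
qed

lemma inj_on_square_quadruple: "inj_on square_quadruple (quadruple_params a)"
proof (rule inj_onI)
  fix p p' assume p: "p \<in> quadruple_params a" and p': "p' \<in> quadruple_params a"
    and image_eq: "square_quadruple p = square_quadruple p'"
  obtain w v u z where coords: "p = (w, v, u, z)" by (cases p)
  obtain w' v' u' z' where coords': "p' = (w', v', u', z')" by (cases p')
  note bounds = quadruple_params_bounds[OF p[unfolded coords]]
    and bounds' = quadruple_params_bounds[OF p'[unfolded coords']]
  have sum_diff_cancel: "X = X' \<and> Y = Y'" if "X + Y = X' + Y'" "X - Y = X' - Y'" "Y \<le> X" "Y' \<le> X'"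
    for X Y X' Y' :: nat using that by linarith
  have "z * (w + v) = z' * (w' + v') \<and> u * w = u' * w'"
    using image_eq bounds bounds'
    by (intro sum_diff_cancel) (auto simp: coords coords' square_quadruple_def)
  moreover have "z * w = z' * w' \<and> u * (w + v) = u' * (w' + v')"
    using image_eq bounds bounds'
    by (intro sum_diff_cancel) (auto simp: coords coords' square_quadruple_def)
  ultimately have products: "u * w = u' * w'" "u * (w + v) = u' * (w' + v')" "z * w = z' * w'" by auto
  have "u * gcd w (w + v) = u' * gcd w' (w' + v')" using products by (simp only: gcd_mult_distrib_nat)
  then have u: "u = u'" using bounds(3) bounds'(3) unfolding coprime_iff_gcd_eq_1 by simp
  have w: "w = w'" using products(1) bounds(2) unfolding u by simp
  have "w + v = w' + v'" using products(2) bounds(2) unfolding u by simp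
  moreover have "z = z'" using products(3) bounds(1) unfolding w by simp
  ultimately show "p = p'" using u w by (simp add: coords coords')
qed

lemma quotient_square_le:
  fixes a w :: nat
  assumes w: "1 \<le> w" "2 * w \<le> a"
  shows "(real a / real w)\<^sup>2 / 12 \<le> real (a div w div 2) * real (2 * (a div w) - 1)"
proof -
  define t where "t = a div w"
  have t: "2 \<le> t" unfolding t_def using w by (simp add: less_eq_div_iff_mult_less_eq)
  have "a mod w < w" using w by simp
  moreover have "a = t * w + a mod w" by (simp add: t_def)
  ultimately have "a \<le> (t + 1) * w" by simp
  also have "\<dots> \<le> (2 * t) * w" using t by (intro mult_right_mono) auto
  finally have "real a \<le> real (2 * t * w)" by (simp only: of_nat_le_iff)
  then have "real a / real w \<le> 2 * real t" using w by (simp add: divide_le_eq)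
  then have "(real a / real w)\<^sup>2 / 12 \<le> (2 * real t)\<^sup>2 / 12" by (intro divide_right_mono power_mono) auto
  also have "\<dots> = real t / 3 * real t" by (simp add: power2_eq_square)
  also have "\<dots> \<le> real (t div 2) * real (2 * t - 1)"
  proof (intro mult_mono)
    have "t \<le> 3 * (t div 2)" using t by linarith
    then show "real t / 3 \<le> real (t div 2)" by linarith
    show "real t \<le> real (2 * t - 1)" using t by simp
  qed auto
  finally show ?thesis unfolding t_def .
qed

lemma card_quadruple_params_ge:
  assumes a: "4 \<le> a"
  shows "(real a)\<^sup>2 / 48 * ln a \<le> card (quadruple_params a)"
proof -
  let ?T = "\<Sum>w\<in>{1..a div 2}. real (totient w) / (real w)\<^sup>2"
  have "sqrt (real a) * 2 \<le> sqrt (real a) * sqrt (real a)"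
    using a real_sqrt_le_mono[of 4 "real a"] by (intro mult_left_mono) auto
  then have "sqrt (real a) \<le> real (a div 2) + 1" by simp
  then have "ln (sqrt (real a)) \<le> ln (real (a div 2) + 1)" using a by (intro ln_mono) auto
  then have "ln (real a) / 4 \<le> ?T"
    using sum_totient_ge[of "a div 2"] a by (simp add: ln_sqrt)
  then have "(real a)\<^sup>2 / 12 * (ln (real a) / 4) \<le> (real a)\<^sup>2 / 12 * ?T" by (intro mult_left_mono) auto
  also have "\<dots> = (\<Sum>w\<in>{1..a div 2}. real (totient w) * ((real a / real w)\<^sup>2 / 12))"
    by (simp add: sum_distrib_left power_divide mult_ac)
  also have "\<dots> \<le> (\<Sum>w\<in>{1..a div 2}. real (totient w) * (real (a div w div 2) * real (2 * (a div w) - 1)))"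
    by (intro sum_mono mult_left_mono quotient_square_le) auto
  also have "\<dots> = card (quadruple_params a)"
    unfolding quadruple_params_def
    by (subst card_SigmaI) (auto simp: card_cartesian_product totient_def intro!: sum.cong)
  finally show ?thesis by simp
qed

lemma series_block_power_mean_4_ge_card:
  assumes s: "0 \<le> s" and a: "1 \<le> a" "10 * a \<le> b"
  shows "((real (10 * a) powr (-2 * s)) ^ 4 * card (quadruple_params a)) powr (1/4)
      \<le> power_mean 4 (series_block s a b)"
proof -
  define Q where "Q = square_quadruple ` quadruple_params a"
  define m where "m = real (10 * a) powr (-2 * s)"
  have range: "{i, j, i', j'} \<subseteq> {a..9 * a}" "int (i\<^sup>2) - int (j\<^sup>2) = int (i'\<^sup>2) - int (j'\<^sup>2)"
    if "((i, j), (i', j')) \<in> Q" for i j i' j'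
    using that square_quadruple_range[of _ a i j i' j'] unfolding Q_def by auto
  have m_le: "m \<le> real n powr (-2 * s)" if "n \<in> {a..9 * a}" for n
    unfolding m_def using that s a by (intro powr_mono2') auto
  have "(m ^ 4 * card Q) powr (1/4) \<le> power_mean 4 (series_block s a b)"
    unfolding series_block_def
  proof (rule power_mean_4_trig_sum_ge)
    show "Q \<subseteq> ({a..<b} \<times> {a..<b}) \<times> ({a..<b} \<times> {a..<b})"
    proof
      fix q assume "q \<in> Q"
      moreover obtain i j i' j' where "q = ((i, j), (i', j'))" by (metis surj_pair)
      ultimately show "q \<in> ({a..<b} \<times> {a..<b}) \<times> ({a..<b} \<times> {a..<b})"
        using range(1)[of i j i' j'] a by auto
    qed
    fix i j i' j' assume q: "((i, j), (i', j')) \<in> Q"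
    show "int (i\<^sup>2) - int (j\<^sup>2) = int (i'\<^sup>2) - int (j'\<^sup>2)" by (rule range(2)[OF q])
    have "m ^ 4 = m * m * (m * m)" by (simp add: eval_nat_numeral)
    also have "\<dots> \<le> real i powr (-2 * s) * real j powr (-2 * s)
        * (real i' powr (-2 * s) * real j' powr (-2 * s))"
      using range(1)[OF q] by (intro mult_mono m_le) (auto simp: m_def)
    finally show "m ^ 4 \<le> real i powr (-2 * s) * real j powr (-2 * s)
        * (real i' powr (-2 * s) * real j' powr (-2 * s))" .
  qed (auto simp: m_def)
  then show ?thesis unfolding Q_def m_def card_image[OF inj_on_square_quadruple] .
qed

lemma series_block_power_mean_4_ge:
  assumes s: "0 \<le> s" and a: "4 \<le> a" "10 * a \<le> b"
  shows "10 powr (-2 * s) * (1/48) powr (1/4) * (real a powr (1/2 - 2 * s) * ln a powr (1/4))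
    \<le> power_mean 4 (series_block s a b)"
proof -
  define m where "m = real (10 * a) powr (-2 * s)"
  have m: "0 < m" using a by (simp add: m_def)
  have "(m powr 4 * (real a powr 2 * (1/48) * ln a)) powr (1/4)
      \<le> (m ^ 4 * card (quadruple_params a)) powr (1/4)"
    using card_quadruple_params_ge[OF a(1)] a m by (intro powr_mono2) auto
  also have "\<dots> \<le> power_mean 4 (series_block s a b)"
    unfolding m_def using s a by (intro series_block_power_mean_4_ge_card) auto
  also have "(m powr 4 * (real a powr 2 * (1/48) * ln a)) powr (1/4)
      = m * (real a powr (1/2) * (1/48) powr (1/4) * ln a powr (1/4))"
    unfolding powr_mult powr_powr using m by simp
  also have "\<dots> = 10 powr (-2 * s) * (1/48) powr (1/4)
      * ((real a powr (1/2) * real a powr (-2 * s)) * ln a powr (1/4))"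
    by (simp add: m_def powr_mult)
  finally show ?thesis by (simp flip: powr_add)
qed

subsection \<open>Two-sided bounds for the power means of blocks\<close>

lemma series_block_power_mean_le:
  assumes P: "0 < P" and s: "weyl_exponent P < 2 * s"
  shows "\<exists>K>0. \<forall>a b. 1 \<le> a \<longrightarrow>
    power_mean P (series_block s a b) \<le> K * (weyl_growth P a * real a powr (-2 * s))"
proof (cases "2 < P")
  case False
  have "weyl_exponent 3 < 2 * s" using s False P by (simp add: weyl_exponent_le_4)
  then obtain K where K: "0 < K" and upper: "\<And>a b. 1 \<le> a \<Longrightarrow>
      power_mean 3 (series_block s a b) \<le> K * (weyl_growth 3 a * real a powr (-2 * s))"
    using series_block_power_mean_growth_le[of 3 s] by auto
  have "power_mean P (series_block s a b) \<le> K * (weyl_growth P a * real a powr (-2 * s))" if "1 \<le> a" for a b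
  proof -
    have "power_mean P (series_block s a b) \<le> power_mean 3 (series_block s a b)"
      using P False by (intro power_mean_mono_exponent continuous_intros) auto
    then show ?thesis using upper[OF that, of b] P False by (simp add: weyl_growth_less_4)
  qed
  then show ?thesis using K by blast
qed (rule series_block_power_mean_growth_le[OF _ s])

lemma interpolation_lower_bound:
  fixes e K M \<theta> \<rho> :: real
  assumes \<theta>: "0 < \<theta>" and "0 \<le> e" and K: "0 < K" and \<rho>: "0 < \<rho>" and "0 \<le> M"
    and upper: "e * \<rho> \<le> M powr \<theta> * (K * \<rho>) powr (1 - \<theta>)"
  shows "(e / K powr (1 - \<theta>)) powr (1/\<theta>) * \<rho> \<le> M"
proof -
  have "((e / K powr (1 - \<theta>)) powr (1/\<theta>) * \<rho>) powr \<theta> = e / K powr (1 - \<theta>) * \<rho> powr \<theta>"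
    using assms by (simp add: powr_mult powr_powr)
  also have "\<dots> = e * \<rho> / (K * \<rho>) powr (1 - \<theta>)"
    using K \<rho> by (simp add: powr_mult field_simps flip: powr_add)
  also have "\<dots> \<le> M powr \<theta>" using upper K \<rho> by (simp add: divide_le_eq)
  finally show ?thesis
    using \<theta> \<open>0 \<le> M\<close> powr_less_mono2[of \<theta> M "(e / K powr (1 - \<theta>)) powr (1/\<theta>) * \<rho>"] by (meson not_le)
qed

lemma series_block_power_mean_ge_less_2:
  assumes P: "0 < P" "P < 2" and s: "1/4 < s"
  shows "\<exists>c>0. \<forall>a b. 1 \<le> a \<longrightarrow> 2 * a \<le> b \<longrightarrow>
    c * real a powr (1/2 - 2 * s) \<le> power_mean P (series_block s a b)"
proof -
  have "weyl_exponent 3 < 2 * s" using s by (simp add: weyl_exponent_le_4)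
  then obtain K where K: "0 < K" and upper: "\<And>a b. 1 \<le> a \<Longrightarrow>
      power_mean 3 (series_block s a b) \<le> K * (weyl_growth 3 a * real a powr (-2 * s))"
    using series_block_power_mean_le[of 3 s] by auto
  define e where "e = 2 powr (-2 * s)"
  define \<theta> where "\<theta> = (1/6) / (1/P - 1/3)"
  have "1/2 < 1/P" using P by (simp add: field_simps)
  then have \<theta>: "0 < \<theta>" "\<theta> < 1" and "\<theta> * (1/P - 1/3) = 1/6" by (auto simp: \<theta>_def)
  then have "\<theta>/P - \<theta>/3 = 1/6" by (simp only: right_diff_distrib times_divide_eq_right mult_1_right)
  then have exponents: "1/2 = \<theta>/P + (1 - \<theta>)/3" unfolding diff_divide_distrib by linarith
  have "(e / K powr (1 - \<theta>)) powr (1/\<theta>) * real a powr (1/2 - 2 * s) \<le> power_mean P (series_block s a b)"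
    if a: "1 \<le> a" "2 * a \<le> b" for a b
  proof (rule interpolation_lower_bound)
    define \<rho> where "\<rho> = real a powr (1/2 - 2 * s)"
    have upper_3: "power_mean 3 (series_block s a b) \<le> K * \<rho>"
      using upper[OF a(1), of b] by (simp add: weyl_growth_less_4 \<rho>_def flip: powr_add)
    have "e * \<rho> \<le> power_mean 2 (series_block s a b)"
      unfolding e_def \<rho>_def using s a by (intro series_block_power_mean_2_ge) auto
    also have "\<dots> \<le> power_mean P (series_block s a b) powr \<theta>
        * power_mean 3 (series_block s a b) powr (1 - \<theta>)"
      using P \<theta> exponents by (intro power_mean_interpolation continuous_intros) auto
    also have "\<dots> \<le> power_mean P (series_block s a b) powr \<theta> * (K * \<rho>) powr (1 - \<theta>)"
      using \<theta> upper_3 by (intro mult_left_mono powr_mono2) auto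
    finally show "e * real a powr (1/2 - 2 * s)
        \<le> power_mean P (series_block s a b) powr \<theta> * (K * real a powr (1/2 - 2 * s)) powr (1 - \<theta>)"
      by (simp only: \<rho>_def)
  qed (use \<theta> K a in \<open>auto simp: e_def\<close>)
  moreover have "0 < (e / K powr (1 - \<theta>)) powr (1/\<theta>)" using K by (simp add: e_def)
  ultimately show ?thesis by blast
qed

lemma one_le_ln:
  fixes x :: real
  assumes "4 \<le> x"
  shows "1 \<le> ln x"
proof -
  have "exp 1 \<le> x" using exp_le assms by linarith
  then show ?thesis using assms by (simp add: ln_ge_iff)
qed

lemma series_block_power_mean_4_ge_growth:
  assumes s: "0 \<le> s" and a: "4 \<le> a" "10 * a \<le> b"
  shows "10 powr (-2 * s) * (1/96) powr (1/4) * (weyl_growth 4 a * real a powr (-2 * s))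
      \<le> power_mean 4 (series_block s a b)"
proof -
  have "1 \<le> ln (real a)" using a by (intro one_le_ln) simp
  then have "((1/96) * (1 + ln a)) powr (1/4) \<le> ((1/48) * ln a) powr (1/4)" by (intro powr_mono2) auto
  then have "10 powr (-2 * s) * (real a powr (1/2 - 2 * s) * ((1/96) powr (1/4) * (1 + ln a) powr (1/4)))
      \<le> 10 powr (-2 * s) * (real a powr (1/2 - 2 * s) * ((1/48) powr (1/4) * ln a powr (1/4)))"
    unfolding powr_mult by (intro mult_left_mono) auto
  also have "\<dots> \<le> power_mean 4 (series_block s a b)"
    using series_block_power_mean_4_ge[OF s a] by (simp only: mult_ac)
  finally show ?thesis
    using powr_add[of "real a" "1/2" "-2 * s"] by (simp add: weyl_growth_4 mult_ac)
qed

lemma series_block_power_mean_ge_growth: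
  assumes P: "0 < P" and s: "weyl_exponent P < 2 * s"
  shows "\<exists>c>0. \<forall>a b. 4 \<le> a \<longrightarrow> 10 * a \<le> b \<longrightarrow>
    c * (weyl_growth P a * real a powr (-2 * s)) \<le> power_mean P (series_block s a b)"
proof -
  have s_gt: "1/4 < s" using s weyl_exponent_ge[of P] by simp
  consider "P < 2" | "2 \<le> P" "P < 4" | "P = 4" | "4 < P" by linarith
  then show ?thesis
  proof cases
    assume "P < 2"
    then obtain c where c: "0 < c" "\<And>a b. 1 \<le> a \<Longrightarrow> 2 * a \<le> b \<Longrightarrow>
        c * real a powr (1/2 - 2 * s) \<le> power_mean P (series_block s a b)"
      using series_block_power_mean_ge_less_2[OF P _ s_gt] by blast
    then show ?thesis using P \<open>P < 2\<close>
      by (intro exI[of _ c]) (auto simp: weyl_growth_less_4 simp flip: powr_add)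
  next
    assume "2 \<le> P" "P < 4"
    have "2 powr (-2 * s) * real a powr (1/2 - 2 * s) \<le> power_mean P (series_block s a b)"
      if "4 \<le> a" "10 * a \<le> b" for a b
      using that s_gt \<open>2 \<le> P\<close>
      by (intro order_trans[OF series_block_power_mean_2_ge power_mean_mono_exponent] continuous_intros) auto
    then show ?thesis using P \<open>P < 4\<close>
      by (intro exI[of _ "2 powr (-2 * s)"]) (auto simp: weyl_growth_less_4 simp flip: powr_add)
  next
    assume "P = 4"
    then show ?thesis using series_block_power_mean_4_ge_growth[of s] s_gt
      by (intro exI[of _ "10 powr (-2 * s) * (1/96) powr (1/4)"]) auto
  next
    assume "4 < P"
    define c where "c = 4 * 2 powr (-2 * s) * 8 powr (- (1 + 1/P))"
    have "c * (weyl_growth P a * real a powr (-2 * s)) \<le> power_mean P (series_block s a b)"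
      if "4 \<le> a" "10 * a \<le> b" for a b
      using series_block_power_mean_ge[of s a b P] \<open>4 < P\<close> s_gt that
      by (simp add: c_def weyl_growth_greater_4 flip: powr_add)
    then show ?thesis by (intro exI[of _ c]) (auto simp: c_def)
  qed
qed

lemma norm_series_block_le:
  assumes s: "1/2 < s" and a: "1 \<le> a"
  shows "norm (series_block s a b x) \<le> 1 / (1 - 1 / (2 * s)) * real a powr (1 - 2 * s)"
proof -
  let ?total = "\<Sum>n\<in>{a..<b}. real n powr (-2 * s)"
  have "norm (series_block s a b x) \<le> ?total"
    unfolding series_block_def using norm_trig_sum_le[of "{a..<b}" "\<lambda>n. real n powr (-2 * s)"] by simp
  also have "\<dots> = power_mean 1 (\<lambda>x. \<Sum>n\<in>{a..<b}. complex_of_real (real n powr (-2 * s)) * 1)"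
    by (simp add: power_mean_def sum_nonneg del: of_real_sum flip: of_real_sum)
  also have "\<dots> \<le> 1 / (1 - 1 / (2 * s)) * real a powr (1 - 2 * s)"
  proof (rule power_mean_powr_weighted_sum_le)
    show "power_mean 1 (\<lambda>x. \<Sum>i\<in>{a..n}. 1 :: complex) \<le> 1 * real n powr 1" if "a \<le> n" for n
      unfolding power_mean_def sum_constant mult_1_right norm_of_nat using a that by simp
  qed (use s a in auto)
  finally show ?thesis .
qed

subsection \<open>The rate function\<close>

definition critical_exponent :: "ennreal \<Rightarrow> real" where
  "critical_exponent p = max (1/4) (1/2 - inv_exp p)"

lemma inv_exp_ennreal: "0 \<le> P \<Longrightarrow> inv_exp (ennreal P) = 1 / P"
  by (simp add: inv_exp_def)

lemma inv_exp_nonneg: "0 \<le> inv_exp p"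
  by (simp add: inv_exp_def)

lemma critical_exponent_ge: "1/4 \<le> critical_exponent p"
  by (simp add: critical_exponent_def)

lemma weyl_exponent_eq_critical: "0 < P \<Longrightarrow> weyl_exponent P = 2 * critical_exponent (ennreal P)"
  by (simp add: weyl_exponent_def critical_exponent_def inv_exp_ennreal max_def)

lemma critical_exponent_eq:
  assumes "0 < p"
  shows "critical_exponent p = (if p \<le> 4 then 1/4 else 1/2 - inv_exp p)"
proof (cases p)
  case (real P)
  then show ?thesis
    using assms ennreal_le_iff[of 4 P]
    by (auto simp: critical_exponent_def inv_exp_ennreal max_def field_simps)
qed (simp add: critical_exponent_def inv_exp_def top_unique)

lemma rate_eq:
  assumes "0 < p"
  shows "rate p s N = real N powr (critical_exponent p - s) * (if p = 4 then ln (real N) powr (1/4) else 1)"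
  using assms by (auto simp: rate_def critical_exponent_eq not_less)

lemma rate_nonneg [simp]: "0 \<le> rate p s N"
  by (simp add: rate_def)

lemma powr_quarter_le:
  fixes t u :: real
  assumes "0 \<le> t" "t \<le> 16 * u"
  shows "t powr (1/4) \<le> 2 * u powr (1/4)"
proof -
  have "t powr (1/4) \<le> (16 * u) powr (1/4)" using assms by (intro powr_mono2) auto
  then show ?thesis using powr_powr[of 2 4 "1/4"] by (simp add: powr_mult)
qed

lemma rate_comparable:
  assumes p: "0 < p"
  shows "\<exists>C>0. \<forall>N M. 4 \<le> N \<longrightarrow> N \<le> M \<longrightarrow> M \<le> 4 * N \<longrightarrow>
    rate p s N \<le> C * rate p s M \<and> rate p s M \<le> C * rate p s N"
proof -
  define e where "e = critical_exponent p - s"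
  define C where "C = 4 powr \<bar>e\<bar> * 2"
  have "rate p s N \<le> C * rate p s M \<and> rate p s M \<le> C * rate p s N"
    if NM: "4 \<le> N" "N \<le> M" "M \<le> 4 * N" for N M
  proof -
    define y where "y = real M / real N"
    have "real M \<le> 4 * real N" using NM(3) by (simp flip: of_nat_le_iff)
    then have y: "1 \<le> y" "y \<le> 4" and M: "real M = y * real N" using NM by (auto simp: y_def divide_le_eq)
    have "y powr e \<le> y powr \<bar>e\<bar>" "y powr (-e) \<le> y powr \<bar>e\<bar>" using y by (auto intro: powr_mono)
    moreover have "y powr \<bar>e\<bar> \<le> 4 powr \<bar>e\<bar>" using y by (intro powr_mono2) auto
    ultimately have y_powr: "y powr e \<le> 4 powr \<bar>e\<bar>" "y powr (-e) \<le> 4 powr \<bar>e\<bar>" by linarith+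
    have "ln (real M) \<le> ln (real N * real N)" using NM
      by (intro ln_mono) (auto simp flip: of_nat_mult intro: order_trans)
    then have ln_le: "0 \<le> ln (real N)" "ln (real N) \<le> ln (real M)" "ln (real M) \<le> 16 * ln (real N)"
      using NM by (auto simp: ln_mult intro: order_trans)
    define rate_log where "rate_log = (\<lambda>n::nat. if p = 4 then ln (real n) powr (1/4) else 1)"
    have rate_log: "rate_log N \<le> 2 * rate_log M" "rate_log M \<le> 2 * rate_log N"
        "0 \<le> rate_log N" "0 \<le> rate_log M"
      using ln_le by (auto simp: rate_log_def intro!: powr_quarter_le)
    have "real N powr e = y powr (-e) * real M powr e"
      using y by (simp add: M powr_mult flip: powr_add)
    then have "real N powr e * rate_log N \<le> (4 powr \<bar>e\<bar> * real M powr e) * (2 * rate_log M)"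
      using y_powr rate_log by (auto intro!: mult_mono)
    moreover have "real M powr e * rate_log M \<le> (4 powr \<bar>e\<bar> * real N powr e) * (2 * rate_log N)"
      unfolding M powr_mult using y_powr rate_log by (auto intro!: mult_mono)
    moreover have "rate p s n = real n powr e * rate_log n" for n
      by (simp add: rate_eq[OF p] e_def rate_log_def)
    ultimately show ?thesis by (simp add: C_def mult_ac)
  qed
  then show ?thesis by (intro exI[of _ C]) (auto simp: C_def)
qed

lemma weyl_growth_comparable_rate:
  assumes P: "0 < P" and a: "4 \<le> a"
  shows "weyl_growth P a * real a powr (-2 * s) \<le> 2 * rate (ennreal P) s (a\<^sup>2)"
    and "rate (ennreal P) s (a\<^sup>2) \<le> 2 * (weyl_growth P a * real a powr (-2 * s))"
proof -
  define growth_log where "growth_log = (if P = 4 then (1 + ln a) powr (1/4) else 1)"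
  define rate_log where "rate_log = (if P = 4 then ln (real (a\<^sup>2)) powr (1/4) else 1)"
  define \<rho> where "\<rho> = real a powr (weyl_exponent P - 2 * s)"
  have ln: "1 \<le> ln (real a)" using a by (intro one_le_ln) simp
  have "growth_log \<le> 2 * rate_log" "rate_log \<le> 2 * growth_log"
    using ln a by (auto simp: growth_log_def rate_log_def ln_realpow intro!: powr_quarter_le)
  then have "\<rho> * growth_log \<le> \<rho> * (2 * rate_log)" "\<rho> * rate_log \<le> \<rho> * (2 * growth_log)"
    by (auto simp: \<rho>_def intro!: mult_left_mono)
  moreover have "weyl_growth P a * real a powr (-2 * s) = \<rho> * growth_log"
    by (simp add: weyl_growth_def growth_log_def \<rho>_def powr_diff powr_minus_divide)
  moreover have "rate (ennreal P) s (a\<^sup>2) = \<rho> * rate_log"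
    using P ennreal_inj[of P 4] a weyl_exponent_eq_critical[OF P]
    by (simp add: rate_eq rate_log_def \<rho>_def powr_powr right_diff_distrib flip: powr_numeral)
  ultimately show "weyl_growth P a * real a powr (-2 * s) \<le> 2 * rate (ennreal P) s (a\<^sup>2)"
    "rate (ennreal P) s (a\<^sup>2) \<le> 2 * (weyl_growth P a * real a powr (-2 * s))" by auto
qed

lemma rate_square_tendsto_0:
  assumes p: "0 < p" and s: "critical_exponent p < s"
  shows "(\<lambda>a. rate p s (a\<^sup>2)) \<longlonglongrightarrow> 0"
proof -
  define \<epsilon> where "\<epsilon> = s - critical_exponent p"
  have \<epsilon>: "0 < \<epsilon>" using s by (simp add: \<epsilon>_def)
  have "((\<lambda>x. x powr - \<epsilon> * ln x powr (1/4)) \<longlongrightarrow> 0) at_top" "((\<lambda>x. x powr - \<epsilon>) \<longlongrightarrow> (0::real)) at_top"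
    using \<epsilon> by real_asymp+
  then have "((\<lambda>x. x powr - \<epsilon> * (if p = 4 then ln x powr (1/4) else 1)) \<longlongrightarrow> 0) at_top"
    by (cases "p = 4") simp_all
  moreover have "filterlim (\<lambda>a. real (a\<^sup>2)) at_top sequentially" by real_asymp
  ultimately have "(\<lambda>a. real (a\<^sup>2) powr - \<epsilon> * (if p = 4 then ln (real (a\<^sup>2)) powr (1/4) else 1)) \<longlonglongrightarrow> 0"
    by (rule filterlim_compose)
  then show ?thesis by (simp only: rate_eq[OF p] \<epsilon>_def minus_diff_eq)
qed

subsection \<open>The quasi-norms of L^p\<close>

lemma Lp_norm_top: "Lp_norm \<infinity> f = Inf {C :: ennreal. AE x in lebesgue_on {0..1}. ennreal (norm (f x)) \<le> C}"
  by (simp add: Lp_norm_def)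

lemma AE_norm_le_Lp_norm_top: "AE x in lebesgue_on {0..1}. ennreal (norm (f x)) \<le> Lp_norm \<infinity> f"
proof -
  let ?A = "{C :: ennreal. AE x in lebesgue_on {0..1}. ennreal (norm (f x)) \<le> C}"
  have "\<infinity> \<in> ?A" by simp
  then have "?A \<noteq> {}" by blast
  from ennreal_Inf_countable_INF[OF this]
  obtain C :: "nat \<Rightarrow> ennreal" where C: "range C \<subseteq> ?A" "Inf ?A = (INF i. C i)" by blast
  then have "AE x in lebesgue_on {0..1}. \<forall>i. ennreal (norm (f x)) \<le> C i"
    by (subst AE_all_countable) auto
  then show ?thesis unfolding Lp_norm_top C(2) by (rule AE_mp) (auto intro!: AE_I2 INF_greatest)
qed

lemma Lp_norm_top_le_iff: "Lp_norm \<infinity> f \<le> C \<longleftrightarrow> (AE x in lebesgue_on {0..1}. ennreal (norm (f x)) \<le> C)"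
proof
  assume "Lp_norm \<infinity> f \<le> C"
  then show "AE x in lebesgue_on {0..1}. ennreal (norm (f x)) \<le> C"
    by (intro AE_mp[OF AE_norm_le_Lp_norm_top[of f] AE_I2]) (auto intro: order_trans)
next
  assume "AE x in lebesgue_on {0..1}. ennreal (norm (f x)) \<le> C"
  then show "Lp_norm \<infinity> f \<le> C" unfolding Lp_norm_top by (intro Inf_lower) simp
qed

lemma Lp_norm_ennreal_le_iff:
  assumes "0 < P" "0 \<le> B"
  shows "Lp_norm (ennreal P) f \<le> ennreal B
    \<longleftrightarrow> (\<integral>\<^sup>+ x. ennreal (norm (f x) powr P) \<partial>lebesgue_on {0..1}) \<le> ennreal (B powr P)"
proof (cases "\<integral>\<^sup>+ x. ennreal (norm (f x) powr P) \<partial>lebesgue_on {0..1}")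
  case (real y)
  have "y powr (1/P) \<le> B \<longleftrightarrow> y \<le> B powr P"
  proof
    assume "y powr (1/P) \<le> B"
    then have "(y powr (1/P)) powr P \<le> B powr P" using assms by (intro powr_mono2) auto
    then show "y \<le> B powr P" using assms real by (simp add: powr_powr)
  next
    assume "y \<le> B powr P"
    then have "y powr (1/P) \<le> (B powr P) powr (1/P)" using assms real by (intro powr_mono2) auto
    then show "y powr (1/P) \<le> B" using assms by (simp add: powr_powr)
  qed
  then show ?thesis using assms real by (simp add: Lp_norm_def)
next
  case top
  then show ?thesis using assms by (simp add: Lp_norm_def top_unique)
qed

lemma nn_integral_norm_powr_continuous:
  fixes g :: "real \<Rightarrow> complex"
  assumes "continuous_on {0..1} g" "0 < P"
  shows "(\<integral>\<^sup>+ x. ennreal (norm (g x) powr P) \<partial>lebesgue_on {0..1}) = ennreal (power_mean P g powr P)"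
proof -
  have "((\<lambda>x. norm (g x) powr P) has_integral power_mean P g powr P) {0..1}"
    using assms by (simp add: power_mean_powr integrable_integral norm_powr_integrable)
  then have "(\<integral>\<^sup>+ x. ennreal (norm (g x) powr P) * indicator {0..1} x \<partial>lborel)
      = ennreal (power_mean P g powr P)"
    by (intro nn_integral_has_integral_lebesgue') auto
  then show ?thesis
    by (subst nn_integral_restrict_space) (auto simp: nn_integral_completion)
qed

lemma Lp_norm_continuous:
  assumes "continuous_on {0..1} g" "0 < P"
  shows "Lp_norm (ennreal P) g = ennreal (power_mean P g)"
  using assms by (simp add: Lp_norm_def nn_integral_norm_powr_continuous powr_powr)

lemma norm_0_le_Lp_norm_top:
  fixes g :: "real \<Rightarrow> complex"
  assumes g: "continuous_on UNIV g"
  shows "ennreal (norm (g 0)) \<le> Lp_norm \<infinity> g"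
proof (cases "Lp_norm \<infinity> g")
  case (real B)
  define C where "C = {x. norm (g x) \<le> B}"
  have C: "closed C" unfolding C_def by (intro closed_Collect_le continuous_intros g)
  have "AE x in lebesgue. x \<in> {0..1} \<longrightarrow> x \<in> C"
    using AE_norm_le_Lp_norm_top[of g] real by (subst (asm) AE_restrict_space_iff) (auto simp: C_def)
  then have "AE x \<in> {0<..<1} in lebesgue. x \<in> C" by (rule AE_mp[OF _ AE_I2]) auto
  from mem_closed_if_AE_lebesgue_open[OF open_greaterThanLessThan C this]
  have "closure {0<..<1} \<subseteq> C" using C by (intro closure_minimal) auto
  moreover have "(0::real) \<in> closure {0<..<1}" by simp
  ultimately have "0 \<in> C" by blast
  then show ?thesis using real by (simp add: C_def ennreal_leI)
qed simp

lemma Lp_norm_uminus: "Lp_norm p (\<lambda>x. - f x) = Lp_norm p f"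
  by (simp add: Lp_norm_def)

lemma nn_integral_norm_powr_add_le:
  fixes u v :: "'a \<Rightarrow> 'b::{real_normed_vector, second_countable_topology}"
  assumes P: "0 \<le> P" and [measurable]: "u \<in> borel_measurable M" "v \<in> borel_measurable M"
  shows "(\<integral>\<^sup>+ x. ennreal (norm (u x + v x) powr P) \<partial>M)
    \<le> ennreal (2 powr P) * ((\<integral>\<^sup>+ x. ennreal (norm (u x) powr P) \<partial>M) + (\<integral>\<^sup>+ x. ennreal (norm (v x) powr P) \<partial>M))"
proof -
  have "ennreal (norm (u x + v x) powr P)
      \<le> ennreal (2 powr P) * (ennreal (norm (u x) powr P) + ennreal (norm (v x) powr P))" for x
  proof -
    define m where "m = max (norm (u x)) (norm (v x))"
    have "norm (u x + v x) \<le> 2 * m" using norm_triangle_ineq[of "u x" "v x"] by (simp add: m_def)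
    then have "norm (u x + v x) powr P \<le> (2 * m) powr P" using P by (intro powr_mono2) auto
    also have "\<dots> = 2 powr P * m powr P" by (simp add: powr_mult)
    also have "\<dots> \<le> 2 powr P * (norm (u x) powr P + norm (v x) powr P)"
      by (intro mult_left_mono) (auto simp: m_def max_def)
    finally show ?thesis by (simp add: ennreal_plus[symmetric] ennreal_mult[symmetric] del: ennreal_plus)
  qed
  then have "(\<integral>\<^sup>+ x. ennreal (norm (u x + v x) powr P) \<partial>M)
      \<le> (\<integral>\<^sup>+ x. ennreal (2 powr P) * (ennreal (norm (u x) powr P) + ennreal (norm (v x) powr P)) \<partial>M)"
    by (intro nn_integral_mono)
  then show ?thesis by (simp add: nn_integral_cmult nn_integral_add)
qed

definition quasinorm_const :: "ennreal \<Rightarrow> real" where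
  "quasinorm_const p = 2 powr (1 + inv_exp p)"

lemma quasinorm_const_ge: "2 \<le> quasinorm_const p"
  using powr_mono[of 1 "1 + inv_exp p" 2] by (simp add: quasinorm_const_def inv_exp_nonneg)

lemma Lp_norm_top_add_le: "Lp_norm \<infinity> (\<lambda>x. u x + v x) \<le> Lp_norm \<infinity> u + Lp_norm \<infinity> v"
  unfolding Lp_norm_top_le_iff
  using AE_norm_le_Lp_norm_top[of u] AE_norm_le_Lp_norm_top[of v]
proof eventually_elim
  case (elim x)
  have "ennreal (norm (u x + v x)) \<le> ennreal (norm (u x)) + ennreal (norm (v x))"
    unfolding ennreal_plus[OF norm_ge_zero norm_ge_zero, symmetric]
    by (intro ennreal_leI norm_triangle_ineq)
  then show ?case using elim by (meson add_mono order_trans)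
qed

lemma Lp_norm_ennreal_add_le:
  assumes P: "0 < P" and u: "u \<in> borel_measurable lebesgue" and v: "v \<in> borel_measurable lebesgue"
    and B: "0 \<le> B" "Lp_norm (ennreal P) u \<le> ennreal B" "Lp_norm (ennreal P) v \<le> ennreal B"
  shows "Lp_norm (ennreal P) (\<lambda>x. u x + v x) \<le> ennreal (quasinorm_const (ennreal P) * B)"
proof -
  let ?I = "\<lambda>w. \<integral>\<^sup>+ x. ennreal (norm (w x) powr P) \<partial>lebesgue_on {0..1}"
  have "u \<in> borel_measurable (lebesgue_on {0..1})" "v \<in> borel_measurable (lebesgue_on {0..1})"
    using u v by (auto intro: measurable_restrict_space1)
  then have "?I (\<lambda>x. u x + v x) \<le> ennreal (2 powr P) * (?I u + ?I v)"
    using P by (intro nn_integral_norm_powr_add_le) auto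
  also have "\<dots> \<le> ennreal (2 powr P) * (ennreal (B powr P) + ennreal (B powr P))"
    using P B by (intro mult_left_mono add_mono) (auto simp: Lp_norm_ennreal_le_iff)
  also have "\<dots> = ennreal (2 powr (P + 1) * B powr P)"
    by (simp add: powr_add ennreal_plus[symmetric] ennreal_mult[symmetric] del: ennreal_plus)
  also have "2 powr (P + 1) * B powr P = (quasinorm_const (ennreal P) * B) powr P"
    using P by (simp add: quasinorm_const_def inv_exp_ennreal powr_mult powr_powr distrib_right add.commute)
  finally show ?thesis using P B by (subst Lp_norm_ennreal_le_iff) (auto simp: quasinorm_const_def)
qed

lemma Lp_norm_add_le:
  assumes p: "0 < p" and u: "u \<in> borel_measurable lebesgue" and v: "v \<in> borel_measurable lebesgue"
  shows "Lp_norm p (\<lambda>x. u x + v x) \<le> ennreal (quasinorm_const p) * (Lp_norm p u + Lp_norm p v)"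
proof (cases p)
  case (real P)
  have P: "0 < P" using p real by simp
  show ?thesis
  proof (cases "Lp_norm p u" "Lp_norm p v" rule: ennreal2_cases)
    case (real_real A B)
    then have "Lp_norm p (\<lambda>x. u x + v x) \<le> ennreal (quasinorm_const p * (A + B))"
      unfolding real(2) using P u v by (intro Lp_norm_ennreal_add_le) auto
    then show ?thesis using real_real quasinorm_const_ge[of p] by (simp add: ennreal_mult')
  qed (use quasinorm_const_ge[of p] in \<open>auto simp: ennreal_mult_top\<close>)
next
  case top
  have "Lp_norm p (\<lambda>x. u x + v x) \<le> 1 * (Lp_norm p u + Lp_norm p v)"
    using Lp_norm_top_add_le[of u v] top by simp
  also have "\<dots> \<le> ennreal (quasinorm_const p) * (Lp_norm p u + Lp_norm p v)"
    using quasinorm_const_ge[of p] by (intro mult_right_mono) auto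
  finally show ?thesis .
qed

lemma Lp_norm_AE_limit_le:
  assumes p: "0 < p" and B: "0 \<le> B" and u: "\<And>k. u k \<in> borel_measurable lebesgue"
    and u_le: "\<And>k. Lp_norm p (u k) \<le> ennreal B" and lim: "AE x in lebesgue_on {0..1}. (\<lambda>k. u k x) \<longlonglongrightarrow> f x"
  shows "Lp_norm p f \<le> ennreal B"
proof (cases p)
  case (real P)
  have P: "0 < P" using p real by simp
  have [measurable]: "u k \<in> borel_measurable (lebesgue_on {0..1})" for k
    using u by (rule measurable_restrict_space1)
  have "(\<integral>\<^sup>+ x. ennreal (norm (f x) powr P) \<partial>lebesgue_on {0..1})
      = (\<integral>\<^sup>+ x. liminf (\<lambda>k. ennreal (norm (u k x) powr P)) \<partial>lebesgue_on {0..1})"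
  proof (rule nn_integral_cong_AE, rule AE_mp[OF lim AE_I2], intro impI)
    fix x assume "(\<lambda>k. u k x) \<longlonglongrightarrow> f x"
    then have "(\<lambda>k. ennreal (norm (u k x) powr P)) \<longlonglongrightarrow> ennreal (norm (f x) powr P)"
      using P by (intro tendsto_ennrealI tendsto_powr2 tendsto_norm) auto
    then show "ennreal (norm (f x) powr P) = liminf (\<lambda>k. ennreal (norm (u k x) powr P))"
      by (rule lim_imp_Liminf[OF sequentially_bot, symmetric])
  qed
  also have "\<dots> \<le> liminf (\<lambda>k. \<integral>\<^sup>+ x. ennreal (norm (u k x) powr P) \<partial>lebesgue_on {0..1})"
    by (intro nn_integral_liminf) measurable
  also have "\<dots> \<le> limsup (\<lambda>k. \<integral>\<^sup>+ x. ennreal (norm (u k x) powr P) \<partial>lebesgue_on {0..1})"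
    by (intro Liminf_le_Limsup) auto
  also have "\<dots> \<le> ennreal (B powr P)"
    using u_le B P unfolding real(2)
    by (intro Limsup_bounded always_eventually) (simp add: Lp_norm_ennreal_le_iff)
  finally show ?thesis unfolding real(2) using P B by (simp add: Lp_norm_ennreal_le_iff)
next
  case top
  then have "AE x in lebesgue_on {0..1}. \<forall>k. ennreal (norm (u k x)) \<le> ennreal B"
    using u_le Lp_norm_top_le_iff by (simp add: AE_all_countable)
  with lim have "AE x in lebesgue_on {0..1}. ennreal (norm (f x)) \<le> ennreal B"
  proof eventually_elim
    case (elim x)
    then show ?case using B by (intro ennreal_leI LIMSEQ_le_const2[OF tendsto_norm]) auto
  qed
  then show ?thesis using top Lp_norm_top_le_iff by simp
qed

lemma Lp_norm_limit_le:
  assumes p: "0 < p" and u: "\<And>b. u b \<in> borel_measurable lebesgue" and f: "f \<in> borel_measurable lebesgue"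
    and lim: "(\<lambda>b. Lp_norm p (\<lambda>x. u b x - f x)) \<longlonglongrightarrow> 0"
    and u_le: "\<forall>\<^sub>F b in sequentially. Lp_norm p (u b) \<le> B"
  shows "Lp_norm p f \<le> ennreal (quasinorm_const p) * B"
proof (rule tendsto_lowerbound)
  show "(\<lambda>b. ennreal (quasinorm_const p) * (B + Lp_norm p (\<lambda>x. u b x - f x)))
      \<longlonglongrightarrow> ennreal (quasinorm_const p) * B"
    using lim by (intro ennreal_tendsto_cmult) (auto intro!: tendsto_eq_intros)
  show "\<forall>\<^sub>F b in sequentially.
      Lp_norm p f \<le> ennreal (quasinorm_const p) * (B + Lp_norm p (\<lambda>x. u b x - f x))"
    using u_le
  proof eventually_elim
    case (elim b)
    have "(\<lambda>x. - (u b x - f x)) \<in> borel_measurable lebesgue" using u f by measurable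
    then have "Lp_norm p (\<lambda>x. u b x + - (u b x - f x))
        \<le> ennreal (quasinorm_const p) * (Lp_norm p (u b) + Lp_norm p (\<lambda>x. - (u b x - f x)))"
      by (intro Lp_norm_add_le p u)
    also have "\<dots> \<le> ennreal (quasinorm_const p) * (B + Lp_norm p (\<lambda>x. u b x - f x))"
      unfolding Lp_norm_uminus by (intro mult_left_mono add_right_mono elim) auto
    finally show ?case by simp
  qed
qed auto

lemma le_Lp_norm_limit:
  assumes p: "0 < p" and u: "\<And>b. u b \<in> borel_measurable lebesgue" and f: "f \<in> borel_measurable lebesgue"
    and lim: "(\<lambda>b. Lp_norm p (\<lambda>x. u b x - f x)) \<longlonglongrightarrow> 0"
    and u_ge: "\<forall>\<^sub>F b in sequentially. B \<le> Lp_norm p (u b)"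
  shows "B \<le> ennreal (quasinorm_const p) * Lp_norm p f"
proof (rule tendsto_lowerbound)
  show "(\<lambda>b. ennreal (quasinorm_const p) * (Lp_norm p f + Lp_norm p (\<lambda>x. u b x - f x)))
      \<longlonglongrightarrow> ennreal (quasinorm_const p) * Lp_norm p f"
    using lim by (intro ennreal_tendsto_cmult) (auto intro!: tendsto_eq_intros)
  show "\<forall>\<^sub>F b in sequentially.
      B \<le> ennreal (quasinorm_const p) * (Lp_norm p f + Lp_norm p (\<lambda>x. u b x - f x))"
    using u_ge
  proof eventually_elim
    case (elim b)
    have "(\<lambda>x. u b x - f x) \<in> borel_measurable lebesgue" using u f by measurable
    then have "Lp_norm p (\<lambda>x. f x + (u b x - f x))
        \<le> ennreal (quasinorm_const p) * (Lp_norm p f + Lp_norm p (\<lambda>x. u b x - f x))"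
      by (intro Lp_norm_add_le p f)
    then show ?case using elim by simp
  qed
qed auto

subsection \<open>Norms of blocks and their limits\<close>

lemma borel_measurable_series_block [measurable]: "series_block s a b \<in> borel_measurable lebesgue"
proof -
  have "series_block s a b \<in> borel_measurable borel"
    by (intro borel_measurable_continuous_onI continuous_intros)
  then show ?thesis by (intro measurable_completion) simp
qed

lemma rate_top_square: "1 \<le> a \<Longrightarrow> rate \<infinity> s (a\<^sup>2) = real a powr (1 - 2 * s)"
  by (simp add: rate_def inv_exp_def powr_powr right_diff_distrib flip: powr_numeral)

lemma series_block_Lp_norm_le:
  assumes p: "0 < p" and s: "critical_exponent p < s"
  shows "\<exists>C>0. \<forall>a b. 4 \<le> a \<longrightarrow> Lp_norm p (series_block s a b) \<le> ennreal (C * rate p s (a\<^sup>2))"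
proof (cases p)
  case (real P)
  have P: "0 < P" using p real by simp
  then obtain K where K: "0 < K" and upper: "\<And>a b. 1 \<le> a \<Longrightarrow>
      power_mean P (series_block s a b) \<le> K * (weyl_growth P a * real a powr (-2 * s))"
    using series_block_power_mean_le[of P s] s real by (auto simp: weyl_exponent_eq_critical)
  have "Lp_norm p (series_block s a b) \<le> ennreal (K * 2 * rate p s (a\<^sup>2))" if a: "4 \<le> a" for a b
  proof -
    have "power_mean P (series_block s a b) \<le> K * (weyl_growth P a * real a powr (-2 * s))"
      using a by (intro upper) auto
    also have "\<dots> \<le> K * (2 * rate p s (a\<^sup>2))"
      unfolding real(2) using K by (intro mult_left_mono weyl_growth_comparable_rate(1) P a) auto
    finally show ?thesis
      unfolding real(2) using P by (subst Lp_norm_continuous) (auto intro!: continuous_intros ennreal_leI)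
  qed
  then show ?thesis using K by (intro exI[of _ "K * 2"]) auto
next
  case top
  have s_gt: "1/2 < s" using s top by (simp add: critical_exponent_def inv_exp_def)
  define C where "C = 1 / (1 - 1 / (2 * s))"
  have "Lp_norm p (series_block s a b) \<le> ennreal (C * rate p s (a\<^sup>2))" if a: "4 \<le> a" for a b
  proof -
    have "norm (series_block s a b x) \<le> C * rate p s (a\<^sup>2)" for x
      using norm_series_block_le[OF s_gt, of a b x] rate_top_square[of a s] a top by (simp add: C_def)
    then show ?thesis using Lp_norm_top_le_iff[of "series_block s a b"] top by (simp add: ennreal_leI)
  qed
  moreover have "0 < C" using s_gt by (simp add: C_def field_simps)
  ultimately show ?thesis by blast
qed

lemma series_block_Lp_norm_ge:
  assumes p: "0 < p" and s: "critical_exponent p < s"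
  shows "\<exists>c>0. \<forall>a b. 4 \<le> a \<longrightarrow> 10 * a \<le> b \<longrightarrow> ennreal (c * rate p s (a\<^sup>2)) \<le> Lp_norm p (series_block s a b)"
proof (cases p)
  case (real P)
  have P: "0 < P" using p real by simp
  then obtain c where c: "0 < c" and lower: "\<And>a b. 4 \<le> a \<Longrightarrow> 10 * a \<le> b \<Longrightarrow>
      c * (weyl_growth P a * real a powr (-2 * s)) \<le> power_mean P (series_block s a b)"
    using series_block_power_mean_ge_growth[of P s] s real by (auto simp: weyl_exponent_eq_critical)
  have "ennreal (c / 2 * rate p s (a\<^sup>2)) \<le> Lp_norm p (series_block s a b)"
    if ab: "4 \<le> a" "10 * a \<le> b" for a b
  proof -
    have "c / 2 * rate p s (a\<^sup>2) \<le> c / 2 * (2 * (weyl_growth P a * real a powr (-2 * s)))"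
      unfolding real(2) using c by (intro mult_left_mono weyl_growth_comparable_rate(2) P ab) auto
    also have "\<dots> \<le> power_mean P (series_block s a b)" using lower[OF ab] by simp
    finally show ?thesis
      unfolding real(2) using P by (subst Lp_norm_continuous) (auto intro!: continuous_intros ennreal_leI)
  qed
  then show ?thesis using c by (intro exI[of _ "c / 2"]) auto
next
  case top
  have s_nonneg: "0 \<le> s" using s critical_exponent_ge[of p] by linarith
  have "ennreal (2 powr (-2 * s) * rate p s (a\<^sup>2)) \<le> Lp_norm p (series_block s a b)"
    if ab: "4 \<le> a" "10 * a \<le> b" for a b
  proof -
    have "2 powr (-2 * s) * rate p s (a\<^sup>2) \<le> norm (series_block s a b 0)"
      using norm_series_block_0_ge[OF s_nonneg, of a b] rate_top_square[of a s] ab top by simp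
    then have "ennreal (2 powr (-2 * s) * rate p s (a\<^sup>2)) \<le> ennreal (norm (series_block s a b 0))"
      by (rule ennreal_leI)
    also have "\<dots> \<le> Lp_norm p (series_block s a b)"
      using norm_0_le_Lp_norm_top[of "series_block s a b"] top by (simp add: continuous_on_series_block)
    finally show ?thesis .
  qed
  then show ?thesis by (intro exI[of _ "2 powr (-2 * s)"]) auto
qed

lemma series_block_concat:
  assumes "a \<le> b" "b \<le> c"
  shows "series_block s a c x = series_block s a b x + series_block s b c x"
  unfolding series_block_def trig_sum_def using assms by (rule sum.atLeastLessThan_concat[symmetric])

lemma AE_convergent_of_summable_increments:
  fixes u :: "nat \<Rightarrow> 'a \<Rightarrow> 'b::{banach, second_countable_topology}"
  assumes [measurable]: "\<And>k. u k \<in> borel_measurable M" and q: "summable q" "\<And>k. 0 \<le> q k"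
    and increment_le: "\<And>k. (\<integral>\<^sup>+ x. ennreal (norm (u (Suc k) x - u k x)) \<partial>M) \<le> ennreal (q k)"
  shows "AE x in M. convergent (\<lambda>k. u k x)"
proof -
  have "(\<integral>\<^sup>+ x. (\<Sum>k. ennreal (norm (u (Suc k) x - u k x))) \<partial>M)
      = (\<Sum>k. \<integral>\<^sup>+ x. ennreal (norm (u (Suc k) x - u k x)) \<partial>M)"
    by (intro nn_integral_suminf) measurable
  also have "\<dots> \<le> (\<Sum>k. ennreal (q k))" by (intro suminf_le increment_le) auto
  also have "\<dots> = ennreal (\<Sum>k. q k)" using q by (intro suminf_ennreal2) auto
  finally have "(\<integral>\<^sup>+ x. (\<Sum>k. ennreal (norm (u (Suc k) x - u k x))) \<partial>M) \<noteq> \<infinity>" by (auto simp: top_unique)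
  then have "AE x in M. (\<Sum>k. ennreal (norm (u (Suc k) x - u k x))) \<noteq> \<infinity>"
    by (intro nn_integral_PInf_AE) measurable
  then show ?thesis
  proof eventually_elim
    case (elim x)
    then have "summable (\<lambda>k. norm (u (Suc k) x - u k x))" by (intro summable_suminf_not_top) auto
    then have "summable (\<lambda>k. u (Suc k) x - u k x)" by (rule summable_norm_cancel)
    then have "convergent (\<lambda>n. u n x - u 0 x)"
      by (simp add: summable_iff_convergent sum_lessThan_telescope[of "\<lambda>k. u k x"])
    from convergent_add[OF this convergent_const[of "u 0 x"]] show ?case by simp
  qed
qed

lemma series_block_AE_convergent:
  assumes s: "1/4 < s" and a: "1 \<le> a"
  shows "AE x in lebesgue_on {0..1}. convergent (\<lambda>k. series_block s a (a * 2 ^ k) x)"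
proof -
  obtain K where K: "0 < K" and upper: "\<And>a b. 1 \<le> a \<Longrightarrow>
      power_mean 1 (series_block s a b) \<le> K * (weyl_growth 1 a * real a powr (-2 * s))"
    using series_block_power_mean_le[of 1 s] s by (auto simp: weyl_exponent_le_4)
  define q where "q = 2 powr (1/2 - 2 * s)"
  define D where "D = (\<lambda>k. series_block s (a * 2 ^ k) (a * 2 ^ Suc k))"
  have q: "0 \<le> q" "q < 1" using s by (auto simp: q_def powr_less_one)
  have D_le: "power_mean 1 (D k) \<le> K * (real a powr (1/2 - 2 * s) * q ^ k)" for k
  proof -
    have "power_mean 1 (D k) \<le> K * real (a * 2 ^ k) powr (1/2 - 2 * s)"
      using upper[of "a * 2 ^ k"] a by (simp add: D_def weyl_growth_less_4 flip: powr_add)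
    also have "real (a * 2 ^ k) powr (1/2 - 2 * s) = real a powr (1/2 - 2 * s) * q ^ k"
      by (simp add: q_def powr_mult powr_power powr_powr mult.commute flip: powr_realpow)
    finally show ?thesis .
  qed
  show ?thesis
  proof (rule AE_convergent_of_summable_increments)
    show "summable (\<lambda>k. K * (real a powr (1/2 - 2 * s) * q ^ k))"
      using q by (intro summable_mult summable_geometric) auto
    fix k
    show "series_block s a (a * 2 ^ k) \<in> borel_measurable (lebesgue_on {0..1})"
      by (intro measurable_restrict_space1 borel_measurable_series_block)
    show "0 \<le> K * (real a powr (1/2 - 2 * s) * q ^ k)" using K q by simp
    have "series_block s a (a * 2 ^ Suc k) x - series_block s a (a * 2 ^ k) x = D k x" for x
      using series_block_concat[of a "a * 2 ^ k" "a * 2 ^ Suc k" s x] by (simp add: D_def)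
    moreover have "(\<integral>\<^sup>+ x. ennreal (norm (D k x)) \<partial>lebesgue_on {0..1}) = ennreal (power_mean 1 (D k))"
      using nn_integral_norm_powr_continuous[of "D k" 1] by (simp add: D_def continuous_on_series_block)
    ultimately show "(\<integral>\<^sup>+ x.
        ennreal (norm (series_block s a (a * 2 ^ Suc k) x - series_block s a (a * 2 ^ k) x)) \<partial>lebesgue_on {0..1})
        \<le> ennreal (K * (real a powr (1/2 - 2 * s) * q ^ k))"
      using D_le by (simp add: ennreal_leI)
  qed
qed

definition is_block_limit :: "ennreal \<Rightarrow> real \<Rightarrow> nat \<Rightarrow> (real \<Rightarrow> complex) \<Rightarrow> bool" where
  "is_block_limit p s a f \<longleftrightarrow>
     f \<in> borel_measurable lebesgue \<and> (\<lambda>b. Lp_norm p (\<lambda>x. series_block s a b x - f x)) \<longlonglongrightarrow> 0"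

lemma block_limit_exists:
  assumes p: "0 < p" and s: "critical_exponent p < s" and a: "4 \<le> a"
  shows "\<exists>f. is_block_limit p s a f"
proof -
  obtain C where C: "0 < C" and upper:
      "\<And>a b. 4 \<le> a \<Longrightarrow> Lp_norm p (series_block s a b) \<le> ennreal (C * rate p s (a\<^sup>2))"
    using series_block_Lp_norm_le[OF p s] by blast
  define f where "f = (\<lambda>x. lim (\<lambda>k. series_block s a (a * 2 ^ k) x))"
  have f: "f \<in> borel_measurable lebesgue" unfolding f_def by measurable
  have AE_lim: "AE x in lebesgue_on {0..1}. (\<lambda>k. series_block s a (a * 2 ^ k) x) \<longlonglongrightarrow> f x"
    using series_block_AE_convergent[of s a] s critical_exponent_ge[of p] a
    by (simp add: f_def convergent_LIMSEQ_iff)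
  have remainder_le: "Lp_norm p (\<lambda>x. series_block s a b x - f x) \<le> ennreal (C * rate p s (b\<^sup>2))"
    if b: "a \<le> b" for b
  proof (rule Lp_norm_AE_limit_le[OF p])
    show "AE x in lebesgue_on {0..1}. (\<lambda>k. - series_block s b (a * 2 ^ k) x) \<longlonglongrightarrow> series_block s a b x - f x"
      using AE_lim
    proof eventually_elim
      case (elim x)
      have "\<forall>\<^sub>F k in sequentially.
          series_block s a b x - series_block s a (a * 2 ^ k) x = - series_block s b (a * 2 ^ k) x"
      proof (rule eventually_sequentiallyI[of b])
        fix k assume "b \<le> k"
        also have "k \<le> 2 ^ k" by (simp add: less_imp_le)
        also have "\<dots> \<le> a * 2 ^ k" using a by simp
        finally show "series_block s a b x - series_block s a (a * 2 ^ k) x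
            = - series_block s b (a * 2 ^ k) x"
          using series_block_concat[OF b, of "a * 2 ^ k" s x] by simp
      qed
      then show ?case by (rule Lim_transform_eventually[rotated]) (intro tendsto_intros elim)
    qed
  qed (use C a b upper in \<open>auto simp: Lp_norm_uminus\<close>)
  have "(\<lambda>b. ennreal (C * rate p s (b\<^sup>2))) \<longlonglongrightarrow> ennreal (C * 0)"
    by (intro tendsto_ennrealI tendsto_mult tendsto_const rate_square_tendsto_0 p s)
  then have rate_lim: "(\<lambda>b. ennreal (C * rate p s (b\<^sup>2))) \<longlonglongrightarrow> 0" by simp
  have "\<forall>\<^sub>F b in sequentially. Lp_norm p (\<lambda>x. series_block s a b x - f x) \<le> ennreal (C * rate p s (b\<^sup>2))"
    using remainder_le by (rule eventually_sequentiallyI)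
  then have "(\<lambda>b. Lp_norm p (\<lambda>x. series_block s a b x - f x)) \<longlonglongrightarrow> 0"
    by (intro tendsto_sandwich[OF _ _ tendsto_const rate_lim]) auto
  then show ?thesis using f by (auto simp: is_block_limit_def)
qed

subsection \<open>From frequency cutoffs to index cutoffs\<close>

lemma nat_sqrt_ceiling:
  assumes "1 \<le> N"
  obtains a :: nat where "1 \<le> a" "N \<le> a\<^sup>2" "a\<^sup>2 \<le> 4 * N" "\<And>n. N \<le> n\<^sup>2 \<longleftrightarrow> a \<le> n"
proof -
  define a where "a = (LEAST n. N \<le> n\<^sup>2)"
  have "N \<le> N\<^sup>2" by (simp add: power2_eq_square)
  then have N_le: "N \<le> a\<^sup>2" unfolding a_def by (rule LeastI)
  have threshold: "N \<le> n\<^sup>2 \<longleftrightarrow> a \<le> n" for n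
  proof
    assume "a \<le> n"
    then have "a\<^sup>2 \<le> n\<^sup>2" by (rule power_mono) simp
    then show "N \<le> n\<^sup>2" using N_le by linarith
  qed (simp add: a_def Least_le)
  obtain k where k: "a = Suc k" using N_le assms by (cases a) auto
  have "a\<^sup>2 \<le> 4 * N"
  proof (cases "k = 0")
    case False
    then have "a\<^sup>2 \<le> (2 * k)\<^sup>2" using k by (intro power_mono) auto
    moreover have "k\<^sup>2 < N" using threshold[of k] k by auto
    ultimately show ?thesis by (simp add: power_mult_distrib)
  qed (use k assms in simp)
  then show ?thesis using that[of a] k N_le threshold by simp
qed

lemma tail_partial_eq_series_block:
  assumes "1 \<le> a" "\<And>n. N \<le> n\<^sup>2 \<longleftrightarrow> a \<le> n"
  shows "tail_partial s N M = series_block s a (Suc M)"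
proof
  fix x
  have "{n. 1 \<le> n \<and> n \<le> M \<and> N \<le> n\<^sup>2} = {a..<Suc M}" unfolding assms(2) using assms(1) by auto
  then show "tail_partial s N M x = series_block s a (Suc M) x"
    by (simp add: tail_partial_def series_block_def trig_sum_def unit_char_def mult.assoc)
qed

lemma is_tail_limit_eq_is_block_limit:
  assumes "1 \<le> a" "\<And>n. N \<le> n\<^sup>2 \<longleftrightarrow> a \<le> n"
  shows "is_tail_limit p s N f \<longleftrightarrow> is_block_limit p s a f"
  unfolding is_tail_limit_def is_block_limit_def tail_partial_eq_series_block[OF assms]
  using filterlim_sequentially_Suc[of "\<lambda>b. Lp_norm p (\<lambda>x. series_block s a b x - f x)"] by simp

lemma tail_limit_cutoff:
  assumes "16 \<le> N"
  obtains a where "4 \<le> a" "N \<le> a\<^sup>2" "a\<^sup>2 \<le> 4 * N" "\<And>p s f. is_tail_limit p s N f \<longleftrightarrow> is_block_limit p s a f"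
proof -
  obtain a where a: "1 \<le> a" "N \<le> a\<^sup>2" "a\<^sup>2 \<le> 4 * N" and threshold: "\<And>n. N \<le> n\<^sup>2 \<longleftrightarrow> a \<le> n"
    using nat_sqrt_ceiling[of N] assms by auto
  have "4\<^sup>2 \<le> a\<^sup>2" using a(2) assms by simp
  then have "4 \<le> a" by (rule power2_le_imp_le) simp
  then show ?thesis using a(2,3) is_tail_limit_eq_is_block_limit[OF a(1) threshold] by (rule that)
qed

lemma tail_limit_exists:
  assumes "0 < p" "critical_exponent p < s" "16 \<le> N"
  shows "\<exists>f. is_tail_limit p s N f"
proof -
  obtain a where "4 \<le> a" "N \<le> a\<^sup>2" "a\<^sup>2 \<le> 4 * N" "\<And>p s f. is_tail_limit p s N f \<longleftrightarrow> is_block_limit p s a f"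
    using assms(3) by (rule tail_limit_cutoff) blast
  then show ?thesis using block_limit_exists[OF assms(1,2)] by simp
qed

lemma tail_limit_Lp_norm_le:
  assumes p: "0 < p" and s: "critical_exponent p < s"
  shows "\<exists>C>0. \<forall>N\<ge>16. \<forall>f. is_tail_limit p s N f \<longrightarrow> Lp_norm p f \<le> ennreal (C * rate p s N)"
proof -
  obtain C where C: "0 < C" and block_le:
      "\<And>a b. 4 \<le> a \<Longrightarrow> Lp_norm p (series_block s a b) \<le> ennreal (C * rate p s (a\<^sup>2))"
    using series_block_Lp_norm_le[OF p s] by blast
  obtain K where K: "0 < K" and comparable: "\<And>N M. 4 \<le> N \<Longrightarrow> N \<le> M \<Longrightarrow> M \<le> 4 * N \<Longrightarrow> rate p s M \<le> K * rate p s N"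
    using rate_comparable[OF p, of s] by blast
  have "Lp_norm p f \<le> ennreal (quasinorm_const p * (C * K) * rate p s N)"
    if N: "16 \<le> N" and f: "is_tail_limit p s N f" for N f
  proof -
    obtain a where a: "4 \<le> a" "N \<le> a\<^sup>2" "a\<^sup>2 \<le> 4 * N"
      and cutoff: "\<And>p s f. is_tail_limit p s N f \<longleftrightarrow> is_block_limit p s a f"
      using N by (rule tail_limit_cutoff) blast
    have "Lp_norm p f \<le> ennreal (quasinorm_const p) * ennreal (C * rate p s (a\<^sup>2))"
      using f[unfolded cutoff is_block_limit_def] block_le[OF a(1)]
      by (intro Lp_norm_limit_le[OF p borel_measurable_series_block]) auto
    also have "\<dots> = ennreal (quasinorm_const p * (C * rate p s (a\<^sup>2)))"
      using quasinorm_const_ge[of p] C by (simp add: ennreal_mult')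
    also have "\<dots> \<le> ennreal (quasinorm_const p * (C * (K * rate p s N)))"
      using quasinorm_const_ge[of p] C comparable[of N "a\<^sup>2"] a N by (intro ennreal_leI mult_left_mono) auto
    finally show ?thesis by (simp add: mult.assoc)
  qed
  then show ?thesis using C K quasinorm_const_ge[of p]
    by (intro exI[of _ "quasinorm_const p * (C * K)"]) auto
qed

lemma tail_limit_Lp_norm_ge:
  assumes p: "0 < p" and s: "critical_exponent p < s"
  shows "\<exists>c>0. \<forall>N\<ge>16. \<forall>f. is_tail_limit p s N f \<longrightarrow> ennreal (c * rate p s N) \<le> Lp_norm p f"
proof -
  obtain c where c: "0 < c" and block_ge:
      "\<And>a b. 4 \<le> a \<Longrightarrow> 10 * a \<le> b \<Longrightarrow> ennreal (c * rate p s (a\<^sup>2)) \<le> Lp_norm p (series_block s a b)"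
    using series_block_Lp_norm_ge[OF p s] by blast
  obtain K where K: "0 < K" and comparable: "\<And>N M. 4 \<le> N \<Longrightarrow> N \<le> M \<Longrightarrow> M \<le> 4 * N \<Longrightarrow> rate p s N \<le> K * rate p s M"
    using rate_comparable[OF p, of s] by blast
  define T where "T = quasinorm_const p"
  have T: "0 < T" using quasinorm_const_ge[of p] by (simp add: T_def)
  have "ennreal (c / (K * T) * rate p s N) \<le> Lp_norm p f"
    if N: "16 \<le> N" and f: "is_tail_limit p s N f" for N f
  proof -
    obtain a where a: "4 \<le> a" "N \<le> a\<^sup>2" "a\<^sup>2 \<le> 4 * N"
      and cutoff: "\<And>p s f. is_tail_limit p s N f \<longleftrightarrow> is_block_limit p s a f"
      using N by (rule tail_limit_cutoff) blast
    have "ennreal (c * rate p s (a\<^sup>2)) \<le> ennreal T * Lp_norm p f"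
      unfolding T_def using f[unfolded cutoff is_block_limit_def] block_ge[OF a(1)]
      by (intro le_Lp_norm_limit[OF p borel_measurable_series_block] eventually_sequentiallyI[of "10 * a"]) auto
    then have "ennreal (1/T) * ennreal (c * rate p s (a\<^sup>2)) \<le> ennreal (1/T) * (ennreal T * Lp_norm p f)"
      by (intro mult_left_mono) auto
    also have "\<dots> = Lp_norm p f" using T by (simp add: mult.assoc[symmetric] ennreal_mult'[symmetric])
    finally have block_bound: "ennreal (1/T * (c * rate p s (a\<^sup>2))) \<le> Lp_norm p f" using T
      by (subst ennreal_mult') auto
    have "c / (K * T) * rate p s N \<le> c / (K * T) * (K * rate p s (a\<^sup>2))"
      using c K T comparable[of N "a\<^sup>2"] a N by (intro mult_left_mono) auto
    also have "\<dots> = 1/T * (c * rate p s (a\<^sup>2))" using K by simp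
    finally show ?thesis using block_bound by (meson ennreal_leI order_trans)
  qed
  then show ?thesis using c K T by (intro exI[of _ "c / (K * T)"]) auto
qed

theorem theorem5p1:
  fixes p :: ennreal and s :: real
  assumes "0 < p"
    and "p \<le> 4 \<Longrightarrow> s > 1/4"
    and "p > 4 \<Longrightarrow> s > 1/2 - inv_exp p"
  shows "\<exists>c C N0. 0 < c \<and> 0 < C \<and>
           (\<forall>N \<ge> N0.
              (\<exists>f. is_tail_limit p s N f) \<and>
              (\<forall>f. is_tail_limit p s N f \<longrightarrow>
                   ennreal (c * rate p s N) \<le> Lp_norm p f \<and>
                   Lp_norm p f \<le> ennreal (C * rate p s N)))"
proof -
  have s: "critical_exponent p < s"
    using assms by (simp add: critical_exponent_eq not_le)
  obtain c where "0 < c" "\<forall>N\<ge>16. \<forall>f. is_tail_limit p s N f \<longrightarrow> ennreal (c * rate p s N) \<le> Lp_norm p f"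
    using tail_limit_Lp_norm_ge[OF assms(1) s] by blast
  moreover obtain C where "0 < C"
      "\<forall>N\<ge>16. \<forall>f. is_tail_limit p s N f \<longrightarrow> Lp_norm p f \<le> ennreal (C * rate p s N)"
    using tail_limit_Lp_norm_le[OF assms(1) s] by blast
  ultimately show ?thesis
    using tail_limit_exists[OF assms(1) s] by (intro exI[of _ c] exI[of _ C] exI[of _ 16]) auto
qed

end
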